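(* Let $\Omega\subset\mathbb{C}^n$ be a smoothly bounded strongly pseudoconvex domain. For each $r\in(0,1)$, $1\le p<\infty$ and $\alpha>-1$ there exist $C,q>0$ such that, for $\gamma\in(0,1]$ and $s\in(0,1)$, if $s<C^{-1}\gamma^q$ and $\{a_j\}_{j=1}^\infty$ is any sequence in $\Omega$ satisfying $$\inf_{z\in\Omega}\frac{\left|\left(\bigcup_{j=1}^\infty Y(a_j,s)\right)\cap Y(z,r)\right|}{|Y(z,r)|}\ge\gamma,$$ then $$\|f\|_{L^p_\alpha(\Omega)}^p\le C\sum_{j=1}^\infty|f(a_j)|^p\operatorname{dist}(a_j,\partial\Omega)^{n+1+\alpha}$$ for all $f\in A^p_\alpha(\Omega)$.
   Context: Domain: $\Omega\subset\mathbb{C}^n$ is a bounded domain with smooth defining function $\rho$, i.e. $\Omega=\{\rho<0\}$, $\nabla\rho\ne0$ on $\partial\Omega$, and $\rho$ is strictly plurisubharmonic; $\rho$ is fixed. $|\cdot|$ of a set is Lebesgue measure on $\mathbb{C}^n\equiv\mathbb{R}^{2n}$, $dA$ the volume element; $\operatorname{dist}$ is Euclidean distance. Kobayashi distance: $F_K(z,\xi)=\inf\{\alpha>0:\exists\,\phi:\mathbb{D}\to\Omega \text{ holomorphic},\ \phi(0)=z,\ \phi'(0)=\xi/\alpha\}$ and $d(z,w)=\inf\int_0^1F_K(\gamma(t),\gamma'(t))\,dt$ over $C^1$ curves $\gamma:[0,1]\to\Omega$ from $z$ to $w$ (on the unit disc this is the Poincaré distance with $d(0,\zeta)=\tanh^{-1}|\zeta|$).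 $Y(w,r)=\{z\in\Omega:d(z,w)<\tanh^{-1}r\}$, $0<r<1$. Spaces: $\|f\|_{L^p_\alpha(\Omega)}^p=\int_\Omega|f|^p|\rho|^\alpha dA$; $A^p_\alpha(\Omega)$ is the space of holomorphic functions on $\Omega$ with finite $L^p_\alpha(\Omega)$ norm. *)

theory Defs
  imports "HOL-Complex_Analysis.Complex_Analysis"
begin

primrec Ck_on :: "nat \<Rightarrow> ('a::real_normed_vector \<Rightarrow> 'b::real_normed_vector) \<Rightarrow> 'a set \<Rightarrow> bool" where
  "Ck_on 0 f U \<longleftrightarrow> continuous_on U f"
| "Ck_on (Suc k) f U \<longleftrightarrow>
     (\<forall>x\<in>U. f differentiable (at x)) \<and>
     (\<forall>v. Ck_on k (\<lambda>x. frechet_derivative f (at x) v) U)"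

definition smooth_on :: "('a::real_normed_vector \<Rightarrow> 'b::real_normed_vector) \<Rightarrow> 'a set \<Rightarrow> bool" where
  "smooth_on f U \<longleftrightarrow> (\<forall>k. Ck_on k f U)"

text \<open>
  Wirtinger derivatives: \<open>axis j 1\<close> and \<open>axis j \<i>\<close> are the real directions
  \<open>x\<^sub>j\<close> and \<open>y\<^sub>j\<close> of the coordinate \<open>z\<^sub>j = x\<^sub>j + \<i> y\<^sub>j\<close>.
\<close>

definition dz :: "'n \<Rightarrow> (complex^'n::finite \<Rightarrow> complex) \<Rightarrow> complex^'n \<Rightarrow> complex" where
  "dz j f z = (frechet_derivative f (at z) (axis j 1)
               - \<i> * frechet_derivative f (at z) (axis j \<i>)) / 2"

definition dzbar :: "'n \<Rightarrow> (complex^'n::finite \<Rightarrow> complex) \<Rightarrow> complex^'n \<Rightarrow> complex" where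
  "dzbar j f z = (frechet_derivative f (at z) (axis j 1)
                  + \<i> * frechet_derivative f (at z) (axis j \<i>)) / 2"

definition levi_form :: "(complex^'n::finite \<Rightarrow> real) \<Rightarrow> complex^'n \<Rightarrow> complex^'n \<Rightarrow> complex" where
  "levi_form \<rho> z w =
     (\<Sum>j\<in>UNIV. \<Sum>k\<in>UNIV. dz j (dzbar k (\<lambda>x. complex_of_real (\<rho> x))) z * w $ j * cnj (w $ k))"

text \<open>
  Only meant for \<open>C\<^sup>2\<close> functions on an open set; there the Levi form is real-valued,
  so that taking the real part loses nothing.
\<close>

definition strictly_psh_on :: "(complex^'n::finite \<Rightarrow> real) \<Rightarrow> (complex^'n) set \<Rightarrow> bool" where
  "strictly_psh_on \<rho> U \<longleftrightarrow> (\<forall>z\<in>U. \<forall>w. w \<noteq> 0 \<longrightarrow> 0 < Re (levi_form \<rho> z w))"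

text \<open>
  The defining function need only be smooth and strictly plurisubharmonic on some open
  neighbourhood of the closed domain; its values elsewhere are irrelevant.
\<close>

definition strongly_pseudoconvex :: "(complex^'n::finite) set \<Rightarrow> (complex^'n \<Rightarrow> real) \<Rightarrow> bool" where
  "strongly_pseudoconvex \<Omega> \<rho> \<longleftrightarrow>
     open \<Omega> \<and> connected \<Omega> \<and> \<Omega> \<noteq> {} \<and> bounded \<Omega> \<and>
     (\<exists>U. open U \<and> closure \<Omega> \<subseteq> U \<and> smooth_on \<rho> U \<and> strictly_psh_on \<rho> U \<and>
          \<Omega> = {z \<in> U. \<rho> z < 0}) \<and>
     (\<forall>z\<in>frontier \<Omega>. \<exists>g. GDERIV \<rho> z :> g \<and> g \<noteq> 0)"

definition holomorphic_Cn :: "(complex^'n::finite \<Rightarrow> complex) \<Rightarrow> (complex^'n) set \<Rightarrow> bool" where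
  "holomorphic_Cn f \<Omega> \<longleftrightarrow>
     (\<forall>z\<in>\<Omega>. \<exists>f'. (f has_derivative f') (at z) \<and> (\<forall>c v. f' (c *s v) = c * f' v))"

definition holomorphic_discs :: "(complex^'n::finite) set \<Rightarrow> (complex \<Rightarrow> complex^'n) set" where
  "holomorphic_discs \<Omega> =
     {\<phi>. (\<forall>i. (\<lambda>\<zeta>. \<phi> \<zeta> $ i) holomorphic_on ball 0 1) \<and> \<phi> ` ball 0 1 \<subseteq> \<Omega>}"

definition kobayashi_metric :: "(complex^'n::finite) set \<Rightarrow> complex^'n \<Rightarrow> complex^'n \<Rightarrow> real" where
  "kobayashi_metric \<Omega> z \<xi> =
     Inf {\<alpha>. \<alpha> > 0 \<and> (\<exists>\<phi>\<in>holomorphic_discs \<Omega>. \<phi> 0 = z \<and>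
              (\<forall>i. deriv (\<lambda>\<zeta>. \<phi> \<zeta> $ i) 0 = \<xi> $ i / complex_of_real \<alpha>))}"

text \<open>
  \<open>\<gamma>'\<close> is the derivative of the curve \<open>\<gamma>\<close>, one-sided at the end points.
\<close>

definition kobayashi_dist :: "(complex^'n::finite) set \<Rightarrow> complex^'n \<Rightarrow> complex^'n \<Rightarrow> real" where
  "kobayashi_dist \<Omega> z w =
     Inf {LBINT t:{0..1}. kobayashi_metric \<Omega> (\<gamma> t) (\<gamma>' t) | \<gamma> \<gamma>'.
            (\<forall>t\<in>{0..1}. (\<gamma> has_vector_derivative \<gamma>' t) (at t within {0..1})) \<and>
            continuous_on {0..1} \<gamma>' \<and> \<gamma> ` {0..1} \<subseteq> \<Omega> \<and> \<gamma> 0 = z \<and> \<gamma> 1 = w}"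

definition kobayashi_ball :: "(complex^'n::finite) set \<Rightarrow> complex^'n \<Rightarrow> real \<Rightarrow> (complex^'n) set" where
  "kobayashi_ball \<Omega> w r = {z \<in> \<Omega>. kobayashi_dist \<Omega> z w < artanh r}"

definition Lp_norm_pow ::
  "(complex^'n::finite) set \<Rightarrow> (complex^'n \<Rightarrow> real) \<Rightarrow> real \<Rightarrow> real \<Rightarrow> (complex^'n \<Rightarrow> complex) \<Rightarrow> ennreal" where
  "Lp_norm_pow \<Omega> \<rho> p \<alpha> f =
     (\<integral>\<^sup>+z\<in>\<Omega>. ennreal (cmod (f z) powr p * \<bar>\<rho> z\<bar> powr \<alpha>) \<partial>lebesgue)"

definition bergman_space ::
  "(complex^'n::finite) set \<Rightarrow> (complex^'n \<Rightarrow> real) \<Rightarrow> real \<Rightarrow> real \<Rightarrow> (complex^'n \<Rightarrow> complex) set" where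
  "bergman_space \<Omega> \<rho> p \<alpha> = {f. holomorphic_Cn f \<Omega> \<and> Lp_norm_pow \<Omega> \<rho> p \<alpha> f < \<infinity>}"

end

theory Submission
  imports Defs
begin

text \<open>
  With \<open>\<delta> = - \<rho>\<close> and \<open>\<ell>\<^sub>z = 2 \<partial>\<rho>(z)\<close>, the Kobayashi metric at \<open>z\<close> is comparable with the norm
  \<open>M\<^sub>z(v) = \<bar>\<ell>\<^sub>z v\<bar> / \<delta>(z) + \<bar>v\<bar> / \<delta>(z)\<^sup>1\<^sup>/\<^sup>2\<close>: affine discs give the upper bound, and the mean value
  inequality for \<open>\<rho> - \<kappa> \<bar>\<cdot> - z\<bar>\<^sup>2\<close> along a holomorphic disc gives the lower bound. Hence small
  Kobayashi balls are comparable with the balls of \<open>M\<^sub>z\<close> (polyballs), whose volume is at most of order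
  \<open>\<delta>(z)\<^sup>n\<^sup>+\<^sup>1\<close>, and \<open>Y(z, r)\<close> lies in the set of points reached from \<open>z\<close> by a fixed number of small steps.

  Points at which \<open>\<bar>f\<bar>\<^sup>p\<close> is much smaller than its mean over a neighbourhood carry at most half of the
  norm. At any other point \<open>z\<close> a Remez-type inequality, obtained from a one-variable estimate on complex
  lines, shows that \<open>f\<close> is small relative to \<open>f(z)\<close> only on a set of small density, so some sample
  points \<open>a\<^sub>j\<close> near \<open>z\<close> have \<open>\<bar>f(a\<^sub>j)\<bar>\<close> not small. The powers of \<open>\<gamma>\<close> lost in this way are recovered from
  the number of such sample points.
\<close>

subsection \<open>Small values of holomorphic functions on the disc\<close>

text \<open>The obstacle is uniformity. The constants of a Remez inequality depend on how fast the
  function grows near \<open>z\<close>, and beyond a finite norm nothing is known about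
  \<open>f\<close>. Where \<open>\<bar>f(z)\<bar>^p\<close> is at least a fixed fraction of its
  neighbourhood mean, the growth is bounded: the mean controls a supremum \<open>H\<close> of
  \<open>\<bar>f\<bar>\<close> near \<open>z\<close>, so
  \<open>\<bar>f(z)\<bar> \<ge> 2^-N H\<close> with \<open>N\<close> independent of
  \<open>z\<close>, \<open>f\<close> and the sample points. The remaining points are absorbed into
  the left-hand side, which is legitimate because the norm of a member of the Bergman space is
  finite. A second difficulty is that the Remez inequality lives in one small polyball, while
  \<open>Y(z, r)\<close> may be large. It is therefore carried along chains of small steps, and each
  step enlarges the exponent; this is why \<open>q\<close> depends on \<open>r\<close> and is not
  explicit. The analysis is carried out for an abstract family of slowly varying norms. Volumes
  enter it only relative to the unit balls of these norms, so that the depth appears at the very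
  end, through an upper bound for those volumes.\<close>

lemma circle_mean_value:
  assumes f: "f holomorphic_on ball 0 1" and R: "0 < R" "R < 1"
  shows "((\<lambda>t. f (of_real R * cis (2 * pi * t))) has_integral f 0) {0..1}"
proof -
  have "continuous_on (cball 0 R) f" "f holomorphic_on ball 0 R"
    using f R by (auto intro!: holomorphic_on_imp_continuous_on intro: holomorphic_on_subset)
  then have "((\<lambda>u. f u / (u - 0)) has_contour_integral (2 * of_real pi * \<i> * f 0)) (circlepath 0 R)"
    by (intro Cauchy_integral_circlepath) (use R in auto)
  then have "((\<lambda>t. f (circlepath 0 R t) / circlepath 0 R t
        * vector_derivative (circlepath 0 R) (at t within {0..1}))
        has_integral (2 * of_real pi * \<i> * f 0)) {0..1}"
    by (simp add: has_contour_integral_def)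
  then have "((\<lambda>t. inverse (2 * of_real pi * \<i>) * (f (circlepath 0 R t) / circlepath 0 R t
        * vector_derivative (circlepath 0 R) (at t within {0..1})))
        has_integral inverse (2 * of_real pi * \<i>) * (2 * of_real pi * \<i> * f 0)) {0..1}"
    by (rule has_integral_mult_right)
  moreover have "inverse (2 * of_real pi * \<i>) * (f (circlepath 0 R t) / circlepath 0 R t
        * vector_derivative (circlepath 0 R) (at t within {0..1})) = f (of_real R * cis (2 * pi * t))"
    if "t \<in> {0..1}" for t
    using that R
    by (subst vector_derivative_circlepath01)
      (auto simp: circlepath cis_conv_exp mult_ac field_simps)
  ultimately show ?thesis
    by (subst has_integral_cong[where g="\<lambda>t. inverse (2 * of_real pi * \<i>) * (f (circlepath 0 R t) / circlepath 0 R t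
        * vector_derivative (circlepath 0 R) (at t within {0..1}))"]) (auto simp: field_simps)
qed

lemma holomorphic_divide_zero_at_0:
  assumes f: "f holomorphic_on ball 0 1" "f 0 = 0" and b: "\<And>z. norm z < 1 \<Longrightarrow> norm (f z) \<le> 1"
  obtains h where "h holomorphic_on ball 0 1" "\<And>z. norm z < 1 \<Longrightarrow> f z = z * h z"
    "\<And>z. norm z < 1 \<Longrightarrow> norm (h z) \<le> 1"
proof -
  obtain h where h: "h holomorphic_on ball 0 1" "\<And>z. norm z < 1 \<Longrightarrow> f z = z * h z" "deriv f 0 = h 0"
    using Schwarz3[OF f] by metis
  have "norm (h z) \<le> 1" if z: "norm z < 1" for z
  \<comment> \<open>\<open>Schwarz_Lemma\<close> takes a strict bound, while here the modulus 1 may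
    be attained; it is applied to \<open>x f\<close> with \<open>0 < x < 1\<close>, and
    \<open>x\<close> then tends to 1.\<close>
  proof (rule field_le_mult_one_interval)
    fix x :: real assume x: "0 < x" "x < 1"
    define g where "g = (\<lambda>z. of_real x * f z)"
    have g: "g holomorphic_on ball 0 1" "g 0 = 0"
      unfolding g_def using f by (auto intro!: holomorphic_intros)
    have gb: "norm (g z) < 1" if "norm z < 1" for z
    proof -
      have "x * norm (f z) \<le> x * 1" using b[OF that] x by (intro mult_left_mono) auto
      then have "x * norm (f z) < 1" using x by linarith
      then show ?thesis using x by (simp add: g_def norm_mult)
    qed
    show "x * norm (h z) \<le> 1"
    proof (cases "z = 0")
      case True
      have "deriv g 0 = of_real x * deriv f 0"
        unfolding g_def using f(1)
        by (intro deriv_cmult holomorphic_on_imp_differentiable_at[of f "ball 0 1"]) auto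
      then show ?thesis
        using Schwarz_Lemma(2)[OF g gb, of 0] x True h(3) by (simp add: norm_mult)
    next
      case False
      have "x * (norm z * norm (h z)) \<le> norm z"
        using Schwarz_Lemma(1)[OF g gb, of z] z h(2)[OF z] x by (simp add: g_def norm_mult)
      then have "norm z * (x * norm (h z)) \<le> norm z * 1"
        by (simp add: mult_ac)
      then show ?thesis
        using False by (subst (asm) mult_le_cancel_left_pos) auto
    qed
  qed
  with h(1,2) show thesis using that by blast
qed

text \<open>A disc automorphism moves the zero \<open>a\<close> to the origin, where the Schwarz
  lemma bounds the quotient by 1; so removing a zero does not worsen the bound.\<close>

lemma holomorphic_divide_Blaschke_factor:
  assumes f: "f holomorphic_on ball 0 1" and b: "\<And>z. norm z < 1 \<Longrightarrow> norm (f z) \<le> 1"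
    and a: "norm a < 1" "f a = 0"
  obtains g where "g holomorphic_on ball 0 1"
    "\<And>z. norm z < 1 \<Longrightarrow> f z = (z - a) / (1 - cnj a * z) * g z"
    "\<And>z. norm z < 1 \<Longrightarrow> norm (g z) \<le> 1"
proof -
  define B where "B = Moebius_function 0 a"
  define B' where "B' = Moebius_function 0 (- a)"
  have B: "B holomorphic_on ball 0 1" "B' holomorphic_on ball 0 1"
    using a by (auto simp: B_def B'_def intro: Moebius_function_holomorphic)
  have Bn: "norm (B z) < 1" "norm (B' z) < 1" if "norm z < 1" for z
    using a that by (auto simp: B_def B'_def intro: Moebius_function_norm_lt_1)
  have BB: "B' (B z) = z" if "norm z < 1" for z
    unfolding B_def B'_def using a that by (intro Moebius_function_compose) auto
  have "(f \<circ> B') holomorphic_on ball 0 1"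
    by (rule holomorphic_on_compose_gen[OF B(2) f]) (use Bn in auto)
  moreover have "(f \<circ> B') 0 = 0"
    using a by (simp add: B'_def Moebius_function_def)
  ultimately obtain h where h: "h holomorphic_on ball 0 1"
    "\<And>z. norm z < 1 \<Longrightarrow> (f \<circ> B') z = z * h z" "\<And>z. norm z < 1 \<Longrightarrow> norm (h z) \<le> 1"
    by (rule holomorphic_divide_zero_at_0) (use b Bn in auto)
  show thesis
  proof
    show "(h \<circ> B) holomorphic_on ball 0 1"
      by (rule holomorphic_on_compose_gen[OF B(1) h(1)]) (use Bn in auto)
    show "f z = (z - a) / (1 - cnj a * z) * (h \<circ> B) z" if z: "norm z < 1" for z
      using h(2)[of "B z"] Bn(1)[OF z] BB[OF z] by (simp add: B_def Moebius_function_def)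
    show "norm ((h \<circ> B) z) \<le> 1" if "norm z < 1" for z
      using h(3) Bn that by simp
  qed
qed

text \<open>Harnack's inequality for the nonnegative harmonic function
  \<open>- ln \<bar>f\<bar>\<close> on the disc of radius 1/2. At half the radius the Harnack
  constant is (1 + 1/2) / (1 - 1/2) = 3, which becomes the exponent. A holomorphic logarithm takes
  values in a half-plane; a Cayley transform maps it to the disc, where the Schwarz lemma
  applies.\<close>

lemma zero_free_lower_bound:
  assumes f: "f holomorphic_on ball 0 1" and b: "\<And>z. norm z < 1 \<Longrightarrow> norm (f z) \<le> 1"
    and nz: "\<And>z. norm z < 1/2 \<Longrightarrow> f z \<noteq> 0" and z: "norm z \<le> 1/4"
  shows "norm (f 0) ^ 3 \<le> norm (f z)"
proof -
  have "simply_connected (ball (0::complex) (1/2))"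
    by (intro convex_imp_simply_connected) auto
  moreover have "f holomorphic_on ball 0 (1/2)"
    using f by (rule holomorphic_on_subset) auto
  ultimately obtain g where g: "g holomorphic_on ball 0 (1/2)"
      and fg: "\<And>z. z \<in> ball 0 (1/2) \<Longrightarrow> f z = exp (g z)"
    using nz unfolding simply_connected_eq_holomorphic_log[OF open_ball] by (metis dist_0_norm mem_ball)
  have Reg: "Re (g z) \<le> 0" if "norm z < 1/2" for z
    using b[of z] fg[of z] that by simp
  have "- Re (g z) \<le> 3 * (- Re (g 0)) + e" if e: "e > 0" for e
  proof -
    \<comment> \<open>Since \<open>\<bar>f\<bar> = 1\<close> is allowed, \<open>Re g\<close> may
      vanish; the shift makes the real part strictly positive. It adds \<open>e/2\<close> on the
      left and \<open>3 e/2\<close> on the right, hence the error \<open>e\<close>.\<close>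
    define G where "G = (\<lambda>z. of_real (e/2) - g z)"
    have G: "G holomorphic_on ball 0 (1/2)" unfolding G_def by (intro holomorphic_intros g)
    have ReG: "Re (G z) > 0" if "norm z < 1/2" for z
      using Reg[OF that] e by (simp add: G_def)
    define \<phi> where "\<phi> = (\<lambda>u. (G (u/2) - G 0) / (G (u/2) + cnj (G 0)))"
    have nz': "G (u/2) + cnj (G 0) \<noteq> 0" if "norm u < 1" for u
    proof -
      have "Re (G (u/2) + cnj (G 0)) > 0"
        using ReG[of "u/2"] ReG[of 0] that by simp
      then show ?thesis by (metis less_irrefl zero_complex.sel(1))
    qed
    have G2: "(\<lambda>u. G (u/2)) holomorphic_on ball 0 1"
      using holomorphic_on_compose_gen[OF _ G, of "\<lambda>u. u/2" "ball 0 1"]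
      by (force intro!: holomorphic_intros simp: o_def)
    have \<phi>: "\<phi> holomorphic_on ball 0 1" unfolding \<phi>_def
      using nz' by (auto intro!: holomorphic_intros G2)
    have sq: "(cmod (X - Y))\<^sup>2 = (cmod (X + cnj Y))\<^sup>2 - 4 * Re X * Re Y" for X Y
      unfolding cmod_power2 by (simp add: algebra_simps power2_eq_square)
    have "norm (\<phi> u) < 1" if "norm u < 1" for u
    proof -
      have "(cmod (G (u/2) - G 0))\<^sup>2 < (cmod (G (u/2) + cnj (G 0)))\<^sup>2"
        using sq[of "G (u/2)" "G 0"] ReG[of "u/2"] ReG[of 0] that by simp
      then have "cmod (G (u/2) - G 0) < cmod (G (u/2) + cnj (G 0))"
        by (rule power_less_imp_less_base) simp
      then show ?thesis using nz'[OF that] by (simp add: \<phi>_def norm_divide)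
    qed
    then have "norm (\<phi> (2*z)) \<le> norm (2*z)"
      using z by (intro Schwarz_Lemma[OF \<phi>]) (auto simp: \<phi>_def norm_mult)
    also have "\<dots> \<le> 1/2" using z by (simp add: norm_mult)
    finally have "norm (G z - G 0) \<le> 1/2 * norm (G z + cnj (G 0))"
      using nz'[of "2*z"] z by (simp add: \<phi>_def norm_divide norm_mult field_simps)
    then have "(norm (G z - G 0))\<^sup>2 \<le> (1/2 * norm (G z + cnj (G 0)))\<^sup>2"
      by (rule power_mono) simp
    also have "\<dots> = 1/4 * (norm (G z + cnj (G 0)))\<^sup>2" by (simp add: power2_eq_square)
    finally have "4 * (cmod (G z - G 0))\<^sup>2 \<le> (cmod (G z + cnj (G 0)))\<^sup>2" by simp
    then have "4 * ((Re (G z) - Re (G 0))\<^sup>2 + (Im (G z) - Im (G 0))\<^sup>2)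
      \<le> (Re (G z) + Re (G 0))\<^sup>2 + (Im (G z) - Im (G 0))\<^sup>2"
      unfolding cmod_power2 by simp
    then have "4 * ((Re (G z) - Re (G 0))\<^sup>2) \<le> (Re (G z) + Re (G 0))\<^sup>2"
      using zero_le_power2[of "Im (G z) - Im (G 0)"] unfolding distrib_left by linarith
    then have "(2 * (Re (G z) - Re (G 0)))\<^sup>2 \<le> (Re (G z) + Re (G 0))\<^sup>2" unfolding power_mult_distrib by simp
    then have "2 * (Re (G z) - Re (G 0)) \<le> Re (G z) + Re (G 0)"
      using ReG[of z] ReG[of 0] z by (intro power2_le_imp_le[of "2 * (Re (G z) - Re (G 0))"]) auto
    then show ?thesis by (simp add: G_def)
  qed
  then have "- Re (g z) \<le> 3 * (- Re (g 0))" by (rule field_le_epsilon)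
  then have "exp (3 * Re (g 0)) \<le> exp (Re (g z))" by simp
  also have "exp (3 * Re (g 0)) = exp (Re (g 0)) ^ 3"
    by (metis exp_of_nat_mult of_nat_numeral)
  finally show ?thesis using fg[of 0] fg[of z] z by simp
qed

text \<open>\<open>N\<close> is a budget of halvings of the modulus at 0. Dividing by the Blaschke
  factor of a zero in the disc of radius 1/2 at least doubles that modulus and spends one unit, so
  at most \<open>N\<close> zeros are removed; they form a list because of multiplicities. When no
  zero remains and \<open>k\<close> units are left, \<open>zero_free_lower_bound\<close> yields the
  cube of \<open>(1/2) ^ k\<close>, that is \<open>(1/8) ^ k\<close>. With an empty budget the
  modulus at 0 is 1, and a zero is impossible.\<close>

lemma holomorphic_lower_bound_by_roots:
  assumes "f holomorphic_on ball 0 1" "\<And>z. norm z < 1 \<Longrightarrow> norm (f z) \<le> 1" "(1/2) ^ N \<le> norm (f 0)"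
  shows "\<exists>as. length as \<le> N \<and> (\<forall>z. norm z \<le> 1/4 \<longrightarrow>
    (1/8) ^ (N - length as) * prod_list (map (\<lambda>a. norm (z - a) / 2) as) \<le> norm (f z))"
  using assms
proof (induction N arbitrary: f)
  case (0 f)
  have "f z \<noteq> 0" if "norm z < 1/2" for z
  proof
    assume "f z = 0"
    obtain g where g: "\<And>w. norm w < 1 \<Longrightarrow> f w = (w - z) / (1 - cnj z * w) * g w"
      "\<And>w. norm w < 1 \<Longrightarrow> norm (g w) \<le> 1"
      by (rule holomorphic_divide_Blaschke_factor[OF 0(1,2), of z]) (use \<open>norm z < 1/2\<close> \<open>f z = 0\<close> in auto)
    have "norm (f 0) = norm z * norm (g 0)" using g(1)[of 0] by (simp add: norm_mult)
    also have "\<dots> \<le> 1/2 * 1" using g(2)[of 0] that by (intro mult_mono) auto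
    finally show False using 0(3) by simp
  qed
  then have "norm (f 0) ^ 3 \<le> norm (f z)" if "norm z \<le> 1/4" for z
    using zero_free_lower_bound[OF 0(1,2)] that by blast
  moreover have "1 \<le> norm (f 0) ^ 3" using 0(3) by (simp add: one_le_power)
  ultimately show ?case
    by (intro exI[of _ "[]"]) fastforce
next
  case (Suc N f)
  show ?case
  proof (cases "\<exists>a. norm a < 1/2 \<and> f a = 0")
    case True
    then obtain a where a: "norm a < 1/2" "f a = 0" by blast
    obtain g where g: "g holomorphic_on ball 0 1"
      "\<And>w. norm w < 1 \<Longrightarrow> f w = (w - a) / (1 - cnj a * w) * g w"
      "\<And>w. norm w < 1 \<Longrightarrow> norm (g w) \<le> 1"
      by (rule holomorphic_divide_Blaschke_factor[OF Suc(2,3), of a]) (use a in auto)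
    have "(1/2) * (1/2) ^ N \<le> norm a * norm (g 0)"
      using g(2)[of 0] Suc(4) by (simp add: norm_mult)
    also have "\<dots> \<le> 1/2 * norm (g 0)" using a by (intro mult_right_mono) auto
    finally have "(1/2) ^ N \<le> norm (g 0)" by simp
    from Suc.IH[OF g(1,3) this] obtain as where as: "length as \<le> N"
      "\<And>z. norm z \<le> 1/4 \<Longrightarrow> (1/8) ^ (N - length as) * prod_list (map (\<lambda>a. norm (z - a) / 2) as) \<le> norm (g z)"
      by blast
    have "(1/8) ^ (Suc N - length (a # as)) * prod_list (map (\<lambda>a. norm (z - a) / 2) (a # as)) \<le> norm (f z)"
      if z: "norm z \<le> 1/4" for z
    proof -
      have n1: "norm (1 - cnj a * z) \<le> 2"
      proof -
        have "norm (cnj a * z) \<le> 1 * 1" unfolding norm_mult using a z by (intro mult_mono) auto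
        then show ?thesis using norm_triangle_ineq4[of 1 "cnj a * z"] by simp
      qed
      have n0: "norm (1 - cnj a * z) > 0"
      proof -
        have "norm (cnj a * z) \<le> 1/2 * 1" unfolding norm_mult using a z by (intro mult_mono) auto
        then show ?thesis
          using norm_triangle_ineq2[of 1 "cnj a * z"] unfolding norm_one by linarith
      qed
      have "norm (z - a) / 2 \<le> norm (z - a) / norm (1 - cnj a * z)"
        using n0 n1 by (intro divide_left_mono) auto
      moreover have "norm (f z) = norm (z - a) / norm (1 - cnj a * z) * norm (g z)"
        using g(2)[of z] z by (simp add: norm_mult norm_divide)
      moreover have "prod_list (map (\<lambda>a. norm (z - a) / 2) as) \<ge> 0"
        by (induction as) auto
      ultimately show ?thesis
        using mult_mono[OF _ as(2)[OF z], of "norm (z - a) / 2" "norm (z - a) / norm (1 - cnj a * z)"]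
        by (simp add: mult_ac)
    qed
    with as(1) show ?thesis by (intro exI[of _ "a # as"]) auto
  next
    case False
    then have "norm (f 0) ^ 3 \<le> norm (f z)" if "norm z \<le> 1/4" for z
      using zero_free_lower_bound[OF Suc(2,3)] that by blast
    moreover have "((1/2) ^ Suc N) ^ 3 \<le> norm (f 0) ^ 3"
      using Suc(4) by (intro power_mono) auto
    moreover have "((1/2) ^ Suc N) ^ 3 = (1/8 :: real) ^ Suc N"
      by (subst power_mult[symmetric], subst mult.commute, subst power_mult) (simp add: power3_eq_cube)
    ultimately show ?thesis
      by (intro exI[of _ "[]"]) (auto simp del: power_Suc intro: order_trans)
  qed
qed

lemma prod_list_ge_power:
  assumes "\<And>x. x \<in> set xs \<Longrightarrow> h \<le> x" "0 \<le> (h::real)"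
  shows "h ^ length xs \<le> prod_list xs"
  using assms
proof (induction xs)
  case (Cons x xs)
  then have "h * h ^ length xs \<le> x * prod_list xs"
    by (intro mult_mono) (auto intro: order_trans[of 0 h])
  then show ?case by simp
qed simp

text \<open>A Cartan-type estimate: if a product of \<open>N\<close> factors is below
  \<open>h ^ N\<close>, some factor is below \<open>h\<close>. For \<open>h \<le> 1/8\<close> this
  is not one of the factors \<open>1/8\<close>, so \<open>t\<close> lies within \<open>2 h\<close>
  of the real part of one of at most \<open>N\<close> zeros. For \<open>h > 1/8\<close> the claimed
  bound exceeds the length 1/32 of the interval.\<close>

lemma emeasure_real_small_values_le:
  assumes f: "f holomorphic_on ball 0 1" "\<And>z. norm z < 1 \<Longrightarrow> norm (f z) \<le> 1"
    and N: "(1/2) ^ N \<le> norm (f 0)" "0 < N" and h: "0 < h"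
  shows "emeasure lborel {t::real\<in>{1/32..1/16}. norm (f (of_real t)) < h ^ N} \<le> ennreal (16 * N * h)"
proof (cases "h \<le> 1/8")
  case False
  have "emeasure lborel {t::real\<in>{1/32..1/16}. norm (f (of_real t)) < h ^ N} \<le> emeasure lborel {1/32..1/16::real}"
    by (rule emeasure_mono) auto
  also have "\<dots> = ennreal (1/32)" by simp
  also have "1/32 \<le> 16 * (1::real) * (1/8)" by simp
  also have "\<dots> \<le> 16 * N * h" using N False by (intro mult_mono) auto
  finally show ?thesis by (simp add: ennreal_leI)
next
  case True
  obtain as where as: "length as \<le> N"
    "\<And>z. norm z \<le> 1/4 \<Longrightarrow> (1/8) ^ (N - length as) * prod_list (map (\<lambda>a. norm (z - a) / 2) as) \<le> norm (f z)"
    using holomorphic_lower_bound_by_roots[OF f N(1)] by blast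
  have "{t::real\<in>{1/32..1/16}. norm (f (of_real t)) < h ^ N} \<subseteq> (\<Union>i<length as. {Re (as ! i) - 2*h .. Re (as ! i) + 2*h})"
  proof safe
    fix t :: real assume t: "t \<in> {1/32..1/16}" "norm (f (of_real t)) < h ^ N"
    have "\<exists>a\<in>set as. norm (of_real t - a) / 2 < h"
    proof (rule ccontr)
      assume *: "\<not> ?thesis"
      have "h ^ N = h ^ (N - length as) * h ^ length (map (\<lambda>a. norm (of_real t - a) / 2) as)"
        using as(1) by (simp add: power_add[symmetric])
      also have "\<dots> \<le> (1/8) ^ (N - length as) * prod_list (map (\<lambda>a. norm (of_real t - a) / 2) as)"
        using * h True by (intro mult_mono power_mono prod_list_ge_power) auto
      also have "\<dots> \<le> norm (f (of_real t))" using t by (intro as(2)) auto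
      finally show False using t by simp
    qed
    then obtain a where a: "a \<in> set as" "norm (of_real t - a) < 2 * h" by auto
    have "\<bar>t - Re a\<bar> \<le> norm (of_real t - a)" using abs_Re_le_cmod[of "of_real t - a"] by simp
    moreover obtain i where "i < length as" "a = as ! i" using a(1) by (metis in_set_conv_nth)
    ultimately show "t \<in> (\<Union>i<length as. {Re (as ! i) - 2*h .. Re (as ! i) + 2*h})"
      using a(2) by (intro UN_I[of i]) auto
  qed
  then have "emeasure lborel {t::real\<in>{1/32..1/16}. norm (f (of_real t)) < h ^ N}
      \<le> emeasure lborel (\<Union>i<length as. {Re (as ! i) - 2*h .. Re (as ! i) + 2*h})"
    by (rule emeasure_mono) (auto intro!: sets.finite_UN)
  also have "\<dots> \<le> (\<Sum>i<length as. emeasure lborel {Re (as ! i) - 2*h .. Re (as ! i) + 2*h})"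
    by (rule emeasure_subadditive_finite) auto
  also have "\<dots> = (\<Sum>i<length as. ennreal (4*h))" using h by (intro sum.cong) auto
  also have "\<dots> = ennreal (length as * (4*h))" by (simp add: ennreal_mult' ennreal_of_nat_eq_real_of_nat)
  also have "length as * (4*h) \<le> 16 * N * h" using as(1) h by simp
  finally show ?thesis by (simp add: ennreal_leI)
qed

subsection \<open>Lebesgue measure on complex Euclidean space\<close>

lemma nn_integral_lborel_translate:
  fixes f :: "'a::euclidean_space \<Rightarrow> ennreal"
  assumes [measurable]: "f \<in> borel_measurable borel"
  shows "(\<integral>\<^sup>+x. f (a + x) \<partial>lborel) = (\<integral>\<^sup>+x. f x \<partial>lborel)"
  by (subst lborel_distr_plus[of a, symmetric], subst nn_integral_distr) auto

lemma nn_integral_lborel_scaleR: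
  fixes f :: "'a::euclidean_space \<Rightarrow> ennreal"
  assumes [measurable]: "f \<in> borel_measurable borel" and c: "c \<noteq> 0"
  shows "(\<integral>\<^sup>+x. f x \<partial>lborel) = ennreal (\<bar>c\<bar> ^ DIM('a)) * (\<integral>\<^sup>+x. f (c *\<^sub>R x) \<partial>lborel)"
  by (subst lborel_affine[OF c, of 0])
    (simp add: nn_integral_density nn_integral_distr nn_integral_cmult)

lemma nn_integral_lborel_reflect:
  fixes f :: "'a::euclidean_space \<Rightarrow> ennreal"
  assumes [measurable]: "f \<in> borel_measurable borel"
  shows "(\<integral>\<^sup>+x. f (a - x) \<partial>lborel) = (\<integral>\<^sup>+x. f x \<partial>lborel)"
proof -
  have "(\<integral>\<^sup>+x. f x \<partial>lborel) = (\<integral>\<^sup>+x. f (a + x) \<partial>lborel)"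
    by (simp add: nn_integral_lborel_translate)
  also have "\<dots> = (\<integral>\<^sup>+x. f (a - x) \<partial>lborel)"
    by (subst nn_integral_lborel_scaleR[of _ "-1"]) auto
  finally show ?thesis by simp
qed

text \<open>
  Uniqueness of Haar measure: Tonelli's theorem, applied to \<open>1\<^sub>A(Tx) 1\<^sub>B(y)\<close> for the unit ball \<open>B\<close>,
  shows that the image measure and Lebesgue measure are proportional, and they agree on \<open>B\<close>.
\<close>
lemma nn_integral_lborel_isometry:
  fixes T :: "'a::euclidean_space \<Rightarrow> 'a"
  assumes T: "linear T" "\<And>x. norm (T x) = norm x" and [measurable]: "f \<in> borel_measurable borel"
  shows "(\<integral>\<^sup>+x. f (T x) \<partial>lborel) = (\<integral>\<^sup>+x. f x \<partial>lborel)"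
proof -
  have [measurable]: "T \<in> borel_measurable borel"
    using T(1) by (intro borel_measurable_continuous_onI linear_continuous_on) (simp add: linear_conv_bounded_linear)
  have "surj T"
    using T by (intro linear_injective_imp_surjective) (metis linear_injective_0 norm_eq_zero)+
  then obtain S where S: "\<And>y. T (S y) = y" by (metis surj_f_inv_f)
  define B where "B = ball (0::'a) 1"
  have [measurable]: "B \<in> sets borel" unfolding B_def by simp
  have B: "emeasure lborel B \<noteq> 0" "emeasure lborel B \<noteq> \<infinity>"
    using unit_ball_vol_pos[of "real DIM('a)", OF of_nat_0_le_iff]
    by (simp_all add: B_def emeasure_ball less_imp_neq[THEN not_sym])
  have "emeasure (distr lborel borel T) A = emeasure lborel A" if [measurable]: "A \<in> sets borel" for A
  proof -
    have "emeasure (distr lborel borel T) A * emeasure lborel B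
        = (\<integral>\<^sup>+x. indicator A (T x) * emeasure lborel B \<partial>lborel)"
    proof -
      have "emeasure (distr lborel borel T) A = (\<integral>\<^sup>+x. indicator A (T x) \<partial>lborel)"
        using nn_integral_distr[of T lborel borel "indicator A"] by simp
      then show ?thesis by (simp add: nn_integral_multc)
    qed
    also have "\<dots> = (\<integral>\<^sup>+x. \<integral>\<^sup>+y. indicator A (T x) * indicator B (T x + y) \<partial>lborel \<partial>lborel)"
    proof (rule nn_integral_cong)
      fix x
      have "(\<integral>\<^sup>+y. indicator A (T x) * indicator B (T x + y) \<partial>lborel) = (\<integral>\<^sup>+y. indicator A (T x) * indicator B y \<partial>lborel)"
        by (rule nn_integral_lborel_translate) measurable
      then show "indicator A (T x) * emeasure lborel B = (\<integral>\<^sup>+y. indicator A (T x) * indicator B (T x + y) \<partial>lborel)"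
        by (simp add: nn_integral_cmult)
    qed
    also have "\<dots> = (\<integral>\<^sup>+y. \<integral>\<^sup>+x. indicator A (T x) * indicator B (T x + y) \<partial>lborel \<partial>lborel)"
      by (rule lborel_pair.Fubini') measurable
    also have "\<dots> = (\<integral>\<^sup>+y. \<integral>\<^sup>+x. indicator A (T x - y) * indicator B (T x) \<partial>lborel \<partial>lborel)"
    proof (rule nn_integral_cong)
      fix y
      have *: "T (S (- y) + x) = T x - y" for x
        using T(1) S by (simp add: linear_add)
      have "(\<integral>\<^sup>+x. indicator A (T x) * indicator B (T x + y) \<partial>lborel)
        = (\<integral>\<^sup>+x. indicator A (T (S (- y) + x)) * indicator B (T (S (- y) + x) + y) \<partial>lborel)"
        by (rule nn_integral_lborel_translate[symmetric]) measurable
      then show "(\<integral>\<^sup>+x. indicator A (T x) * indicator B (T x + y) \<partial>lborel) =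
          (\<integral>\<^sup>+x. indicator A (T x - y) * indicator B (T x) \<partial>lborel :: ennreal)"
        unfolding * by simp
    qed
    also have "\<dots> = (\<integral>\<^sup>+x. \<integral>\<^sup>+y. indicator A (T x - y) * indicator B (T x) \<partial>lborel \<partial>lborel)"
      by (rule lborel_pair.Fubini'[symmetric]) measurable
    also have "\<dots> = (\<integral>\<^sup>+x. emeasure lborel A * indicator B (T x) \<partial>lborel)"
    proof (rule nn_integral_cong)
      fix x
      have "(\<integral>\<^sup>+y. indicator A (T x - y) \<partial>lborel) = emeasure lborel A"
        by (subst nn_integral_lborel_reflect) auto
      then show "(\<integral>\<^sup>+y. indicator A (T x - y) * indicator B (T x) \<partial>lborel) = emeasure lborel A * indicator B (T x)"
        by (subst nn_integral_multc) auto
    qed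
    also have "\<dots> = emeasure lborel A * (\<integral>\<^sup>+x. indicator B (T x) \<partial>lborel)"
      by (rule nn_integral_cmult) measurable
    also have "(\<integral>\<^sup>+x. indicator B (T x) \<partial>lborel) = emeasure lborel B"
      using nn_integral_indicator[of B lborel] by (simp add: B_def T(2) indicator_def)
    finally show ?thesis
      using B by (subst (asm) (1 2) mult.commute) (simp add: ennreal_mult_cancel_left)
  qed
  then have "distr lborel borel T = lborel"
    by (intro measure_eqI) auto
  then have "(\<integral>\<^sup>+x. f x \<partial>lborel) = (\<integral>\<^sup>+x. f x \<partial>distr lborel borel T)" by simp
  then show ?thesis by (simp add: nn_integral_distr)
qed

lemma norm_vector_scalar_mult:
  fixes v :: "complex^'n"
  shows "norm (c *s v) = cmod c * norm v"
proof -
  have "norm (c *s v) = L2_set (\<lambda>i. cmod c * cmod (v $ i)) UNIV"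
    unfolding norm_vec_def by (simp only: vector_smult_component norm_mult)
  also have "\<dots> = cmod c * norm v"
    unfolding norm_vec_def by (rule L2_set_right_distrib[symmetric]) simp
  finally show ?thesis .
qed

lemma continuous_on_vector_scalar_mult [continuous_intros]:
  fixes g :: "'a::topological_space \<Rightarrow> complex^'n"
  assumes "continuous_on S f" "continuous_on S g"
  shows "continuous_on S (\<lambda>x. f x *s g x)"
  unfolding vector_scalar_mult_def using assms by (intro continuous_intros)

lemma borel_measurable_vector_scalar_mult [measurable]:
  fixes g :: "'a \<Rightarrow> complex^'n"
  assumes [measurable]: "f \<in> borel_measurable M" "g \<in> borel_measurable M"
  shows "(\<lambda>x. f x *s g x) \<in> borel_measurable M"
proof -
  have "(\<lambda>p::complex \<times> (complex^'n). fst p *s snd p) \<in> borel_measurable borel"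
    by (intro borel_measurable_continuous_onI continuous_intros)
  then have "(\<lambda>p::complex \<times> (complex^'n). fst p *s snd p) \<in> borel \<Otimes>\<^sub>M borel \<rightarrow>\<^sub>M borel"
    by (simp add: borel_prod)
  from measurable_compose[OF _ this, of "\<lambda>x. (f x, g x)" M] show ?thesis by simp
qed

lemma scaleR_eq_vector_scalar_mult: "r *\<^sub>R (v::complex^'n) = complex_of_real r *s v"
  by (simp add: vec_eq_iff scaleR_conv_of_real[where 'a=complex])

lemma nn_integral_lborel_rotate:
  fixes f :: "complex^'n \<Rightarrow> ennreal"
  assumes "f \<in> borel_measurable borel" "cmod c = 1"
  shows "(\<integral>\<^sup>+x. f (c *s x) \<partial>lborel) = (\<integral>\<^sup>+x. f x \<partial>lborel)"
proof (rule nn_integral_lborel_isometry)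
  show "linear ((*s) c :: complex^'n \<Rightarrow> complex^'n)"
    by (intro linearI) (simp_all add: vec_eq_iff algebra_simps)
qed (use assms in \<open>auto simp: norm_vector_scalar_mult\<close>)

text \<open>
  Translating the tube by \<open>\<zeta>u\<close> with \<open>\<bar>\<zeta>\<bar> < R\<close> keeps it inside the ball of radius \<open>2R\<close>, and a point
  lies in few of these translates.
\<close>
lemma emeasure_tube_le:
  fixes l :: "complex^'n \<Rightarrow> complex"
  assumes l: "\<And>x y. l (x + y) = l x + l y" "\<And>a x. l (a *s x) = a * l x"
    and u: "norm u \<le> 1" "\<kappa> \<le> cmod (l u)" "0 < \<kappa>" and R: "0 < R" "0 \<le> d"
  shows "emeasure lborel {v. norm v < R \<and> cmod (l v) < d}
    \<le> ennreal (unit_ball_vol (DIM(complex^'n)) * (2 * R) ^ DIM(complex^'n) * (d / \<kappa>)\<^sup>2 / R\<^sup>2)"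
proof -
  have "linear l" using l by (intro linearI) (auto simp: scaleR_eq_vector_scalar_mult scaleR_conv_of_real)
  then have [measurable]: "l \<in> borel_measurable borel"
    by (intro borel_measurable_continuous_onI linear_continuous_on) (simp add: linear_conv_bounded_linear)
  define T where "T = {v. norm v < R \<and> cmod (l v) < d}"
  have [measurable]: "T \<in> sets borel" unfolding T_def by measurable
  have [measurable]: "ball 0 R \<in> sets (borel :: complex measure)" by simp
  have "ennreal (pi * R\<^sup>2) * emeasure lborel T
      = (\<integral>\<^sup>+\<zeta>. indicator (ball 0 R) (\<zeta>::complex) * emeasure lborel T \<partial>lborel)"
    using R by (subst nn_integral_multc) (auto simp: emeasure_ball unit_ball_vol_2 borel_measurable_indicator)
  also have "\<dots> = (\<integral>\<^sup>+\<zeta>. \<integral>\<^sup>+v. indicator (ball 0 R) \<zeta> * indicator T (- (\<zeta> *s u) + v) \<partial>lborel \<partial>lborel)"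
  proof (rule nn_integral_cong)
    fix \<zeta> :: complex
    have "(\<integral>\<^sup>+v. indicator (ball 0 R) \<zeta> * indicator T (- (\<zeta> *s u) + v) \<partial>lborel)
        = (\<integral>\<^sup>+v. indicator (ball 0 R) \<zeta> * indicator T v \<partial>lborel)"
      by (rule nn_integral_lborel_translate) measurable
    then show "indicator (ball 0 R) \<zeta> * emeasure lborel T
        = (\<integral>\<^sup>+v. indicator (ball 0 R) \<zeta> * indicator T (- (\<zeta> *s u) + v) \<partial>lborel)"
      by (simp add: nn_integral_cmult)
  qed
  also have "\<dots> = (\<integral>\<^sup>+v. \<integral>\<^sup>+\<zeta>. indicator (ball 0 R) \<zeta> * indicator T (- (\<zeta> *s u) + v) \<partial>lborel \<partial>lborel)"
    by (rule lborel_pair.Fubini'[symmetric]) (simp add: split_beta' )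
  \<comment> \<open>Translation by \<open>\<zeta> u\<close> changes \<open>l\<close> by
    \<open>\<zeta> l(u)\<close>. Hence, for fixed \<open>v\<close>, the \<open>\<zeta>\<close> whose
    translate of the tube contains \<open>v\<close> lie in a disc of radius
    \<open>d / \<kappa>\<close> about \<open>l v / l u\<close>.\<close>
  also have "\<dots> \<le> (\<integral>\<^sup>+v. \<integral>\<^sup>+\<zeta>. indicator (ball 0 (2*R)) v * indicator (ball (l v / l u) (d / \<kappa>)) \<zeta> \<partial>lborel \<partial>lborel)"
  proof (intro nn_integral_mono)
    fix v \<zeta>
    have "v \<in> ball 0 (2*R) \<and> \<zeta> \<in> ball (l v / l u) (d / \<kappa>)"
      if \<zeta>: "cmod \<zeta> < R" and v: "- (\<zeta> *s u) + v \<in> T"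
    proof
      have "norm v \<le> norm (\<zeta> *s u) + norm (- (\<zeta> *s u) + v)"
        using norm_triangle_ineq[of "\<zeta> *s u" "- (\<zeta> *s u) + v"] by (simp only: add_minus_cancel)
      also have "norm (\<zeta> *s u) \<le> R * 1"
        unfolding norm_vector_scalar_mult using u \<zeta> R by (intro mult_mono) auto
      finally show "v \<in> ball 0 (2*R)" using v by (simp add: T_def)
      have "l (- (\<zeta> *s u) + v) = l v - \<zeta> * l u"
        using l(1)[of "(- \<zeta>) *s u" v] l(2)[of "- \<zeta>" u] by simp
      then have "cmod (l v - \<zeta> * l u) < d" using v by (simp add: T_def)
      moreover have nz: "l u \<noteq> 0" using u by auto
      then have "l v - \<zeta> * l u = l u * (l v / l u - \<zeta>)" by (simp add: field_simps)
      ultimately have "cmod (l u) * cmod (l v / l u - \<zeta>) < d" by (simp add: norm_mult)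
      moreover have "\<kappa> * cmod (l v / l u - \<zeta>) \<le> cmod (l u) * cmod (l v / l u - \<zeta>)"
        using u by (intro mult_right_mono) auto
      ultimately have "\<kappa> * cmod (l v / l u - \<zeta>) < d" by linarith
      then show "\<zeta> \<in> ball (l v / l u) (d / \<kappa>)"
        using u by (simp add: dist_norm field_simps)
    qed
    then show "indicator (ball 0 R) \<zeta> * indicator T (- (\<zeta> *s u) + v)
        \<le> (indicator (ball 0 (2*R)) v * indicator (ball (l v / l u) (d / \<kappa>)) \<zeta> :: ennreal)"
      by (auto simp: indicator_def)
  qed
  also have "\<dots> = (\<integral>\<^sup>+v. indicator (ball (0::complex^'n) (2*R)) v * ennreal (pi * (d / \<kappa>)\<^sup>2) \<partial>lborel)"
  proof (rule nn_integral_cong)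
    fix v
    have "(\<integral>\<^sup>+\<zeta>. indicator (ball 0 (2*R)) v * indicator (ball (l v / l u) (d / \<kappa>)) \<zeta> \<partial>lborel)
        = indicator (ball 0 (2*R)) v * emeasure lborel (ball (l v / l u) (d / \<kappa>))"
      by (simp only: nn_integral_cmult_indicator sets_lborel borel_open open_ball)
    also have "emeasure lborel (ball (l v / l u) (d / \<kappa>)) = ennreal (pi * (d / \<kappa>)\<^sup>2)"
      using u R by (subst emeasure_ball) (auto simp: unit_ball_vol_2)
    finally show "(\<integral>\<^sup>+\<zeta>. indicator (ball 0 (2*R)) v * indicator (ball (l v / l u) (d / \<kappa>)) \<zeta> \<partial>lborel)
        = indicator (ball 0 (2*R)) v * ennreal (pi * (d / \<kappa>)\<^sup>2)" .
  qed
  also have "\<dots> = emeasure lborel (ball (0::complex^'n) (2*R)) * ennreal (pi * (d / \<kappa>)\<^sup>2)"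
    by (subst nn_integral_multc) (auto simp: borel_measurable_indicator)
  also have "\<dots> = ennreal (unit_ball_vol (DIM(complex^'n)) * (2*R) ^ DIM(complex^'n) * (pi * (d / \<kappa>)\<^sup>2))" (is "_ = ennreal ?V")
    using R by (subst emeasure_ball) (auto simp: ennreal_mult'[symmetric] unit_ball_vol_nonneg)
  finally have *: "ennreal (pi * R\<^sup>2) * emeasure lborel T \<le> ennreal ?V" .
  have inv: "0 < inverse (pi * R\<^sup>2)" using R by simp
  have "ennreal (inverse (pi * R\<^sup>2)) * (ennreal (pi * R\<^sup>2) * emeasure lborel T)
     \<le> ennreal (inverse (pi * R\<^sup>2)) * ennreal (unit_ball_vol (DIM(complex^'n)) * (2*R) ^ DIM(complex^'n) * (pi * (d / \<kappa>)\<^sup>2))"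
    by (rule mult_left_mono[OF *]) simp
  also have "ennreal (inverse (pi * R\<^sup>2)) * (ennreal (pi * R\<^sup>2) * emeasure lborel T)
      = ennreal (inverse (pi * R\<^sup>2) * (pi * R\<^sup>2)) * emeasure lborel T"
    by (simp only: ennreal_mult'[OF less_imp_le[OF inv]] mult.assoc)
  also have "inverse (pi * R\<^sup>2) * (pi * R\<^sup>2) = 1"
    using R by (intro left_inverse) auto
  also have "ennreal (inverse (pi * R\<^sup>2)) * ennreal (unit_ball_vol (DIM(complex^'n)) * (2*R) ^ DIM(complex^'n) * (pi * (d / \<kappa>)\<^sup>2))
    = ennreal (inverse (pi * R\<^sup>2) * (unit_ball_vol (DIM(complex^'n)) * (2*R) ^ DIM(complex^'n) * (pi * (d / \<kappa>)\<^sup>2)))"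
    by (rule ennreal_mult'[symmetric]) simp
  also have *: "inverse (pi * x) * (b * (pi * y)) = b * y / x" if "x \<noteq> 0" for x b y :: real
    using that by (simp add: divide_simps)
  then have "inverse (pi * R\<^sup>2) * (unit_ball_vol (DIM(complex^'n)) * (2*R) ^ DIM(complex^'n) * (pi * (d / \<kappa>)\<^sup>2))
    = unit_ball_vol (DIM(complex^'n)) * (2 * R) ^ DIM(complex^'n) * (d / \<kappa>)\<^sup>2 / R\<^sup>2"
    using R by simp
  finally show ?thesis by (simp only: T_def mult_1_left ennreal_1)
qed

text \<open>Convexity of \<open>t powr p\<close>, in the tangent form from which Jensen's inequality
  follows by integration. The difference from the tangent line is least at \<open>a\<close>; at the
  end point \<open>x = 0\<close> continuity suffices.\<close>

lemma powr_ge_tangent: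
  fixes a x p :: real
  assumes "0 < a" "0 \<le> x" "1 \<le> p"
  shows "a powr p + p * a powr (p - 1) * (x - a) \<le> x powr p"
proof -
  define g where "g = (\<lambda>t. t powr p - p * a powr (p - 1) * t)"
  have d: "(g has_real_derivative (p * t powr (p - 1) - p * a powr (p - 1))) (at t)" if "t > 0" for t
    unfolding g_def using that by (auto intro!: derivative_eq_intros)
  have "continuous_on {0..} (\<lambda>t. t powr p)"
    using assms by (intro continuous_on_powr') (auto intro!: continuous_intros)
  then have cont: "continuous_on {0..} g"
    unfolding g_def by (intro continuous_on_diff continuous_on_mult continuous_on_const continuous_on_id)
  have "g a \<le> g x"
  proof (cases "a \<le> x")
    case True
    show ?thesis
    proof (rule DERIV_nonneg_imp_nondecreasing[OF True])
      fix t assume t: "a \<le> t" "t \<le> x"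
      have "a powr (p - 1) \<le> t powr (p - 1)"
        using t assms by (intro powr_mono2) auto
      then have "p * t powr (p - 1) - p * a powr (p - 1) \<ge> 0"
        using assms mult_left_mono[of "a powr (p - 1)" "t powr (p - 1)" p] by simp
      then show "\<exists>y. (g has_real_derivative y) (at t) \<and> 0 \<le> y"
        using d[of t] t assms by auto
    qed
  next
    case False
    have "continuous_on {x..a} g"
      using cont by (rule continuous_on_subset) (use assms in auto)
    moreover have "(g has_real_derivative (p * t powr (p - 1) - p * a powr (p - 1))) (at t)" if "x < t" "t < a" for t
      using that assms by (intro d) auto
    ultimately obtain l z where z: "x < z" "z < a" "(g has_real_derivative l) (at z)" "g a - g x = (a - x) * l"
      using MVT[of x a g] False real_differentiable_def by (metis (no_types, lifting) not_le)
    have "l = p * z powr (p - 1) - p * a powr (p - 1)"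
      using z assms by (intro DERIV_unique[OF z(3) d]) auto
    moreover have "z powr (p - 1) \<le> a powr (p - 1)"
      using z assms by (intro powr_mono2) auto
    ultimately have "l \<le> 0" using assms mult_left_mono[of "z powr (p - 1)" "a powr (p - 1)" p] by simp
    then have "(a - x) * l \<le> 0" using False by (simp add: mult_nonneg_nonpos)
    then show ?thesis using z(4) by simp
  qed
  moreover have "a powr p = a powr (p - 1) * a"
    using assms by (simp add: powr_diff)
  ultimately show ?thesis
    by (simp add: g_def algebra_simps)
qed

text \<open>Jensen's inequality: the tangent inequality at \<open>\<bar>g(0)\<bar>\<close> is
  integrated over the circle, and its linear term is nonnegative by the mean value property. The
  right side is a nonnegative integral over the whole line, ready for Tonelli's theorem.\<close>

lemma powr_circle_mean_le:
  assumes g: "g holomorphic_on ball 0 1" and R: "0 < R" "R < 1" and p: "1 \<le> p"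
  shows "ennreal (cmod (g 0) powr p)
    \<le> (\<integral>\<^sup>+t. indicator {0..1::real} t * ennreal (cmod (g (of_real R * cis (2 * pi * t))) powr p) \<partial>lborel)"
proof (cases "g 0 = 0")
  case False
  define a where "a = cmod (g 0)"
  have a: "a > 0" using False by (simp add: a_def)
  define h where "h = (\<lambda>t. g (of_real R * cis (2 * pi * t)))"
  have hc: "continuous_on {0..1} h"
    unfolding h_def using R
    by (intro continuous_on_compose2[OF holomorphic_on_imp_continuous_on[OF g]] continuous_intros)
      (auto simp: norm_mult)
  have int1: "(\<lambda>t. cmod (h t)) integrable_on {0..1}"
    by (intro integrable_continuous_real continuous_intros hc)
  have "continuous_on {0..1} (\<lambda>t. cmod (h t) powr p)"
    using p by (intro continuous_on_powr' continuous_intros hc) auto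
  then have int2: "(\<lambda>t. cmod (h t) powr p) integrable_on {0..1}"
    by (rule integrable_continuous_real)
  have "(h has_integral g 0) {0..1}"
    unfolding h_def using circle_mean_value[OF g R] .
  then have "a \<le> integral {0..1} (\<lambda>t. cmod (h t))"
    unfolding a_def using integral_norm_bound_integral[of h "{0..1}" "\<lambda>t. cmod (h t)"] int1
    by (metis has_integral_iff order_refl)
  then have "a powr p \<le> a powr p + p * a powr (p - 1) * (integral {0..1} (\<lambda>t. cmod (h t)) - a)"
    using a p by simp
  also have "\<dots> = integral {0..1} (\<lambda>t. a powr p + p * a powr (p - 1) * (cmod (h t) - a))"
    using has_integral_add[OF has_integral_const_real[of "a powr p" 0 1] has_integral_mult_right[OF
        has_integral_diff[OF integrable_integral[OF int1] has_integral_const_real[of a 0 1]], of "p * a powr (p - 1)"]]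
    by (simp add: has_integral_iff)
  also have "\<dots> \<le> integral {0..1} (\<lambda>t. cmod (h t) powr p)"
    using a p int1 int2 by (intro integral_le powr_ge_tangent)
      (auto intro!: integrable_add integrable_on_cmult_left integrable_diff)
  finally have "ennreal (a powr p) \<le> ennreal (integral {0..1} (\<lambda>t. cmod (h t) powr p))"
    by (rule ennreal_leI)
  also have "\<dots> = (\<integral>\<^sup>+t. ennreal (cmod (h t) powr p) * indicator {0..1} t \<partial>lborel)"
    using int2 by (intro nn_integral_has_integral_lebesgue'[symmetric]) (auto simp: has_integral_integral)
  finally show ?thesis by (simp add: a_def h_def mult.commute)
qed (use p in simp)

lemma holomorphic_Cn_along_line:
  assumes f: "holomorphic_Cn f \<Omega>" and s: "\<And>\<zeta>. norm \<zeta> < 1 \<Longrightarrow> z + \<zeta> *s v \<in> \<Omega>"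
  shows "(\<lambda>\<zeta>. f (z + \<zeta> *s v)) holomorphic_on ball 0 1"
proof (rule holomorphic_onI)
  fix \<zeta> :: complex assume "\<zeta> \<in> ball 0 1"
  then obtain f' where f': "(f has_derivative f') (at (z + \<zeta> *s v))" "\<And>c v. f' (c *s v) = c * f' v"
    using f s[of \<zeta>] unfolding holomorphic_Cn_def by force
  have "bounded_linear (\<lambda>h. h *s v)"
    by (intro bounded_linear_intro[where K="norm v"])
      (auto simp: vec_eq_iff algebra_simps norm_vector_scalar_mult)
  then have "((\<lambda>\<zeta>. z + \<zeta> *s v) has_derivative (\<lambda>h. h *s v)) (at \<zeta>)"
    by (auto intro!: derivative_eq_intros bounded_linear_imp_has_derivative)
  from has_derivative_compose[OF this f'(1)]
  have "((\<lambda>\<zeta>. f (z + \<zeta> *s v)) has_derivative (\<lambda>h. f' v * h)) (at \<zeta>)"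
    by (simp add: f'(2) mult.commute)
  then show "(\<lambda>\<zeta>. f (z + \<zeta> *s v)) field_differentiable at \<zeta> within ball 0 1"
    by (metis field_differentiable_at_within field_differentiable_def has_field_derivative_def)
qed

lemma holomorphic_Cn_imp_continuous_on:
  "holomorphic_Cn f \<Omega> \<Longrightarrow> continuous_on \<Omega> f"
  unfolding holomorphic_Cn_def
  by (meson continuous_at_imp_continuous_on has_derivative_continuous)

text \<open>The Schwarz lemma for \<open>(g - g 0) / (2 H)\<close>; it will compare the value at a
  covered point with the value at its sample point.\<close>

lemma bounded_holomorphic_Lipschitz_at_0:
  assumes g: "g holomorphic_on ball 0 1" and b: "\<And>z. norm z < 1 \<Longrightarrow> norm (g z) \<le> H" and z: "norm z < 1"
  shows "norm (g z - g 0) \<le> 2 * H * norm z"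
proof (cases "H = 0")
  case True
  then show ?thesis using b[of z] b[of 0] z by simp
next
  case False
  then have H: "H > 0" using b[of 0] norm_ge_zero[of "g 0"] by (smt (verit) norm_zero)
  obtain h where h: "\<And>z. norm z < 1 \<Longrightarrow> (g z - g 0) / (2 * of_real H) = z * h z" "\<And>z. norm z < 1 \<Longrightarrow> norm (h z) \<le> 1"
  proof (rule holomorphic_divide_zero_at_0[of "\<lambda>z. (g z - g 0) / (2 * of_real H)"])
    show "(\<lambda>z. (g z - g 0) / (2 * of_real H)) holomorphic_on ball 0 1"
      using H by (intro holomorphic_intros g) auto
    fix z :: complex assume z: "norm z < 1"
    have "norm (g z - g 0) \<le> H + H"
      using norm_triangle_ineq4[of "g z" "g 0"] b[OF z] b[of 0] by simp
    then show "norm ((g z - g 0) / (2 * of_real H)) \<le> 1"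
      using H by (simp add: norm_divide norm_mult)
  qed auto
  have "norm ((g z - g 0) / (2 * of_real H)) = norm z * norm (h z)"
    using h(1)[OF z] by (simp only: norm_mult)
  also have "\<dots> \<le> norm z * 1" using h(2)[OF z] by (intro mult_left_mono) auto
  finally show ?thesis using H by (simp add: norm_divide norm_mult field_simps)
qed

text \<open>Chains of small steps are composites of one open relation. Openness makes the chain
  relation and its sections Borel, so that Tonelli's theorem applies to them.\<close>

lemma open_relcomp:
  fixes R :: "('a::topological_space \<times> 'b::topological_space) set" and S :: "('b \<times> 'c::topological_space) set"
  assumes "open R" "open S" shows "open (R O S)"
unfolding open_prod_def
proof (intro ballI)
  fix p assume "p \<in> R O S"
  then obtain x y z where p: "p = (x, z)" and y: "(x, y) \<in> R" "(y, z) \<in> S" by auto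
  from open_prod_elim[OF assms(1) y(1)] obtain A B where "open A" "open B" "(x, y) \<in> A \<times> B" "A \<times> B \<subseteq> R" .
  moreover from open_prod_elim[OF assms(2) y(2)] obtain A' B' where "open A'" "open B'" "(y, z) \<in> A' \<times> B'" "A' \<times> B' \<subseteq> S" .
  ultimately show "\<exists>A C. open A \<and> open C \<and> p \<in> A \<times> C \<and> A \<times> C \<subseteq> R O S"
    unfolding p by (intro exI[of _ A] exI[of _ B']) auto
qed

subsection \<open>Slowly varying norms and the sampling inequality\<close>

text \<open>The interface between geometry and analysis. Complex homogeneity makes polyballs
  invariant under rotation and makes complex lines through the centre meet them in discs.
  \<open>plump\<close> says that a closed ball of the fixed radius \<open>c\<close> stays in the
  domain and that the norm varies on it by a factor at most 2. The bound \<open>M_lower\<close> may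
  depend on \<open>z\<close>; it makes the unit balls bounded. Joint continuity supplies
  measurability.\<close>

locale plump_metric =
  fixes \<Omega> :: "(complex^'n::finite) set" and M :: "complex^'n \<Rightarrow> complex^'n \<Rightarrow> real" and c :: real
  assumes open_dom: "open \<Omega>" and c: "0 < c" "c \<le> 1"
    and M_add: "z \<in> \<Omega> \<Longrightarrow> M z (v + w) \<le> M z v + M z w"
    and M_scale: "z \<in> \<Omega> \<Longrightarrow> M z (a *s v) = cmod a * M z v"
    and M_lower: "z \<in> \<Omega> \<Longrightarrow> \<exists>k>0. \<forall>v. k * norm v \<le> M z v"
    and M_cont: "continuous_on (\<Omega> \<times> UNIV) (\<lambda>p. M (fst p) (snd p))"
    and plump: "z \<in> \<Omega> \<Longrightarrow> M z (w - z) \<le> c \<Longrightarrow> w \<in> \<Omega> \<and> (\<forall>v. M w v \<le> 2 * M z v \<and> M z v \<le> 2 * M w v)"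
begin

definition polyball :: "complex^'n \<Rightarrow> real \<Rightarrow> (complex^'n) set" where
  "polyball z t = {w. M z (w - z) < t}"

definition vol :: "complex^'n \<Rightarrow> real" where
  "vol z = measure lborel {v. M z v < 1}"

text \<open>A relation, so that \<open>near t ^^ k\<close> means reachable in exactly
  \<open>k\<close> steps. It is not symmetric: each step is measured in the norm at its starting
  point, which is why volumes from the left and from the right are estimated separately.\<close>

definition near :: "real \<Rightarrow> ((complex^'n) \<times> (complex^'n)) set" where
  "near t = {(z, w). z \<in> \<Omega> \<and> M z (w - z) < t}"

lemma M_nonneg: "z \<in> \<Omega> \<Longrightarrow> 0 \<le> M z v"
  using M_lower[of z] by (meson mult_nonneg_nonneg norm_ge_zero less_imp_le order_trans)

lemma M_0: "z \<in> \<Omega> \<Longrightarrow> M z 0 = 0"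
  using M_scale[of z 0 0] by simp

lemma M_minus: "z \<in> \<Omega> \<Longrightarrow> M z (- v) = M z v"
  using M_scale[of z "-1" v] by simp

lemma M_commute: "z \<in> \<Omega> \<Longrightarrow> M z (v - w) = M z (w - v)"
  using M_minus[of z "w - v"] by simp

lemma M_scaleR: "z \<in> \<Omega> \<Longrightarrow> M z (r *\<^sub>R v) = \<bar>r\<bar> * M z v"
  by (simp add: scaleR_eq_vector_scalar_mult M_scale)

lemma M_triangle: "z \<in> \<Omega> \<Longrightarrow> M z (u - w) \<le> M z (u - v) + M z (v - w)"
  using M_add[of z "u - v" "v - w"] by simp

lemma continuous_M: "z \<in> \<Omega> \<Longrightarrow> continuous_on S (M z)"
  using continuous_on_compose2[OF M_cont continuous_on_Pair[OF continuous_on_const continuous_on_id], of z S]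
  by auto

lemma M_measurable: "z \<in> \<Omega> \<Longrightarrow> M z \<in> borel_measurable borel"
  by (intro borel_measurable_continuous_onI continuous_M)

lemma open_M_less: "z \<in> \<Omega> \<Longrightarrow> open {v. M z v < t}"
  by (intro open_Collect_less continuous_M continuous_on_const)

lemma open_polyball: "z \<in> \<Omega> \<Longrightarrow> open (polyball z t)"
  unfolding polyball_def
  by (intro open_Collect_less continuous_on_compose2[OF continuous_M[of z UNIV]] continuous_intros) auto

lemma polyball_measurable [measurable]: "z \<in> \<Omega> \<Longrightarrow> polyball z t \<in> sets borel"
  by (intro borel_open open_polyball)

lemma center_in_polyball: "z \<in> \<Omega> \<Longrightarrow> 0 < t \<Longrightarrow> z \<in> polyball z t"
  by (simp add: polyball_def M_0)

lemma polyball_subset: "z \<in> \<Omega> \<Longrightarrow> t \<le> c \<Longrightarrow> polyball z t \<subseteq> \<Omega>"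
  using plump by (force simp: polyball_def)

lemma
  assumes "z \<in> \<Omega>" "M z (w - z) \<le> c"
  shows plump_mem: "w \<in> \<Omega>" and plump_le: "M w v \<le> 2 * M z v" and plump_ge: "M z v \<le> 2 * M w v"
  using plump[OF assms] by auto

lemma emeasure_unit: assumes z: "z \<in> \<Omega>"
  shows "emeasure lborel {v. M z v < 1} = ennreal (vol z)" and "0 < vol z"
proof -
  obtain k where k: "k > 0" "\<And>v. k * norm v \<le> M z v" using M_lower[OF z] by blast
  have "norm v \<le> 1 / k" if "M z v < 1" for v
    using k(1) order_le_less_trans[OF k(2)[of v] that] by (simp add: field_simps)
  then have "bounded {v. M z v < 1}" by (auto simp: bounded_iff)
  then have fin: "emeasure lborel {v. M z v < 1} < \<infinity>" by (rule emeasure_bounded_finite)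
  then show eq: "emeasure lborel {v. M z v < 1} = ennreal (vol z)"
    unfolding vol_def by (intro emeasure_eq_ennreal_measure) auto
  obtain e where e: "e > 0" "ball 0 e \<subseteq> {v. M z v < 1}"
    using open_M_less[OF z, of 1] M_0[OF z] by (metis mem_Collect_eq openE zero_less_one)
  have "0 < emeasure lborel (ball (0::complex^'n) e)"
    using e(1) by (subst emeasure_ball) (auto intro!: mult_pos_pos unit_ball_vol_pos)
  also have "\<dots> \<le> emeasure lborel {v. M z v < 1}"
    using e(2) open_M_less[OF z, of 1] by (intro emeasure_mono) auto
  finally show "0 < vol z" by (simp add: eq)
qed

lemma emeasure_M_less:
  assumes z: "z \<in> \<Omega>" and t: "0 < t"
  shows "emeasure lborel {v. M z v < t} = ennreal (t ^ DIM(complex^'n) * vol z)"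
proof -
  have [measurable]: "{v. M z v < s} \<in> sets borel" for s using open_M_less[OF z] by simp
  have "emeasure lborel {v. M z v < t} = (\<integral>\<^sup>+v. indicator {v. M z v < t} v \<partial>lborel)" by simp
  also have "\<dots> = ennreal (\<bar>t\<bar> ^ DIM(complex^'n)) * (\<integral>\<^sup>+v. indicator {v. M z v < t} (t *\<^sub>R v) \<partial>lborel)"
    by (rule nn_integral_lborel_scaleR) (use t in auto)
  also have "(\<lambda>v. indicator {v. M z v < t} (t *\<^sub>R v)) = (indicator {v. M z v < 1} :: _ \<Rightarrow> ennreal)"
    using t by (auto simp: indicator_def M_scaleR[OF z])
  also have "(\<integral>\<^sup>+v. indicator {v. M z v < 1} v \<partial>lborel) = ennreal (vol z)"
    using emeasure_unit[OF z] by simp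
  finally show ?thesis using t emeasure_unit[OF z] by (simp add: ennreal_mult' less_imp_le)
qed

lemma emeasure_translate:
  fixes A :: "(complex^'n) set"
  assumes [measurable]: "A \<in> sets borel" shows "emeasure lborel {v. z + v \<in> A} = emeasure lborel A"
proof -
  have "emeasure lborel {v. z + v \<in> A} = (\<integral>\<^sup>+v. indicator A (z + v) \<partial>lborel)"
    using nn_integral_indicator[of "{v. z + v \<in> A}" lborel] by (simp add: indicator_def)
  also have "\<dots> = (\<integral>\<^sup>+v. indicator A v \<partial>lborel)"
    by (rule nn_integral_lborel_translate) simp
  finally show ?thesis by simp
qed

lemma emeasure_polyball:
  assumes z: "z \<in> \<Omega>" and t: "0 < t"
  shows "emeasure lborel (polyball z t) = ennreal (t ^ DIM(complex^'n) * vol z)"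
proof -
  have "emeasure lborel (polyball z t) = emeasure lborel {v. z + v \<in> polyball z t}"
    using z by (intro emeasure_translate[symmetric]) simp
  also have "{v. z + v \<in> polyball z t} = {v. M z v < t}" by (auto simp: polyball_def)
  finally show ?thesis using emeasure_M_less[OF assms] by simp
qed

lemma vol_le:
  assumes "z \<in> \<Omega>" "w \<in> \<Omega>" "0 < b" "\<And>v. M z v \<le> b * M w v"
  shows "vol w \<le> b ^ DIM(complex^'n) * vol z"
proof -
  have "emeasure lborel {v. M w v < 1} \<le> emeasure lborel {v. M z v < b}"
  proof (rule emeasure_mono)
    show "{v. M w v < 1} \<subseteq> {v. M z v < b}"
    proof safe
      fix v assume "M w v < 1"
      then have "b * M w v < b * 1" using assms(3) by (intro mult_strict_left_mono) auto
      then show "M z v < b" using assms(4)[of v] by simp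
    qed
  qed (use open_M_less[OF assms(1)] in simp)
  then show ?thesis
    using assms by (simp add: emeasure_unit emeasure_M_less ennreal_le_iff less_imp_le)
qed

text \<open>Each step changes the norm by a factor at most 2. Seen from \<open>z\<close>, the step
  after \<open>i\<close> steps has length at most \<open>2 ^ i * t\<close>, and the geometric series
  sums to \<open>(2 ^ k - 1) * t\<close>.\<close>

lemma near_pow:
  assumes "(z, w) \<in> near t ^^ k" "t \<le> c" "z \<in> \<Omega>"
  shows "w \<in> \<Omega> \<and> (\<forall>v. M w v \<le> 2 ^ k * M z v \<and> M z v \<le> 2 ^ k * M w v) \<and> M z (w - z) \<le> (2 ^ k - 1) * t"
  using assms(1)
proof (induction k arbitrary: w)
  case 0
  then show ?case using assms(3) by (simp add: M_0)
next
  case (Suc k)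
  then obtain y where y: "(z, y) \<in> near t ^^ k" "(y, w) \<in> near t" by auto
  have IH: "y \<in> \<Omega>" "\<And>v. M y v \<le> 2 ^ k * M z v" "\<And>v. M z v \<le> 2 ^ k * M y v" "M z (y - z) \<le> (2 ^ k - 1) * t"
    using Suc.IH[OF y(1)] by auto
  have yw: "M y (w - y) < t" using y(2) by (simp add: near_def)
  have w: "w \<in> \<Omega>" "\<And>v. M w v \<le> 2 * M y v" "\<And>v. M y v \<le> 2 * M w v"
    using plump[OF IH(1), of w] yw assms(2) by auto
  have "M w v \<le> 2 ^ Suc k * M z v" for v
    using w(2)[of v] IH(2)[of v] by simp
  moreover have "M z v \<le> 2 ^ Suc k * M w v" for v
  proof -
    have "M z v \<le> 2 ^ k * M y v" by (rule IH(3))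
    also have "\<dots> \<le> 2 ^ k * (2 * M w v)" using w(3)[of v] by (intro mult_left_mono) auto
    finally show ?thesis by simp
  qed
  moreover have "M z (w - z) \<le> (2 ^ Suc k - 1) * t"
  proof -
    have "M z (w - z) \<le> M z (w - y) + M z (y - z)" by (rule M_triangle[OF assms(3)])
    also have "M z (w - y) \<le> 2 ^ k * M y (w - y)" by (rule IH(3))
    also have "\<dots> \<le> 2 ^ k * t" using yw by (intro mult_left_mono) auto
    also have "M z (y - z) \<le> (2 ^ k - 1) * t" by (rule IH(4))
    finally show ?thesis by (simp add: algebra_simps)
  qed
  ultimately show ?case using w(1) by blast
qed

lemmas near_pow_mem = near_pow[THEN conjunct1]

lemma near_pow_vol:
  assumes "(z, w) \<in> near t ^^ k" "t \<le> c" "z \<in> \<Omega>"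
  shows "vol w \<le> (2 ^ k) ^ DIM(complex^'n) * vol z" "vol z \<le> (2 ^ k) ^ DIM(complex^'n) * vol w"
  using near_pow[OF assms] assms vol_le[of z w "2 ^ k"] vol_le[of w z "2 ^ k"] by simp_all

lemma near_mono: "s \<le> t \<Longrightarrow> near s \<subseteq> near t"
  by (auto simp: near_def)

lemma near_pow_mono: "s \<le> t \<Longrightarrow> near s ^^ k \<subseteq> near t ^^ k"
proof (induction k)
  case (Suc k)
  assume "s \<le> t"
  then show ?case using Suc relcomp_mono[OF _ near_mono] by simp
qed simp

text \<open>A chain may pause because \<open>M w 0 = 0\<close>, so an exact number of steps can
  always be increased.\<close>

lemma near_Suc_self: "(z, w) \<in> near t ^^ k \<Longrightarrow> 0 < t \<Longrightarrow> t \<le> c \<Longrightarrow> z \<in> \<Omega> \<Longrightarrow> (z, w) \<in> near t ^^ Suc k"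
  using near_pow_mem[of z w k t] by (auto intro!: relcompI[of z w] simp: near_def M_0)

lemma near_pow_le:
  assumes "(z, w) \<in> near t ^^ k" "k \<le> l" "0 < t" "t \<le> c" "z \<in> \<Omega>"
  shows "(z, w) \<in> near t ^^ l"
  using assms(2,1)
proof (induction l rule: dec_induct)
  case (step n)
  then show ?case using near_Suc_self assms(3-) by blast
qed

lemma open_near: "open (near t)"
proof -
  have "continuous_on (\<Omega> \<times> UNIV) (\<lambda>p. M (fst p) (snd p - fst p))"
    by (rule continuous_on_compose2[OF M_cont, of _ "\<lambda>p. (fst p, snd p - fst p)", simplified])
      (auto intro!: continuous_intros)
  then have "open ((\<Omega> \<times> UNIV) \<inter> (\<lambda>p. M (fst p) (snd p - fst p)) -` {..<t})"
    by (intro continuous_open_preimage open_Times open_dom) auto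
  also have "(\<Omega> \<times> UNIV) \<inter> (\<lambda>p. M (fst p) (snd p - fst p)) -` {..<t} = near t"
    by (auto simp: near_def)
  finally show ?thesis .
qed

lemma open_near_pow: "open (near t ^^ Suc k)"
proof (induction k)
  case (Suc k)
  show ?case using open_relcomp[OF Suc open_near[of t]] by simp
qed (simp add: open_near)

lemma near_pow_measurable [measurable]: "Measurable.pred (borel \<Otimes>\<^sub>M borel) (\<lambda>p. p \<in> near t ^^ Suc k)"
  using open_near_pow[of k t] by (simp add: borel_prod pred_def del: relpow.simps)

lemma near_pow_sections:
  "open {w. (z, w) \<in> near t ^^ Suc k}" "open {z. (z, w) \<in> near t ^^ Suc k}"
proof -
  have "open ((\<lambda>w. (z, w)) -` (near t ^^ Suc k))" "open ((\<lambda>z. (z, w)) -` (near t ^^ Suc k))"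
    by (intro open_vimage open_near_pow continuous_intros)+
  then show "open {w. (z, w) \<in> near t ^^ Suc k}" "open {z. (z, w) \<in> near t ^^ Suc k}"
    by (simp_all add: vimage_def)
qed

lemma emeasure_near_pow_right:
  assumes "z \<in> \<Omega>" "0 < t" "t \<le> c"
  shows "emeasure lborel {w. (z, w) \<in> near t ^^ k} \<le> ennreal ((2 ^ k * t) ^ DIM(complex^'n) * vol z)"
proof -
  have "{w. (z, w) \<in> near t ^^ k} \<subseteq> polyball z (2 ^ k * t)"
    using near_pow[OF _ assms(3,1), of _ k] assms(2) by (fastforce simp: polyball_def algebra_simps)
  then have "emeasure lborel {w. (z, w) \<in> near t ^^ k} \<le> emeasure lborel (polyball z (2 ^ k * t))"
    using assms(1) by (intro emeasure_mono) auto
  then show ?thesis using assms by (simp add: emeasure_polyball)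
qed

lemma near_pow_in_domain: "(z, w) \<in> near t ^^ Suc k \<Longrightarrow> z \<in> \<Omega>"
  by (induction k arbitrary: w) (auto simp: near_def)

text \<open>The displacement is below \<open>2 ^ Suc k * t\<close> in the norm at \<open>z\<close>;
  measuring it in the norm at \<open>w\<close> costs the same factor once more, hence
  \<open>4 ^ Suc k\<close>.\<close>

lemma emeasure_near_pow_left:
  assumes "w \<in> \<Omega>" "0 < t" "t \<le> c"
  shows "emeasure lborel {z. (z, w) \<in> near t ^^ Suc k} \<le> ennreal ((4 ^ Suc k * t) ^ DIM(complex^'n) * vol w)"
proof -
  have "{z. (z, w) \<in> near t ^^ Suc k} \<subseteq> polyball w (4 ^ Suc k * t)"
  proof safe
    fix z assume z: "(z, w) \<in> near t ^^ Suc k"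
    then have z\<Omega>: "z \<in> \<Omega>" by (rule near_pow_in_domain)
    have "M w (z - w) \<le> 2 ^ Suc k * M z (w - z)"
      using near_pow[OF z assms(3) z\<Omega>] M_commute[OF assms(1)] by metis
    also have "\<dots> \<le> 2 ^ Suc k * ((2 ^ Suc k - 1) * t)"
      using near_pow[OF z assms(3) z\<Omega>] by (intro mult_left_mono) auto
    also have "\<dots> < 2 ^ Suc k * (2 ^ Suc k * t)"
      using assms(2) by (intro mult_strict_left_mono mult_strict_right_mono) auto
    also have "\<dots> = 4 ^ Suc k * t"
      by (simp add: power_mult_distrib[symmetric] mult.assoc[symmetric] del: power_Suc)
    finally show "z \<in> polyball w (4 ^ Suc k * t)" by (simp add: polyball_def)
  qed
  then have "emeasure lborel {z. (z, w) \<in> near t ^^ Suc k} \<le> emeasure lborel (polyball w (4 ^ Suc k * t))"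
    using assms(1) by (intro emeasure_mono) auto
  then show ?thesis using assms by (simp add: emeasure_polyball)
qed

end

section \<open>Submean values and small values of holomorphic functions on polyballs\<close>

context plump_metric
begin

lemma holomorphic_along_line:
  assumes "holomorphic_Cn f \<Omega>" "z \<in> \<Omega>" "M z v \<le> c"
  shows "(\<lambda>\<zeta>. f (z + \<zeta> *s v)) holomorphic_on ball 0 1"
proof (rule holomorphic_Cn_along_line[OF assms(1)])
  fix \<zeta> :: complex assume "norm \<zeta> < 1"
  then have "cmod \<zeta> * M z v \<le> 1 * c"
    using assms M_nonneg[of z v] by (intro mult_mono) auto
  then show "z + \<zeta> *s v \<in> \<Omega>"
    using plump_mem[OF assms(2), of "z + \<zeta> *s v"] assms(2) by (simp add: M_scale)
qed

text \<open>The extension by 0 makes the function Borel on the whole space, whatever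
  \<open>f\<close> is outside \<open>\<Omega>\<close>.\<close>

definition weight :: "(complex^'n \<Rightarrow> complex) \<Rightarrow> real \<Rightarrow> complex^'n \<Rightarrow> ennreal" where
  "weight f p x = indicator \<Omega> x * ennreal (cmod (f x) powr p)"

lemma weight_measurable [measurable]:
  assumes f: "holomorphic_Cn f \<Omega>"
  shows "weight f p \<in> borel_measurable borel"
proof -
  have "(\<lambda>x. indicator \<Omega> x *\<^sub>R f x) \<in> borel_measurable borel"
    using f by (intro borel_measurable_continuous_on_indicator holomorphic_Cn_imp_continuous_on borel_open open_dom)
  moreover have "indicator \<Omega> \<in> (borel_measurable borel :: (complex^'n \<Rightarrow> ennreal) set)"
    using open_dom by (intro borel_measurable_indicator borel_open)
  ultimately have "(\<lambda>x. indicator \<Omega> x * ennreal (cmod (indicator \<Omega> x *\<^sub>R f x) powr p)) \<in> borel_measurable borel"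
    by measurable
  also have "(\<lambda>x. indicator \<Omega> x * ennreal (cmod (indicator \<Omega> x *\<^sub>R f x) powr p)) = weight f p"
    by (auto simp: weight_def indicator_def)
  finally show ?thesis .
qed

text \<open>For each \<open>v\<close> in the ball of radius \<open>t\<close>, the circle mean is
  taken at radius 1/2 in direction \<open>2 v\<close>, which is allowed because
  \<open>t \<le> c / 2\<close>. Averaging over \<open>v\<close> and exchanging the integrals, each
  rotation \<open>v \<mapsto> e s *s v\<close> preserves both the ball and Lebesgue measure, so the
  circle average disappears and the volume mean remains.\<close>

lemma submean_value:
  assumes f: "holomorphic_Cn f \<Omega>" and z: "z \<in> \<Omega>" and p: "1 \<le> p" and t: "0 < t" "t \<le> c / 2"
  shows "ennreal (cmod (f z) powr p * (t ^ DIM(complex^'n) * vol z))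
    \<le> (\<integral>\<^sup>+x. indicator (polyball z t) x * weight f p x \<partial>lborel)"
proof -
  note [measurable] = weight_measurable[OF f] M_measurable[OF z]
  define S where "S = {v. M z v < t}"
  have [measurable]: "S \<in> sets borel" unfolding S_def by measurable
  define e where "e = (\<lambda>s::real. cis (2 * pi * s))"
  have [measurable]: "e \<in> borel_measurable borel"
    unfolding e_def by (intro borel_measurable_continuous_onI continuous_intros)
  have rot: "indicator S v = indicator S (e s *s v)" for v s
    by (simp add: indicator_def S_def M_scale[OF z] e_def)
  have pt: "indicator S v * ennreal (cmod (f z) powr p)
      \<le> (\<integral>\<^sup>+s. indicator S v * (indicator {0..1} s * weight f p (z + e s *s v)) \<partial>lborel)" for v
  proof (cases "v \<in> S")
    case True
    then have v: "M z (2 *s v) \<le> c" using t M_scale[OF z, of 2 v] by (simp add: S_def)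
    have "z + e s *s v \<in> \<Omega>" for s
      using plump_mem[OF z, of "z + e s *s v"] v M_nonneg[OF z, of v] by (simp add: M_scale[OF z] e_def)
    then have "weight f p (z + e s *s v) = ennreal (cmod (f (z + (of_real (1/2) * e s) *s (2 *s v))) powr p)" for s
      by (simp add: weight_def)
    then show ?thesis
      using powr_circle_mean_le[OF holomorphic_along_line[OF f z v], of "1/2" p] p True
      by (simp add: e_def)
  qed simp
  have "ennreal (cmod (f z) powr p * (t ^ DIM(complex^'n) * vol z))
      = (\<integral>\<^sup>+v. indicator S v * ennreal (cmod (f z) powr p) \<partial>lborel)"
    using emeasure_M_less[OF z t(1)] emeasure_unit(2)[OF z] t(1)
    by (subst nn_integral_multc) (auto simp: S_def ennreal_mult' mult.commute)
  also have "\<dots> \<le> (\<integral>\<^sup>+v. \<integral>\<^sup>+s. indicator S v * (indicator {0..1} s * weight f p (z + e s *s v)) \<partial>lborel \<partial>lborel)"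
    by (rule nn_integral_mono) (rule pt)
  also have "\<dots> = (\<integral>\<^sup>+s. \<integral>\<^sup>+v. indicator S v * (indicator {0..1} s * weight f p (z + e s *s v)) \<partial>lborel \<partial>lborel)"
    by (rule lborel_pair.Fubini') measurable
  also have "\<dots> = (\<integral>\<^sup>+s. (\<integral>\<^sup>+x. indicator (polyball z t) x * weight f p x \<partial>lborel) * indicator {0..1::real} s \<partial>lborel)"
  proof (rule nn_integral_cong)
    fix s :: real
    have "(\<integral>\<^sup>+v. indicator S v * (indicator {0..1} s * weight f p (z + e s *s v)) \<partial>lborel)
      = (\<integral>\<^sup>+v. (indicator S (e s *s v) * weight f p (z + e s *s v)) * indicator {0..1} s \<partial>lborel)"
      unfolding rot[of _ s, symmetric] by (simp add: mult_ac)
    also have "\<dots> = (\<integral>\<^sup>+v. indicator S (e s *s v) * weight f p (z + e s *s v) \<partial>lborel) * indicator {0..1} s"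
      by (rule nn_integral_multc) measurable
    also have "(\<integral>\<^sup>+v. indicator S (e s *s v) * weight f p (z + e s *s v) \<partial>lborel)
       = (\<integral>\<^sup>+v. indicator S v * weight f p (z + v) \<partial>lborel)"
      by (rule nn_integral_lborel_rotate[of "\<lambda>v. indicator S v * weight f p (z + v)"]) (auto simp: e_def)
    also have "(\<lambda>v. indicator S v * weight f p (z + v)) = (\<lambda>v. indicator (polyball z t) (z + v) * weight f p (z + v))"
      by (auto simp: S_def polyball_def indicator_def)
    also have "(\<integral>\<^sup>+v. indicator (polyball z t) (z + v) * weight f p (z + v) \<partial>lborel)
       = (\<integral>\<^sup>+x. indicator (polyball z t) x * weight f p x \<partial>lborel)"
      by (rule nn_integral_lborel_translate[of "\<lambda>v. indicator (polyball z t) v * weight f p v"])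
        (use z in \<open>auto intro!: borel_measurable_times_ennreal borel_measurable_indicator\<close>)
    finally show "(\<integral>\<^sup>+v. indicator S v * (indicator {0..1} s * weight f p (z + e s *s v)) \<partial>lborel)
      = (\<integral>\<^sup>+x. indicator (polyball z t) x * weight f p x \<partial>lborel) * indicator {0..1} s" .
  qed
  also have "\<dots> = (\<integral>\<^sup>+x. indicator (polyball z t) x * weight f p x \<partial>lborel)"
    by (subst nn_integral_cmult_indicator) auto
  finally show ?thesis .
qed

text \<open>
  A Remez-type inequality: averaging over the dilations by \<open>t \<in> [1/32, 1/16]\<close> reduces it to the
  one-variable estimate on complex lines through \<open>z\<close>.
\<close>
lemma emeasure_small_values_le:
  assumes f: "holomorphic_Cn f \<Omega>" and z: "z \<in> \<Omega>" and H: "0 < H" and fH: "\<And>x. x \<in> polyball z c \<Longrightarrow> cmod (f x) \<le> H"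
    and fz: "(1/2) ^ N * H \<le> cmod (f z)" and N: "0 < N" and h: "0 < h"
  shows "emeasure lborel {x \<in> polyball z (c / 32). cmod (f x) < h ^ N * H}
    \<le> ennreal (512 * real N * h * (c ^ DIM(complex^'n) * vol z))"
proof -
  define S where "S = {v. M z v < c}"
  note [measurable] = M_measurable[OF z]
  have [measurable]: "S \<in> sets borel" unfolding S_def by measurable
  have fc: "continuous_on (polyball z c) f"
    using holomorphic_Cn_imp_continuous_on[OF f] by (rule continuous_on_subset) (use polyball_subset[OF z] in simp)
  define B where "B = {x \<in> polyball z (c / 32). cmod (f x) < h ^ N * H}"
  have "open (polyball z (c/32) \<inter> (\<lambda>x. cmod (f x)) -` {..<h ^ N * H})"
    using z c by (intro continuous_open_preimage open_polyball continuous_intros continuous_on_subset[OF fc])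
      (auto simp: polyball_def)
  also have "polyball z (c/32) \<inter> (\<lambda>x. cmod (f x)) -` {..<h ^ N * H} = B" by (auto simp: B_def)
  finally have [measurable]: "B \<in> sets borel" by (rule borel_open)
  define G where "G = {v. z + v \<in> B}"
  have [measurable]: "G \<in> sets borel" unfolding G_def by measurable
  have GB: "emeasure lborel G = emeasure lborel B"
    unfolding G_def by (rule emeasure_translate) measurable
  \<comment> \<open>For a direction \<open>u\<close> in the \<open>c\<close>-ball,
    \<open>emeasure_real_small_values_le\<close> bounds the dilation factors that send
    \<open>u\<close> into the bad set \<open>G\<close>. For \<open>u\<close> outside there are none,
    because \<open>t \<ge> 1/32\<close> while \<open>G\<close> lies in the ball of radius
    \<open>c / 32\<close>.\<close>
  have pt: "(\<integral>\<^sup>+t. indicator {1/32..1/16} t * indicator G (t *\<^sub>R u) \<partial>lborel)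
      \<le> indicator S u * ennreal (16 * real N * h)" for u
  proof (cases "u \<in> S")
    case True
    have u: "M z u \<le> c" using True by (simp add: S_def)
    define g where "g = (\<lambda>\<zeta>. f (z + \<zeta> *s u) / of_real H)"
    have g: "g holomorphic_on ball 0 1" unfolding g_def
      using H by (intro holomorphic_intros holomorphic_along_line[OF f z u]) auto
    have g1: "norm (g \<zeta>) \<le> 1" if "norm \<zeta> < 1" for \<zeta>
    proof -
      have "cmod \<zeta> * M z u \<le> 1 * M z u" using that M_nonneg[OF z, of u] by (intro mult_right_mono) auto
      then have "z + \<zeta> *s u \<in> polyball z c" using True by (simp add: polyball_def S_def M_scale[OF z])
      from fH[OF this] show ?thesis using H by (simp add: g_def norm_divide)
    qed
    have "(1/2) ^ N \<le> norm (g 0)" using fz H by (simp add: g_def norm_divide field_simps)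
    then have le: "emeasure lborel {t::real\<in>{1/32..1/16}. norm (g (of_real t)) < h ^ N} \<le> ennreal (16 * real N * h)"
      using g1 by (intro emeasure_real_small_values_le[OF g _ _ N h])
    have "{t::real. t \<in> {1/32..1/16} \<and> t *\<^sub>R u \<in> G} \<subseteq> {t\<in>{1/32..1/16}. norm (g (of_real t)) < h ^ N}"
      using H by (auto simp: G_def B_def g_def norm_divide scaleR_eq_vector_scalar_mult field_simps)
    moreover have "{t::real\<in>{1/32..1/16}. norm (g (of_real t)) < h ^ N} \<in> sets borel"
    proof -
      have "continuous_on {1/32..1/16} (\<lambda>t. norm (g (complex_of_real t)))"
        by (intro continuous_intros continuous_on_compose2[OF holomorphic_on_imp_continuous_on[OF g]]) auto
      then have "closed {t\<in>{1/32..1/16}. h ^ N \<le> norm (g (complex_of_real t))}"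
        by (intro continuous_on_closed_Collect_le) auto
      then have "{1/32..1/16} - {t\<in>{1/32..1/16}. h ^ N \<le> norm (g (complex_of_real t))} \<in> sets borel"
        by (intro sets.Diff borel_closed) auto
      also have "{1/32..1/16} - {t\<in>{1/32..1/16}. h ^ N \<le> norm (g (complex_of_real t))} =
        {t::real\<in>{1/32..1/16}. norm (g (of_real t)) < h ^ N}" by auto
      finally show ?thesis .
    qed
    ultimately have "emeasure lborel {t::real. t \<in> {1/32..1/16} \<and> t *\<^sub>R u \<in> G}
        \<le> emeasure lborel {t::real\<in>{1/32..1/16}. norm (g (of_real t)) < h ^ N}"
      unfolding sets_lborel[symmetric] by (rule emeasure_mono)
    from order_trans[OF this le]
    have "emeasure lborel {t::real. t \<in> {1/32..1/16} \<and> t *\<^sub>R u \<in> G} \<le> ennreal (16 * real N * h)" .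
    moreover have "(\<integral>\<^sup>+t. indicator {1/32..1/16} t * indicator G (t *\<^sub>R u) \<partial>lborel)
       = (\<integral>\<^sup>+t. indicator {t::real. t \<in> {1/32..1/16} \<and> t *\<^sub>R u \<in> G} t \<partial>lborel)"
      by (intro nn_integral_cong) (auto simp: indicator_def)
    ultimately show ?thesis using True by simp
  next
    case False
    have "t *\<^sub>R u \<notin> G" if "t \<in> {1/32..1/16}" for t
    proof
      assume "t *\<^sub>R u \<in> G"
      then have "t * M z u < c / 32" using that by (simp add: G_def B_def polyball_def M_scaleR[OF z])
      moreover have "1/32 * M z u \<le> t * M z u" using that M_nonneg[OF z, of u] by (intro mult_right_mono) auto
      ultimately show False using False by (simp add: S_def)
    qed
    then have "(\<lambda>t. indicator {1/32..1/16} t * indicator G (t *\<^sub>R u)) = (\<lambda>_. 0::ennreal)"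
      by (auto simp: indicator_def)
    then show ?thesis by simp
  qed
  have scal: "ennreal 32 * (ennreal a * ennreal b) = ennreal (32 * (a * b))" if "0 \<le> a" "0 \<le> b" for a b
    using that by (simp add: ennreal_mult)
  \<comment> \<open>The length of \<open>{1/32..1/16}\<close> is 1/32; dividing by it at the end
    turns the one-variable constant 16 into 512. The Jacobian \<open>t ^ DIM(complex^'n)\<close> of
    the dilation is at most 1.\<close>
  have "ennreal (1/32) * emeasure lborel G = (\<integral>\<^sup>+t. indicator {1/32..1/16::real} t * emeasure lborel G \<partial>lborel)"
    by (subst nn_integral_multc) auto
  also have "\<dots> \<le> (\<integral>\<^sup>+t. \<integral>\<^sup>+u. indicator {1/32..1/16} t * indicator G (t *\<^sub>R u) \<partial>lborel \<partial>lborel)"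
  proof (rule nn_integral_mono)
    fix t :: real
    show "indicator {1/32..1/16} t * emeasure lborel G \<le> (\<integral>\<^sup>+u. indicator {1/32..1/16} t * indicator G (t *\<^sub>R u) \<partial>lborel)"
    proof (cases "t \<in> {1/32..1/16}")
      case True
      have "emeasure lborel G = (\<integral>\<^sup>+u. indicator G u \<partial>lborel)" by simp
      also have "\<dots> = ennreal (\<bar>t\<bar> ^ DIM(complex^'n)) * (\<integral>\<^sup>+u. indicator G (t *\<^sub>R u) \<partial>lborel)"
        by (rule nn_integral_lborel_scaleR) (use True in auto)
      also have "\<dots> \<le> 1 * (\<integral>\<^sup>+u. indicator G (t *\<^sub>R u) \<partial>lborel)"
        using True power_le_one[of "\<bar>t\<bar>" "DIM(complex^'n)"]
        by (intro mult_right_mono) (auto simp: ennreal_le_1)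
      finally show ?thesis using True by simp
    qed simp
  qed
  also have "\<dots> = (\<integral>\<^sup>+u. \<integral>\<^sup>+t. indicator {1/32..1/16} t * indicator G (t *\<^sub>R u) \<partial>lborel \<partial>lborel)"
    by (rule lborel_pair.Fubini'[symmetric]) measurable
  also have "\<dots> \<le> (\<integral>\<^sup>+u. indicator S u * ennreal (16 * real N * h) \<partial>lborel)"
    by (rule nn_integral_mono) (rule pt)
  also have "\<dots> = emeasure lborel S * ennreal (16 * real N * h)" by (subst nn_integral_multc) auto
  also have "\<dots> = ennreal (c ^ DIM(complex^'n) * vol z) * ennreal (16 * real N * h)"
    using emeasure_M_less[OF z c(1)] by (simp add: S_def)
  finally have "ennreal 32 * (ennreal (1/32) * emeasure lborel G)
      \<le> ennreal 32 * (ennreal (c ^ DIM(complex^'n) * vol z) * ennreal (16 * real N * h))"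
    by (rule mult_left_mono) simp
  also have "ennreal 32 * (ennreal (c ^ DIM(complex^'n) * vol z) * ennreal (16 * real N * h))
    = ennreal (32 * ((c ^ DIM(complex^'n) * vol z) * (16 * real N * h)))"
    using scal[of "c ^ DIM(complex^'n) * vol z" "16 * real N * h"] h c emeasure_unit(2)[OF z] by simp
  also have "32 * ((c ^ DIM(complex^'n) * vol z) * (16 * real N * h)) = 512 * real N * h * (c ^ DIM(complex^'n) * vol z)"
    by simp
  also have "ennreal 32 * (ennreal (1/32) * emeasure lborel G) = emeasure lborel G"
  proof -
    have "ennreal 32 * ennreal (1/32) = ennreal (32 * (1/32))"
      by (rule ennreal_mult[symmetric]) simp_all
    also have "\<dots> = 1" by simp
    finally show ?thesis by (simp only: mult.assoc[symmetric] mult_1_left)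
  qed
  finally show ?thesis by (simp only: GB B_def)
qed

end

lemma ennreal_mult_le_imp_le_divide:
  assumes "ennreal k * X \<le> ennreal r" "0 < k" "0 \<le> r"
  shows "X \<le> ennreal (r / k)"
proof (cases X)
  case (real x)
  then have "k * x \<le> r" using assms by (simp add: ennreal_mult[symmetric])
  then show ?thesis using real assms by (simp add: field_simps)
next
  case top
  then show ?thesis using assms by (simp add: ennreal_mult_top top_unique)
qed

section \<open>Carrying the Remez inequality along chains\<close>

context plump_metric
begin

text \<open>Chosen for \<open>polyball_step\<close>: with \<open>y\<close> and \<open>x'\<close> one
  step from \<open>x\<close>, a point of \<open>polyball x' step\<close> has distance below
  \<open>4 * step\<close> from \<open>y\<close> in the norm at \<open>x\<close>, hence below
  \<open>8 * step = c / 32\<close> in the norm at \<open>y\<close>. This is the radius at which the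
  Remez inequality about \<open>y\<close> holds.\<close>

abbreviation step :: real where "step \<equiv> c / 256"

lemma small_values_measurable:
  assumes f: "holomorphic_Cn f \<Omega>" and U: "open U" "U \<subseteq> \<Omega>"
  shows "{x \<in> U. cmod (f x) < s} \<in> sets borel"
proof -
  have "continuous_on U f"
    by (rule continuous_on_subset[OF holomorphic_Cn_imp_continuous_on[OF f] U(2)])
  then have "open (U \<inter> (\<lambda>x. cmod (f x)) -` {..<s})"
    using U by (intro continuous_open_preimage continuous_intros) auto
  also have "U \<inter> (\<lambda>x. cmod (f x)) -` {..<s} = {x \<in> U. cmod (f x) < s}" by auto
  finally show ?thesis by (rule borel_open)
qed

lemma polyball_step:
  assumes x: "x \<in> \<Omega>" and y: "M x (y - x) < step" and x': "M x (x' - x) < step"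
  shows "y \<in> \<Omega>" "x' \<in> \<Omega>" "polyball x' step \<subseteq> polyball y (c / 32)"
    "vol y \<le> 4 ^ DIM(complex^'n) * vol x'"
proof -
  have le: "M x (y - x) \<le> c" "M x (x' - x) \<le> c" using y x' c by auto
  show y\<Omega>: "y \<in> \<Omega>" and x'\<Omega>: "x' \<in> \<Omega>" using plump_mem[OF x] le by auto
  have yM: "M y v \<le> 2 * M x v" and xM: "M x v \<le> 2 * M x' v" and xM': "M x v \<le> 2 * M y v"
    and x'M: "M x' v \<le> 2 * M x v" for v
    using plump_le[OF x le(1)] plump_ge[OF x le(1)] plump_le[OF x le(2)] plump_ge[OF x le(2)] by auto
  show "polyball x' step \<subseteq> polyball y (c / 32)"
  proof
    fix w assume "w \<in> polyball x' step"
    then have w: "M x' (w - x') < step" by (simp add: polyball_def)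
    have "M x (w - y) \<le> M x (w - x') + (M x (x' - x) + M x (x - y))"
      using M_triangle[OF x, of w y x'] M_triangle[OF x, of x' y x] by simp
    also have "\<dots> < 2 * step + (step + step)"
      using xM[of "w - x'"] w x' y M_commute[OF x, of x y] by simp
    finally show "w \<in> polyball y (c / 32)"
      using yM[of "w - y"] c by (simp add: polyball_def)
  qed
  have "vol y \<le> (2 * 2) ^ DIM(complex^'n) * vol x'"
  proof (rule vol_le[OF x'\<Omega> y\<Omega>])
    fix v show "M x' v \<le> 2 * 2 * M y v" using x'M[of v] xM'[of v] by simp
  qed simp
  then show "vol y \<le> 4 ^ DIM(complex^'n) * vol x'" by simp
qed

text \<open>A doubling condition: the value at \<open>z\<close> is comparable, up to
  \<open>2 ^ N\<close>, with a bound for \<open>\<bar>f\<bar>\<close> near every point reachable in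
  \<open>k\<close> steps. The constants derived from it depend on \<open>N\<close> and the number of
  steps, but not on \<open>f\<close>, \<open>H\<close> or \<open>z\<close>.\<close>

definition controlled :: "(complex^'n \<Rightarrow> complex) \<Rightarrow> real \<Rightarrow> nat \<Rightarrow> complex^'n \<Rightarrow> nat \<Rightarrow> bool" where
  "controlled f H N z k \<longleftrightarrow> holomorphic_Cn f \<Omega> \<and> z \<in> \<Omega> \<and> 0 < H \<and> (1/2) ^ N * H \<le> cmod (f z) \<and>
     (\<forall>y. (z, y) \<in> near step ^^ k \<longrightarrow> (\<forall>x\<in>polyball y c. cmod (f x) \<le> H))"

lemma controlled_mono: "controlled f H N z l \<Longrightarrow> k \<le> l \<Longrightarrow> controlled f H N z k"
  unfolding controlled_def using near_pow_le[of z _ k step l] c by auto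

text \<open>Induction along the chain. If a value near \<open>x\<close> is large but all values on
  the polyball about the next point \<open>x'\<close> are tiny, then this whole polyball lies in the
  small-value set of the Remez inequality centred at the large value, and it is too big for
  that.\<close>

lemma chain_large_value:
  "\<exists>N'>0. \<forall>z f H. controlled f H N z (Suc m) \<longrightarrow>
     (\<forall>x. (z, x) \<in> near step ^^ m \<longrightarrow> (\<exists>y\<in>polyball x step. (1/2) ^ N' * H \<le> cmod (f y)))"
proof (induction m)
  case 0
  \<comment> \<open>\<open>Suc N\<close> in place of \<open>N\<close> makes the exponent positive,
    as \<open>emeasure_small_values_le\<close> requires.\<close>
  have "\<exists>y\<in>polyball z step. (1/2) ^ Suc N * H \<le> cmod (f y)" if "controlled f H N z (Suc 0)" for z f H
  proof (rule bexI[of _ z])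
    have "(1/2) ^ Suc N * H \<le> (1/2) ^ N * H"
      using that by (intro mult_right_mono) (auto simp: controlled_def)
    also have "\<dots> \<le> cmod (f z)" using that by (simp add: controlled_def)
    finally show "(1/2) ^ Suc N * H \<le> cmod (f z)" .
    show "z \<in> polyball z step" using that c by (intro center_in_polyball) (auto simp: controlled_def)
  qed
  then show ?case by (intro exI[of _ "Suc N"]) auto
next
  case (Suc m)
  define D where "D = DIM(complex^'n)"
  from Suc obtain L where L: "0 < L"
    "\<And>z f H x. controlled f H N z (Suc m) \<Longrightarrow> (z, x) \<in> near step ^^ m \<Longrightarrow> \<exists>y\<in>polyball x step. (1/2) ^ L * H \<le> cmod (f y)"
    by blast
  \<comment> \<open>With this \<open>h\<close> the Remez bound is exactly half the volume of
    \<open>polyball x' step\<close>: one factor 2, and \<open>1024 = 4 * 256\<close> per real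
    dimension, from the comparison of volumes and from \<open>step = c / 256\<close>.\<close>
  define h :: real where "h = 1 / (1024 * L * 1024 ^ D)"
  have h: "h > 0" using L(1) by (simp add: h_def)
  obtain k where k: "(1/2) ^ k < h ^ L" using real_arch_pow_inv[of "h ^ L" "1/2"] h by auto
  have k': "(1/2) ^ Suc k \<le> h ^ L"
  proof -
    have "(1/2::real) ^ Suc k \<le> (1/2) ^ k" by simp
    then show ?thesis using k by linarith
  qed
  have "\<exists>y\<in>polyball x' step. (1/2) ^ Suc k * H \<le> cmod (f y)"
    if ctr: "controlled f H N z (Suc (Suc m))" and x': "(z, x') \<in> near step ^^ Suc m" for z f H x'
  proof (rule ccontr)
    assume "\<not> ?thesis"
    then have small: "cmod (f w) < (1/2) ^ Suc k * H" if "w \<in> polyball x' step" for w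
      using that by (auto simp: not_le)
    have f: "holomorphic_Cn f \<Omega>" and z: "z \<in> \<Omega>" and H: "0 < H"
      and fH: "\<And>y x. (z, y) \<in> near step ^^ Suc (Suc m) \<Longrightarrow> x \<in> polyball y c \<Longrightarrow> cmod (f x) \<le> H"
      using ctr by (auto simp: controlled_def)
    obtain x where x: "(z, x) \<in> near step ^^ m" "(x, x') \<in> near step" using x' by auto
    have x\<Omega>: "x \<in> \<Omega>" and xx': "M x (x' - x) < step" using x(2) by (auto simp: near_def)
    obtain y where y: "y \<in> polyball x step" "(1/2) ^ L * H \<le> cmod (f y)"
      using L(2)[OF controlled_mono[OF ctr]] x(1) by auto
    have xy: "M x (y - x) < step" using y(1) by (simp add: polyball_def)
    note ps = polyball_step[OF x\<Omega> xy xx']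
    have "(z, y) \<in> near step ^^ Suc m" using x(1) xy x\<Omega> by (auto simp: near_def)
    then have "(z, y) \<in> near step ^^ Suc (Suc m)"
      using near_Suc_self[of z y "Suc m" step] c z by (simp del: relpow.simps)
    from fH[OF this] have "emeasure lborel {x \<in> polyball y (c / 32). cmod (f x) < h ^ L * H}
        \<le> ennreal (512 * real L * h * (c ^ D * vol y))"
      unfolding D_def by (intro emeasure_small_values_le[OF f ps(1) H _ y(2) L(1) h])
    moreover have "polyball x' step \<subseteq> {x \<in> polyball y (c / 32). cmod (f x) < h ^ L * H}"
    proof
      fix w assume w: "w \<in> polyball x' step"
      have "cmod (f w) < (1/2) ^ Suc k * H" by (rule small[OF w])
      also have "\<dots> \<le> h ^ L * H" using k' H by (intro mult_right_mono) auto
      finally show "w \<in> {x \<in> polyball y (c / 32). cmod (f x) < h ^ L * H}" using ps(3) w by auto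
    qed
    then have "emeasure lborel (polyball x' step) \<le> emeasure lborel {x \<in> polyball y (c / 32). cmod (f x) < h ^ L * H}"
      using small_values_measurable[OF f open_polyball[OF ps(1)] polyball_subset[OF ps(1)], of "c/32"] c
      by (intro emeasure_mono) auto
    ultimately have "emeasure lborel (polyball x' step) \<le> ennreal (512 * real L * h * (c ^ D * vol y))"
      by (rule order_trans[rotated])
    then have "ennreal (step ^ D * vol x') \<le> ennreal (512 * real L * h * (c ^ D * vol y))"
      using emeasure_polyball[OF ps(2), of step] c by (simp add: D_def)
    then have "step ^ D * vol x' \<le> 512 * real L * h * (c ^ D * vol y)"
      using L(1) h c emeasure_unit(2)[OF ps(1)] by (subst (asm) ennreal_le_iff) auto
    also have "\<dots> \<le> 512 * real L * h * (c ^ D * (4 ^ D * vol x'))"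
      using L(1) h c ps(4) unfolding D_def by (intro mult_left_mono) auto
    also have "\<dots> = 1/2 * (step ^ D * vol x')"
    proof -
      have "(1024::real) ^ D = 4 ^ D * 256 ^ D" by (simp add: power_mult_distrib[symmetric])
      then show ?thesis using L(1) by (simp add: h_def power_divide field_simps)
    qed
    finally have "step ^ D * vol x' \<le> 0" by linarith
    moreover have "0 < step ^ D * vol x'" using c emeasure_unit(2)[OF ps(2)] by simp
    ultimately show False by simp
  qed
  then show ?case by (intro exI[of _ "Suc k"]) blast
qed

text \<open>The Remez inequality needs a centre at which \<open>f\<close> is not small. It is
  centred not at \<open>x\<close> but at the large value \<open>y\<close> within one step of
  \<open>x\<close>, whose \<open>c / 32\<close> polyball still covers
  \<open>polyball x step\<close>.\<close>

lemma local_small_values: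
  "\<exists>N'>0. \<exists>C>0. \<forall>z f H x h. controlled f H N z (Suc m) \<longrightarrow> (z, x) \<in> near step ^^ m \<longrightarrow> 0 < h \<longrightarrow>
     emeasure lborel {w \<in> polyball x step. cmod (f w) < h ^ N' * H} \<le> ennreal (C * h * vol x)"
proof -
  define D where "D = DIM(complex^'n)"
  obtain L where L: "0 < L"
    "\<And>z f H x. controlled f H N z (Suc m) \<Longrightarrow> (z, x) \<in> near step ^^ m \<Longrightarrow> \<exists>y\<in>polyball x step. (1/2) ^ L * H \<le> cmod (f y)"
    using chain_large_value[of N m] by metis
  have "emeasure lborel {w \<in> polyball x step. cmod (f w) < h ^ L * H} \<le> ennreal ((512 * real L * c ^ D * 4 ^ D) * h * vol x)"
    if ctr: "controlled f H N z (Suc m)" and x: "(z, x) \<in> near step ^^ m" and h: "0 < h" for z f H x h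
  proof -
    have f: "holomorphic_Cn f \<Omega>" and z: "z \<in> \<Omega>" and H: "0 < H"
      and fH: "\<And>y x. (z, y) \<in> near step ^^ Suc m \<Longrightarrow> x \<in> polyball y c \<Longrightarrow> cmod (f x) \<le> H"
      using ctr by (auto simp: controlled_def)
    have x\<Omega>: "x \<in> \<Omega>" using near_pow_mem[OF x] z c by auto
    obtain y where y: "y \<in> polyball x step" "(1/2) ^ L * H \<le> cmod (f y)"
      using L(2)[OF ctr x] by auto
    have xy: "M x (y - x) < step" and xx: "M x (x - x) < step"
      using y(1) c by (simp_all add: polyball_def M_0[OF x\<Omega>])
    note ps = polyball_step[OF x\<Omega> xy xx]
    have "(z, y) \<in> near step ^^ Suc m" using x(1) xy x\<Omega> by (auto simp: near_def)
    from fH[OF this] have "emeasure lborel {x \<in> polyball y (c / 32). cmod (f x) < h ^ L * H}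
        \<le> ennreal (512 * real L * h * (c ^ D * vol y))"
      unfolding D_def by (intro emeasure_small_values_le[OF f ps(1) H _ y(2) L(1) h])
    also have "\<dots> \<le> ennreal (512 * real L * h * (c ^ D * (4 ^ D * vol x)))"
      using L(1) h c ps(4) unfolding D_def by (intro ennreal_leI mult_left_mono) auto
    finally have "emeasure lborel {x \<in> polyball y (c / 32). cmod (f x) < h ^ L * H}
      \<le> ennreal ((512 * real L * c ^ D * 4 ^ D) * h * vol x)"
      by (simp only: mult_ac)
    moreover have "emeasure lborel {w \<in> polyball x step. cmod (f w) < h ^ L * H}
        \<le> emeasure lborel {x \<in> polyball y (c / 32). cmod (f x) < h ^ L * H}"
      using small_values_measurable[OF f open_polyball[OF ps(1)] polyball_subset[OF ps(1)], of "c/32"] c ps(3)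
      by (intro emeasure_mono) auto
    ultimately show ?thesis by (rule order_trans[rotated])
  qed
  moreover have "0 < 512 * real L * c ^ D * 4 ^ D" using L(1) c by simp
  ultimately show ?thesis using L(1) by blast
qed

text \<open>Double counting replaces a finite cover. The local estimate is integrated over all
  \<open>x\<close> reachable in one step more; each bad point \<open>b\<close> is counted by all
  \<open>x\<close> in \<open>polyball b (step / 2)\<close>, whose volume is bounded below by a
  multiple of \<open>vol z\<close>. Of the three extra steps in \<open>controlled\<close>, one sits
  in \<open>Suc m\<close>, one leads to \<open>x\<close>, and one to the centre of the Remez
  inequality.\<close>

lemma chain_small_values:
  "\<exists>N'>0. \<exists>C>0. \<forall>z f H h. controlled f H N z (Suc (Suc (Suc m))) \<longrightarrow> 0 < h \<longrightarrow>
     emeasure lborel {x. (z, x) \<in> near step ^^ Suc m \<and> cmod (f x) < h ^ N' * H} \<le> ennreal (C * h * vol z)"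
proof -
  define D where "D = DIM(complex^'n)"
  define L :: real where "L = 2 ^ Suc m"
  have L: "L > 0" by (simp add: L_def)
  obtain N' C where N': "0 < N'" and C: "0 < C" and loc:
    "\<And>z f H x h. controlled f H N z (Suc (Suc (Suc m))) \<Longrightarrow> (z, x) \<in> near step ^^ Suc (Suc m) \<Longrightarrow> 0 < h \<Longrightarrow>
     emeasure lborel {w \<in> polyball x step. cmod (f w) < h ^ N' * H} \<le> ennreal (C * h * vol x)"
    using local_small_values[of N "Suc (Suc m)"] by (elim exE conjE) (simp del: relpow.simps)
  \<comment> \<open>The local constant, the comparison of \<open>vol x\<close> with
    \<open>vol z\<close>, and the volume of the set \<open>W\<close> of centres, divided by the
    lower bound for how often a bad point is counted.\<close>
  define C' where "C' = C * (2 * L) ^ D * (2 * L * step) ^ D / ((step / 2) ^ D / L ^ D)"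
  have "emeasure lborel {x. (z, x) \<in> near step ^^ Suc m \<and> cmod (f x) < h ^ N' * H} \<le> ennreal (C' * h * vol z)"
    if ctr: "controlled f H N z (Suc (Suc (Suc m)))" and h: "0 < h" for z f H h
  proof -
    have f: "holomorphic_Cn f \<Omega>" and z: "z \<in> \<Omega>"
      using ctr by (auto simp: controlled_def)
    have st: "0 < step" "step \<le> c" using c by auto
    have Vz: "0 < vol z" by (rule emeasure_unit(2)[OF z])
    define B where "B = {x. (z, x) \<in> near step ^^ Suc m \<and> cmod (f x) < h ^ N' * H}"
    define W where "W = {x. (z, x) \<in> near step ^^ Suc (Suc m)}"
    have [measurable]: "W \<in> sets borel" unfolding W_def by (intro borel_open near_pow_sections)
    have "{x. (z, x) \<in> near step ^^ Suc m} \<subseteq> \<Omega>" using near_pow_mem[OF _ st(2) z] by blast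
    from small_values_measurable[OF f near_pow_sections(1) this]
    have [measurable]: "B \<in> sets borel" unfolding B_def by (simp del: relpow.simps)
    have near_meas [measurable]: "Measurable.pred (borel \<Otimes>\<^sub>M borel) (\<lambda>p. p \<in> near step)"
      using near_pow_measurable[of 0 step] by simp
    have "ennreal ((step / 2) ^ D / L ^ D * vol z) * emeasure lborel B
        = (\<integral>\<^sup>+b. ennreal ((step / 2) ^ D / L ^ D * vol z) * indicator B b \<partial>lborel)"
      by (subst nn_integral_cmult_indicator) auto
    also have "\<dots> \<le> (\<integral>\<^sup>+b. \<integral>\<^sup>+x. indicator B b * (indicator W x * indicator (near step) (x, b)) \<partial>lborel \<partial>lborel)"
    proof (rule nn_integral_mono)
      fix b
      show "ennreal ((step / 2) ^ D / L ^ D * vol z) * indicator B b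
          \<le> (\<integral>\<^sup>+x. indicator B b * (indicator W x * indicator (near step) (x, b)) \<partial>lborel)"
      proof (cases "b \<in> B")
        case True
        then have zb: "(z, b) \<in> near step ^^ Suc m" by (simp add: B_def)
        have b: "b \<in> \<Omega>" using near_pow_mem[OF zb st(2) z] .
        have "vol z \<le> L ^ D * vol b" using near_pow_vol(2)[OF zb st(2) z] by (simp only: L_def D_def)
        then have "(step / 2) ^ D / L ^ D * vol z \<le> (step / 2) ^ D / L ^ D * (L ^ D * vol b)"
          using L st by (intro mult_left_mono) auto
        also have "\<dots> = (step / 2) ^ D * vol b" using L by simp
        finally have "ennreal ((step / 2) ^ D / L ^ D * vol z) \<le> emeasure lborel (polyball b (step / 2))"
          using emeasure_polyball[OF b, of "step / 2"] st by (simp add: D_def ennreal_leI)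
        also have "\<dots> = (\<integral>\<^sup>+x. indicator (polyball b (step / 2)) x \<partial>lborel)" using b by simp
        also have "\<dots> \<le> (\<integral>\<^sup>+x. indicator W x * indicator (near step) (x, b) \<partial>lborel)"
        proof (rule nn_integral_mono)
          fix x
          \<comment> \<open>Radius \<open>step / 2\<close> absorbs the factor 2 between the norms at
            \<open>b\<close> and at \<open>x\<close>, so that the step is admissible in both
            directions.\<close>
          have "x \<in> W \<and> (x, b) \<in> near step" if x: "x \<in> polyball b (step / 2)"
          proof
            have bx: "M b (x - b) < step / 2" using x by (simp add: polyball_def)
            then have le: "M b (x - b) \<le> c" using st by simp
            have "(b, x) \<in> near step" using bx b st by (simp add: near_def)
            with zb show "x \<in> W" unfolding W_def by auto
            show "(x, b) \<in> near step"
              using plump_mem[OF b le] plump_le[OF b le, of "x - b"] bx M_commute[OF plump_mem[OF b le], of x b]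
              by (simp add: near_def)
          qed
          then show "indicator (polyball b (step / 2)) x \<le> (indicator W x * indicator (near step) (x, b) :: ennreal)"
            by (auto simp: indicator_def)
        qed
        finally show ?thesis using True by simp
      qed simp
    qed
    also have "\<dots> = (\<integral>\<^sup>+x. \<integral>\<^sup>+b. indicator B b * (indicator W x * indicator (near step) (x, b)) \<partial>lborel \<partial>lborel)"
      by (rule lborel_pair.Fubini') measurable
    also have "\<dots> \<le> (\<integral>\<^sup>+x. ennreal (C * h * ((2 * L) ^ D * vol z)) * indicator W x \<partial>lborel)"
    proof (rule nn_integral_mono)
      fix x
      show "(\<integral>\<^sup>+b. indicator B b * (indicator W x * indicator (near step) (x, b)) \<partial>lborel)
        \<le> ennreal (C * h * ((2 * L) ^ D * vol z)) * indicator W x"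
      proof (cases "x \<in> W")
        case True
        then have zx: "(z, x) \<in> near step ^^ Suc (Suc m)" by (simp add: W_def)
        have x: "x \<in> \<Omega>" using near_pow_mem[OF zx st(2) z] .
        have "(\<integral>\<^sup>+b. indicator B b * (indicator W x * indicator (near step) (x, b)) \<partial>lborel)
           \<le> (\<integral>\<^sup>+b. indicator {w \<in> polyball x step. cmod (f w) < h ^ N' * H} b \<partial>lborel)"
          by (intro nn_integral_mono) (auto simp: indicator_def near_def polyball_def B_def)
        also have "\<dots> = emeasure lborel {w \<in> polyball x step. cmod (f w) < h ^ N' * H}"
          using small_values_measurable[OF f open_polyball[OF x] polyball_subset[OF x st(2)]] by simp
        also have "\<dots> \<le> ennreal (C * h * vol x)" by (rule loc[OF ctr zx h])
        also have "\<dots> \<le> ennreal (C * h * ((2 * L) ^ D * vol z))"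
          using near_pow_vol(1)[OF zx st(2) z] C h
          by (intro ennreal_leI mult_left_mono) (auto simp: L_def D_def)
        finally show ?thesis using True by simp
      qed simp
    qed
    also have "\<dots> = ennreal (C * h * ((2 * L) ^ D * vol z)) * emeasure lborel W"
      by (subst nn_integral_cmult_indicator) auto
    also have "\<dots> \<le> ennreal (C * h * ((2 * L) ^ D * vol z)) * ennreal ((2 * L * step) ^ D * vol z)"
      using emeasure_near_pow_right[OF z st, of "Suc (Suc m)"]
      by (intro mult_left_mono) (simp_all add: W_def L_def D_def del: relpow.simps)
    also have "\<dots> = ennreal (C * h * ((2 * L) ^ D * vol z) * ((2 * L * step) ^ D * vol z))"
      using C h L Vz st by (intro ennreal_mult[symmetric]) auto
    finally have "emeasure lborel B \<le> ennreal (C * h * ((2 * L) ^ D * vol z) * ((2 * L * step) ^ D * vol z)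
        / ((step / 2) ^ D / L ^ D * vol z))"
      using C h L Vz st by (intro ennreal_mult_le_imp_le_divide) auto
    also have "C * h * ((2 * L) ^ D * vol z) * ((2 * L * step) ^ D * vol z)
        / ((step / 2) ^ D / L ^ D * vol z) = C' * h * vol z"
    proof -
      have "C * h * (a * V) * (b * V) / (k * V) = C * a * b / k * h * V" if "V \<noteq> 0" "k \<noteq> 0" for a b k V :: real
        using that by (simp add: field_simps)
      then show ?thesis using Vz L st by (simp add: C'_def)
    qed
    finally show ?thesis by (simp only: B_def)
  qed
  moreover have "0 < C'" using C L c by (simp add: C'_def)
  ultimately show ?thesis using N' by blast
qed

end

section \<open>Sample points at which a function is not small\<close>

context plump_metric
begin

text \<open>
  The covering hypothesis forces at least of order \<open>\<gamma> t\<^sup>-\<^sup>2\<^sup>n\<close> sample points at which \<open>\<bar>f\<bar>\<close> is not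
  small; this number beats the loss in \<open>\<gamma>\<close> of the Remez inequality when \<open>t\<close> is a small multiple
  of a high power of \<open>\<gamma>\<close>.
\<close>
lemma good_point:
  assumes p: "1 \<le> p" and \<epsilon>: "0 < \<epsilon>"
  shows "\<exists>C>0. \<exists>q>0. \<forall>\<gamma> t a f z. 0 < \<gamma> \<longrightarrow> \<gamma> \<le> 1 \<longrightarrow> 0 < t \<longrightarrow> t < inverse C * \<gamma> powr q \<longrightarrow> (\<forall>j::nat. a j \<in> \<Omega>) \<longrightarrow> z \<in> \<Omega> \<longrightarrow>
    ennreal (\<gamma> * vol z) \<le> emeasure lborel ((\<Union>j. polyball (a j) t) \<inter> {x. (z, x) \<in> near step ^^ Suc m}) \<longrightarrow>
    holomorphic_Cn f \<Omega> \<longrightarrow>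
    ennreal \<epsilon> * (\<integral>\<^sup>+w. indicator (near c ^^ Suc (m + 4)) (z, w) * weight f p w \<partial>lborel) \<le> ennreal (cmod (f z) powr p * vol z) \<longrightarrow>
    ennreal (cmod (f z) powr p) \<le> (\<Sum>j. indicator (near c ^^ Suc (Suc m)) (z, a j) * ennreal (cmod (f (a j)) powr p))"
proof -
  define D where "D = DIM(complex^'n)"
  have D: "D > 0" by (simp add: D_def)
  \<comment> \<open>The submean value property at radius \<open>c / 2\<close> yields
    \<open>(2 / c) ^ D\<close>; the other factor compares the volumes at the ends of a chain of
    \<open>m + 4\<close> steps.\<close>
  define C1 where "C1 = (2 / c) ^ D * (2 ^ (m + 4)) ^ D"
  have C1: "C1 > 0" using c by (simp add: C1_def)
  \<comment> \<open>Below, \<open>H^p\<close> is \<open>C1\<close> times the mean over the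
    neighbourhood, so the hypothesis on \<open>z\<close> says
    \<open>\<bar>f(z)\<bar>^p \<ge> (\<epsilon> / C1) H^p\<close>; \<open>N0\<close> turns this into
    the dyadic bound of \<open>controlled\<close>.\<close>
  obtain N0 where N0: "(1/2) ^ N0 < (\<epsilon> / C1) powr (1 / p)"
    using real_arch_pow_inv[of "(\<epsilon> / C1) powr (1 / p)" "1/2"] \<epsilon> C1 by auto
  from chain_small_values[of N0 m] obtain N' C2 where N': "0 < N'" and C2: "0 < C2" and small:
    "\<And>z f H h. controlled f H N0 z (Suc (Suc (Suc m))) \<Longrightarrow> 0 < h \<Longrightarrow>
     emeasure lborel {x. (z, x) \<in> near step ^^ Suc m \<and> cmod (f x) < h ^ N' * H} \<le> ennreal (C2 * h * vol z)"
    by (elim exE conjE) (simp del: relpow.simps)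
  define E :: real where "E = (2 ^ Suc (Suc m)) ^ D"
  have E: "0 < E" by (simp add: E_def)
  define Q0 where "Q0 = ((1 / (2 * C2)) ^ N' / 2) powr p"
  have Q0: "Q0 > 0" using C2 by (simp add: Q0_def)
  \<comment> \<open>The three summands serve \<open>t1\<close> (sample points stay within reach),
    \<open>t2\<close> (\<open>f\<close> varies little between a covered point and its sample point)
    and \<open>t3\<close> (the number of sample points beats the loss).\<close>
  define C where "C = 2 / c + 8 * (2 * C2) ^ N' / c + 2 * E / Q0"
  \<comment> \<open>\<open>N' * p\<close> is the power of \<open>\<gamma>\<close> lost in
    \<open>(h ^ N') powr p\<close>, where \<open>h\<close> is proportional to
    \<open>\<gamma>\<close>; the extra 1 pays for the density \<open>\<gamma>\<close>
    itself.\<close>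
  define q where "q = N' * p + 1"
  have "0 < 2 / c" "0 < 8 * (2 * C2) ^ N' / c" "0 < 2 * E / Q0" using c C2 E Q0 by auto
  then have C: "C > 0" "2 / c \<le> C" "8 * (2 * C2) ^ N' / c \<le> C" "2 * E / Q0 \<le> C"
    unfolding C_def by linarith+
  have "real N' * 1 \<le> real N' * p" using p by (intro mult_left_mono) auto
  moreover have "0 < real N'" using N' by simp
  ultimately have q: "q > 0" "real N' \<le> q" unfolding q_def by linarith+
  have "ennreal (cmod (f z) powr p) \<le> (\<Sum>j. indicator (near c ^^ Suc (Suc m)) (z, a j) * ennreal (cmod (f (a j)) powr p))"
    if \<gamma>: "0 < \<gamma>" "\<gamma> \<le> 1" and t: "0 < t" "t < inverse C * \<gamma> powr q" and a: "\<And>j. a j \<in> \<Omega>" and z: "z \<in> \<Omega>"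
      and cover: "ennreal (\<gamma> * vol z) \<le> emeasure lborel ((\<Union>j. polyball (a j) t) \<inter> {x. (z, x) \<in> near step ^^ Suc m})"
      and f: "holomorphic_Cn f \<Omega>"
      and good: "ennreal \<epsilon> * (\<integral>\<^sup>+w. indicator (near c ^^ Suc (m + 4)) (z, w) * weight f p w \<partial>lborel) \<le> ennreal (cmod (f z) powr p * vol z)"
    for \<gamma> t f z and a :: "nat \<Rightarrow> complex^'n"
  proof (cases "f z = 0")
    case False
    have V: "vol z > 0" by (rule emeasure_unit(2)[OF z])
    have st: "0 < step" "step \<le> c" using c by auto
    define A where "A = (\<integral>\<^sup>+w. indicator (near c ^^ Suc (m + 4)) (z, w) * weight f p w \<partial>lborel)"
    have "A \<noteq> top"
    proof
      assume "A = top"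
      then have "ennreal \<epsilon> * A = top" using \<epsilon> by (simp add: ennreal_mult_top)
      then show False using good by (simp add: A_def top_unique)
    qed
    then obtain Ar where Ar: "A = ennreal Ar" "0 \<le> Ar" by (cases A) auto
    have sub: "cmod (f x) powr p \<le> C1 * Ar / vol z" if x: "(z, x) \<in> near c ^^ (m + 4)" for x
    proof -
      have x\<Omega>: "x \<in> \<Omega>" using near_pow_mem[OF x _ z] by simp
      have "ennreal (cmod (f x) powr p * ((c/2) ^ D * vol x)) \<le> (\<integral>\<^sup>+w. indicator (polyball x (c/2)) w * weight f p w \<partial>lborel)"
        unfolding D_def using c by (intro submean_value[OF f x\<Omega> p]) auto
      also have "\<dots> \<le> A" unfolding A_def
      proof (rule nn_integral_mono)
        fix w
        have "(z, w) \<in> near c ^^ Suc (m + 4)" if "w \<in> polyball x (c/2)"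
        proof (rule relpow_Suc_I[OF x])
          show "(x, w) \<in> near c" using x\<Omega> that c by (simp add: near_def polyball_def)
        qed
        then show "indicator (polyball x (c/2)) w * weight f p w \<le> indicator (near c ^^ Suc (m + 4)) (z, w) * weight f p w"
          by (auto simp: indicator_def simp del: relpow.simps)
      qed
      finally have 1: "cmod (f x) powr p * ((c/2) ^ D * vol x) \<le> Ar"
        using Ar by (simp add: ennreal_le_iff)
      have "vol z \<le> (2 ^ (m + 4)) ^ D * vol x" unfolding D_def using near_pow_vol(2)[OF x _ z] by simp
      then have "(cmod (f x) powr p * (c/2) ^ D) * vol z \<le> (cmod (f x) powr p * (c/2) ^ D) * ((2 ^ (m + 4)) ^ D * vol x)"
        using c by (intro mult_left_mono) auto
      also have "\<dots> = (2 ^ (m + 4)) ^ D * (cmod (f x) powr p * ((c/2) ^ D * vol x))" by (simp only: mult_ac)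
      also have "\<dots> \<le> (2 ^ (m + 4)) ^ D * Ar" using 1 by (intro mult_left_mono) auto
      finally have "(2/c) ^ D * ((cmod (f x) powr p * (c/2) ^ D) * vol z) \<le> (2/c) ^ D * ((2 ^ (m + 4)) ^ D * Ar)"
        using c by (intro mult_left_mono) auto
      also have "(2/c) ^ D * ((cmod (f x) powr p * (c/2) ^ D) * vol z)
        = ((2/c) ^ D * (c/2) ^ D) * (cmod (f x) powr p * vol z)" by (simp only: mult_ac)
      also have "(2/c) ^ D * (c/2) ^ D = (2/c * (c/2)) ^ D" by (rule power_mult_distrib[symmetric])
      also have "2/c * (c/2) = 1" using c by simp
      finally have "cmod (f x) powr p * vol z \<le> C1 * Ar" by (simp only: C1_def mult.assoc power_one mult_1_left)
      then show ?thesis using V by (simp only: pos_le_divide_eq)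
    qed
    have "0 < cmod (f z) powr p" using False by simp
    also have "(z, z) \<in> near c ^^ (m + 4)"
      using near_pow_le[of z z 0 c "m + 4"] c z by simp
    note sub[OF this]
    finally have Ar0: "Ar > 0" using C1 V Ar(2) by (auto simp: zero_less_divide_iff zero_less_mult_iff)
    define H where "H = (C1 * Ar / vol z) powr (1 / p)"
    have H: "H > 0" using C1 V Ar0 by (simp add: H_def)
    have Hp: "H powr p = C1 * Ar / vol z" using p C1 V Ar0 by (simp add: H_def powr_powr)
    have le_H: "cmod (f x) \<le> H" if "(z, x) \<in> near c ^^ (m + 4)" for x
    proof (rule ccontr)
      assume "\<not> ?thesis"
      then have "H powr p < cmod (f x) powr p" using H p by (intro powr_less_mono2) auto
      then show False using sub[OF that] Hp by simp
    qed
    have "(1/2) ^ N0 * H \<le> cmod (f z)"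
    proof (rule ccontr)
      assume "\<not> ?thesis"
      then have "cmod (f z) powr p < ((1/2) ^ N0 * H) powr p" using p by (intro powr_less_mono2) auto
      also have "\<dots> \<le> ((\<epsilon> / C1) powr (1 / p) * H) powr p"
        using N0 H p by (intro powr_mono2 mult_right_mono) auto
      also have "\<dots> = \<epsilon> / C1 * (C1 * Ar / vol z)"
        using p \<epsilon> C1 H by (simp add: powr_mult Hp powr_powr)
      also have "\<dots> = \<epsilon> * Ar / vol z" using C1 by simp
      finally have "cmod (f z) powr p * vol z < \<epsilon> * Ar" using V by (simp add: field_simps)
      moreover have "ennreal (\<epsilon> * Ar) \<le> ennreal (cmod (f z) powr p * vol z)"
        using good Ar \<epsilon> unfolding A_def[symmetric] by (simp add: ennreal_mult)
      then have "\<epsilon> * Ar \<le> cmod (f z) powr p * vol z"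
        using V by (subst (asm) ennreal_le_iff) auto
      ultimately show False by simp
    qed
    \<comment> \<open>At most \<open>m + 3\<close> small steps and one step of size \<open>c\<close>
      give \<open>m + 4\<close>. The additional step in \<open>Suc (m + 4)\<close> is taken by the
      submean value property.\<close>
    moreover have near_c: "(z, x) \<in> near c ^^ (m + 4)" if y: "(z, y) \<in> near step ^^ k" "k \<le> m + 3" and x: "x \<in> polyball y c" for x y k
    proof -
      have "(z, y) \<in> near c ^^ k" using near_pow_mono[OF st(2)] y(1) by blast
      then have "(z, y) \<in> near c ^^ (m + 3)" using near_pow_le y(2) c z by blast
      moreover have "y \<in> \<Omega>" using near_pow_mem[OF y(1) st(2) z] .
      then have "(y, x) \<in> near c" using x by (simp add: near_def polyball_def)
      ultimately have "(z, x) \<in> near c ^^ Suc (m + 3)" by (rule relpow_Suc_I)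
      moreover have "Suc (m + 3) = m + 4" by simp
      ultimately show ?thesis by (simp only:)
    qed
    then have "cmod (f x) \<le> H" if "(z, y) \<in> near step ^^ Suc (Suc (Suc m))" "x \<in> polyball y c" for x y
      using le_H[OF near_c[OF that(1) _ that(2)]] by simp
    ultimately have ctr: "controlled f H N0 z (Suc (Suc (Suc m)))"
      unfolding controlled_def using f z H by blast
    \<comment> \<open>Then the set where \<open>\<bar>f\<bar> < h ^ N' * H\<close> has measure at
      most \<open>\<gamma> * vol z / 2\<close>, half of what the hypothesis says is covered.\<close>
    define h where "h = \<gamma> / (2 * C2)"
    have h: "h > 0" using \<gamma> C2 by (simp add: h_def)
    have hN: "h ^ N' = (1 / (2 * C2)) ^ N' * \<gamma> powr N'"
      using \<gamma> by (simp add: h_def power_divide powr_realpow)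
    have q1: "\<gamma> powr q \<le> 1" "\<gamma> powr q \<le> \<gamma> powr N'"
      using \<gamma> q powr_mono'[of 0 q \<gamma>] powr_mono'[of "real N'" q \<gamma>] by auto
    have tC: "t * C < \<gamma> powr q" using t(2) C(1) by (simp add: field_simps)
    have t1: "t < c / 2"
    proof -
      have "t * (2 / c) \<le> t * C" using t(1) C(2) by (intro mult_left_mono) auto
      then have "t * (2 / c) < 1" using tC q1(1) by linarith
      then show ?thesis using c by (simp add: field_simps)
    qed
    \<comment> \<open>A sample point lies at parameter \<open>2 * t / c\<close> of a disc on which
      \<open>\<bar>f\<bar> \<le> H\<close>. The Lipschitz bound \<open>2 * H * (2 * t / c)\<close>
      thus is at most half of \<open>h ^ N' * H\<close>.\<close>
    have t2: "8 * t \<le> c * h ^ N'"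
    proof -
      have "t * (8 * (2 * C2) ^ N' / c) \<le> t * C" using t(1) C(3) by (intro mult_left_mono) auto
      then have "t * (8 * (2 * C2) ^ N' / c) \<le> \<gamma> powr N'" using tC q1(2) by linarith
      then show ?thesis unfolding hN using c C2 by (simp add: field_simps)
    qed
    define Q where "Q = (h ^ N' / 2) powr p"
    have Q: "Q > 0" using h by (simp add: Q_def)
    have Q_eq: "Q = Q0 * \<gamma> powr (N' * p)"
    proof -
      have "h ^ N' / 2 = ((1 / (2 * C2)) ^ N' / 2) * \<gamma> powr N'" unfolding hN by simp
      then have "Q = ((1 / (2 * C2)) ^ N' / 2 * \<gamma> powr N') powr p" by (simp only: Q_def)
      also have "\<dots> = Q0 * (\<gamma> powr N') powr p" unfolding Q0_def by (rule powr_mult)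
      finally show ?thesis by (simp only: powr_powr)
    qed
    \<comment> \<open>The estimate \<open>t ^ D \<le> t\<close> is enough here and makes the
      condition on \<open>t\<close> linear.\<close>
    have t3: "t ^ D * E \<le> Q * \<gamma> / 2"
    proof -
      have "t * (2 * E / Q0) \<le> t * C" using t(1) C(4) by (intro mult_left_mono) auto
      then have "t * (2 * E / Q0) \<le> \<gamma> powr q" using tC by linarith
      then have "t * E \<le> Q0 * \<gamma> powr q / 2" using Q0 by (simp add: field_simps)
      moreover have "\<gamma> powr q = \<gamma> powr (N' * p) * \<gamma>" using \<gamma> by (simp add: q_def powr_add)
      moreover have "t ^ D \<le> t"
        using power_decreasing[of 1 D t] t1 t(1) c D by simp
      then have "t ^ D * E \<le> t * E" using E by (intro mult_right_mono) auto
      ultimately show ?thesis by (simp add: Q_eq)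
    qed
    define Z where "Z = {x. (z, x) \<in> near step ^^ Suc m}"
    have [measurable]: "Z \<in> sets borel" unfolding Z_def by (intro borel_open near_pow_sections)
    define S where "S = {x. (z, x) \<in> near step ^^ Suc m \<and> cmod (f x) < h ^ N' * H}"
    have "{x. (z, x) \<in> near step ^^ Suc m} \<subseteq> \<Omega>" using near_pow_mem[OF _ st(2) z] by blast
    from small_values_measurable[OF f near_pow_sections(1) this]
    have [measurable]: "S \<in> sets borel" unfolding S_def by (simp del: relpow.simps)
    \<comment> \<open>The indices whose balls meet the covered part outside the small-value set;
      these balls must cover the remaining half.\<close>
    define J where "J = {j. \<exists>x\<in>polyball (a j) t. x \<in> Z - S}"
    have J: "(z, a j) \<in> near c ^^ Suc (Suc m) \<and> h ^ N' * H / 2 \<le> cmod (f (a j))" if "j \<in> J" for j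
    proof -
      obtain x where x: "x \<in> polyball (a j) t" "(z, x) \<in> near step ^^ Suc m" "h ^ N' * H \<le> cmod (f x)"
        using \<open>j \<in> J\<close> by (auto simp: J_def Z_def S_def not_less simp del: relpow.simps)
      have ax: "M (a j) (x - a j) < t" using x(1) by (simp add: polyball_def)
      then have le: "M (a j) (x - a j) \<le> c" using t1 c by simp
      have x\<Omega>: "x \<in> \<Omega>" by (rule plump_mem[OF a le])
      have xa: "M x (a j - x) < 2 * t"
        using plump_le[OF a le, of "x - a j"] ax M_commute[OF x\<Omega>, of x "a j"] by simp
      then have "(x, a j) \<in> near c" using x\<Omega> t1 by (simp add: near_def)
      moreover have "(z, x) \<in> near c ^^ Suc m" using near_pow_mono[OF st(2)] x(2) by blast
      ultimately have 1: "(z, a j) \<in> near c ^^ Suc (Suc m)" by (rule relpow_Suc_I[rotated])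
      \<comment> \<open>Scaled so that the disc \<open>x + \<zeta> *s v\<close> has
        \<open>M\<close>-radius at most \<open>c\<close> and passes through \<open>a j\<close> at
        \<open>\<zeta> = 2 * t / c\<close>.\<close>
      define v where "v = of_real (c / (2 * t)) *s (a j - x)"
      have Mv: "M x v \<le> c"
      proof -
        have "M x v = c / (2 * t) * M x (a j - x)" 
          unfolding v_def M_scale[OF x\<Omega>] norm_of_real using c t by simp
        also have "\<dots> \<le> c / (2 * t) * (2 * t)" using xa c t by (intro mult_left_mono) auto
        finally show ?thesis using t by simp
      qed
      define g where "g = (\<lambda>\<zeta>. f (x + \<zeta> *s v))"
      have "g holomorphic_on ball 0 1" unfolding g_def by (rule holomorphic_along_line[OF f x\<Omega> Mv])
      moreover have "norm (g \<zeta>) \<le> H" if "norm \<zeta> < 1" for \<zeta>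
      proof -
        have "M x (\<zeta> *s v) < c"
        proof (cases "M x v = 0")
          case False
          then have "cmod \<zeta> * M x v < 1 * M x v" using that M_nonneg[OF x\<Omega>, of v] by (intro mult_strict_right_mono) auto
          then show ?thesis using Mv M_scale[OF x\<Omega>] by simp
        qed (use c M_scale[OF x\<Omega>] in simp)
        then have "x + \<zeta> *s v \<in> polyball x c" by (simp add: polyball_def)
        from le_H[OF near_c[OF x(2) _ this]] show ?thesis by (simp add: g_def)
      qed
      ultimately have "norm (g (of_real (2 * t / c)) - g 0) \<le> 2 * H * norm (of_real (2 * t / c) :: complex)"
        using t t1 c by (intro bounded_holomorphic_Lipschitz_at_0) (auto simp: norm_divide norm_mult)
      moreover have "g (of_real (2 * t / c)) = f (a j)"
      proof -
        have "complex_of_real (2 * t / c) *s v = complex_of_real ((2 * t / c) * (c / (2 * t))) *s (a j - x)"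
          unfolding v_def vector_smult_assoc by (simp only: of_real_mult)
        also have "(2 * t / c) * (c / (2 * t)) = 1" using t c by simp
        finally show ?thesis by (simp add: g_def)
      qed
      ultimately have "norm (f (a j) - f x) \<le> 2 * H * (2 * t / c)"
        using t c by (simp add: g_def norm_divide norm_mult)
      also have "\<dots> = H * (8 * t) / (2 * c)" by simp
      also have "\<dots> \<le> H * (c * h ^ N') / (2 * c)" using t2 H c by (intro divide_right_mono mult_left_mono) auto
      also have "\<dots> = h ^ N' * H / 2" using c by simp
      finally have "norm (f (a j) - f x) \<le> h ^ N' * H / 2" .
      then have "h ^ N' * H / 2 \<le> cmod (f (a j))"
        using x(3) norm_triangle_ineq2[of "f x" "f x - f (a j)"] norm_minus_commute[of "f x" "f (a j)"] by simp
      with 1 show ?thesis by blast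
    qed
    have aj: "polyball (a j) t \<in> sets borel" for j by (rule polyball_measurable[OF a])
    \<comment> \<open>The number of indices in \<open>J\<close>, possibly infinite.\<close>
    define SJ where "SJ = (\<Sum>j. indicator J j :: ennreal)"
    have "ennreal (\<gamma> * vol z) \<le> emeasure lborel ((\<Union>j. polyball (a j) t) \<inter> Z)" using cover by (simp only: Z_def)
    also have "\<dots> \<le> emeasure lborel (S \<union> (\<Union>j. if j \<in> J then polyball (a j) t else {}))"
    proof (rule emeasure_mono)
      show "(\<Union>j. polyball (a j) t) \<inter> Z \<subseteq> S \<union> (\<Union>j. if j \<in> J then polyball (a j) t else {})"
      proof safe
        fix x j assume "x \<in> polyball (a j) t" "x \<in> Z" and no: "x \<notin> (\<Union>j. if j \<in> J then polyball (a j) t else {})"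
        then show "x \<in> S" unfolding J_def by (cases "j \<in> J") (auto simp: J_def)
      qed
      show "S \<union> (\<Union>j. if j \<in> J then polyball (a j) t else {}) \<in> sets lborel"
        using aj by (auto intro!: sets.Un sets.countable_UN)
    qed
    also have "\<dots> \<le> emeasure lborel S + emeasure lborel (\<Union>j. if j \<in> J then polyball (a j) t else {})"
      using aj by (intro emeasure_subadditive) (auto intro!: sets.countable_UN)
    also have "\<dots> \<le> ennreal (C2 * h * vol z) + (\<Sum>j. emeasure lborel (if j \<in> J then polyball (a j) t else {}))"
      using aj unfolding S_def by (intro add_mono small[OF ctr h] emeasure_subadditive_countably) auto
    also have "(\<Sum>j. emeasure lborel (if j \<in> J then polyball (a j) t else {})) \<le> (\<Sum>j. ennreal (t ^ D * E * vol z) * indicator J j)"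
    proof (intro suminf_le)
      fix j
      show "emeasure lborel (if j \<in> J then polyball (a j) t else {}) \<le> ennreal (t ^ D * E * vol z) * indicator J j"
      proof (cases "j \<in> J")
        case True
        have "vol (a j) \<le> E * vol z"
          using near_pow_vol(1)[OF conjunct1[OF J[OF True]] _ z] by (simp only: E_def D_def)
        then have "t ^ D * vol (a j) \<le> t ^ D * (E * vol z)" using t by (intro mult_left_mono) auto
        then show ?thesis using True emeasure_polyball[OF a t(1), of j] by (simp add: D_def ennreal_leI mult.assoc)
      qed simp
    qed auto
    also have "\<dots> = ennreal (t ^ D * E * vol z) * SJ" unfolding SJ_def by (rule ennreal_suminf_cmult)
    finally have "ennreal (\<gamma> * vol z) \<le> ennreal (C2 * h * vol z) + ennreal (t ^ D * E * vol z) * SJ" by simp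
    also have "C2 * h * vol z = \<gamma> * vol z / 2" using C2 by (simp add: h_def)
    also have "ennreal (\<gamma> * vol z) = ennreal (\<gamma> * vol z / 2) + ennreal (\<gamma> * vol z / 2)"
      using \<gamma> V by (subst ennreal_plus[symmetric]) auto
    finally have "ennreal (\<gamma> * vol z / 2) \<le> ennreal (t ^ D * E * vol z) * SJ"
      by (simp only: ennreal_add_left_cancel_le infinity_ennreal_def ennreal_neq_top simp_thms)
    also have "\<dots> \<le> ennreal (\<gamma> * vol z / 2 * Q) * SJ"
    proof (intro mult_right_mono ennreal_leI)
      have "t ^ D * E * vol z \<le> Q * \<gamma> / 2 * vol z" using t3 V by (intro mult_right_mono) auto
      then show "t ^ D * E * vol z \<le> \<gamma> * vol z / 2 * Q" by (simp add: mult_ac)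
    qed simp
    also have "\<dots> = ennreal (\<gamma> * vol z / 2) * (ennreal Q * SJ)"
    proof -
      have "ennreal (\<gamma> * vol z / 2 * Q) = ennreal (\<gamma> * vol z / 2) * ennreal Q"
        using \<gamma> V by (intro ennreal_mult') auto
      then show ?thesis by (simp only: mult.assoc)
    qed
    finally have "ennreal (\<gamma> * vol z / 2) * 1 \<le> ennreal (\<gamma> * vol z / 2) * (ennreal Q * SJ)" by simp
    \<comment> \<open>\<open>Q * H^p\<close> is a lower bound for
      \<open>\<bar>f(a j)\<bar>^p\<close> when \<open>j\<close> is in \<open>J\<close>. Multiplying
      by \<open>H^p\<close> thus turns this count into the claim.\<close>
    then have one: "1 \<le> ennreal Q * SJ"
      using \<gamma> V by (subst (asm) ennreal_mult_le_mult_iff) auto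
    have "ennreal (cmod (f z) powr p) \<le> ennreal (H powr p)"
      using le_H[OF \<open>(z, z) \<in> near c ^^ (m + 4)\<close>] p by (intro ennreal_leI powr_mono2) auto
    also have "\<dots> = ennreal (H powr p) * 1" by simp
    also have "\<dots> \<le> ennreal (H powr p) * (ennreal Q * SJ)" using one by (rule mult_left_mono) simp
    also have "\<dots> = ennreal (H powr p * Q) * SJ"
      by (simp only: ennreal_mult'[OF powr_ge_zero] mult.assoc)
    also have "\<dots> = (\<Sum>j. ennreal (H powr p * Q) * indicator J j)" unfolding SJ_def by (rule ennreal_suminf_cmult[symmetric])
    also have "\<dots> \<le> (\<Sum>j. indicator (near c ^^ Suc (Suc m)) (z, a j) * ennreal (cmod (f (a j)) powr p))"
    proof (intro suminf_le)
      fix j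
      show "ennreal (H powr p * Q) * indicator J j \<le> indicator (near c ^^ Suc (Suc m)) (z, a j) * ennreal (cmod (f (a j)) powr p)"
      proof (cases "j \<in> J")
        case True
        have "H powr p * Q = (h ^ N' * H / 2) powr p"
        proof -
          have "h ^ N' * H / 2 = H * (h ^ N' / 2)" by simp
          then show ?thesis using H h by (simp only: Q_def powr_mult)
        qed
        also have "\<dots> \<le> cmod (f (a j)) powr p" using J[OF True] h H p by (intro powr_mono2) auto
        finally show ?thesis using True J[OF True] by (simp add: ennreal_leI del: relpow.simps)
      qed simp
    qed auto
    finally show ?thesis .
  qed (use p in simp)
  then show ?thesis using C(1) q(1) by blast
qed

end

section \<open>Integration against a slowly varying weight\<close>

context plump_metric
begin

text \<open>In the application \<open>\<omega>\<close> is the depth to the power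
  \<open>\<alpha>\<close>, and \<open>b\<close> is the factor by which it varies within distance
  \<open>c\<close>.\<close>

context
  fixes \<omega> :: "complex^'n \<Rightarrow> real" and b :: real
  assumes \<omega>_cont: "continuous_on \<Omega> \<omega>" and \<omega>_pos: "\<And>z. z \<in> \<Omega> \<Longrightarrow> 0 < \<omega> z" and b: "1 \<le> b"
    and \<omega>_le: "\<And>z w. z \<in> \<Omega> \<Longrightarrow> M z (w - z) \<le> c \<Longrightarrow> \<omega> w \<le> b * \<omega> z \<and> \<omega> z \<le> b * \<omega> w"
begin

lemma near_pow_weight:
  assumes "(z, w) \<in> near c ^^ k" "z \<in> \<Omega>"
  shows "\<omega> z \<le> b ^ k * \<omega> w"
  using assms(1)
proof (induction k arbitrary: w)
  case (Suc k)
  then obtain y where y: "(z, y) \<in> near c ^^ k" "(y, w) \<in> near c" by auto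
  have "\<omega> y \<le> b * \<omega> w" using \<omega>_le[of y w] y(2) by (auto simp: near_def)
  then have "b ^ k * \<omega> y \<le> b ^ k * (b * \<omega> w)" using b by (intro mult_left_mono) auto
  then show ?case using Suc.IH[OF y(1)] by (simp add: mult_ac)
qed simp

lemma weight_measurable': "(\<lambda>x. indicator \<Omega> x * ennreal (\<omega> x)) \<in> borel_measurable borel"
proof -
  have "(\<lambda>x. indicator \<Omega> x *\<^sub>R \<omega> x) \<in> borel_measurable borel"
    by (intro borel_measurable_continuous_on_indicator \<omega>_cont borel_open open_dom)
  then have "(\<lambda>x. ennreal (indicator \<Omega> x *\<^sub>R \<omega> x)) \<in> borel_measurable borel"
    by measurable
  also have "(\<lambda>x. ennreal (indicator \<Omega> x *\<^sub>R \<omega> x)) = (\<lambda>x. indicator \<Omega> x * ennreal (\<omega> x))"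
    by (auto simp: indicator_def)
  finally show ?thesis .
qed

text \<open>\<open>vol z\<close> is the measure of the section at \<open>z\<close> of an open subset
  of the product space, and section measures are measurable.\<close>

lemma vol_measurable: "(\<lambda>z. indicator \<Omega> z * vol z) \<in> borel_measurable borel"
proof -
  define Q where "Q = (\<Omega> \<times> UNIV) \<inter> (\<lambda>p. M (fst p) (snd p)) -` {..<1}"
  have "open Q" unfolding Q_def
    by (intro continuous_open_preimage open_Times open_dom M_cont) auto
  then have "Q \<in> sets (borel \<Otimes>\<^sub>M lborel)"
  proof -
    have "sets (borel \<Otimes>\<^sub>M lborel) = sets (borel \<Otimes>\<^sub>M borel :: ((complex^'n) \<times> (complex^'n)) measure)"
      by (intro sets_pair_measure_cong) auto
    then show ?thesis using borel_open[OF \<open>open Q\<close>] by (simp only: borel_prod)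
  qed
  from lborel.measurable_emeasure_Pair[OF this]
  have "(\<lambda>z. enn2real (emeasure lborel (Pair z -` Q))) \<in> borel_measurable borel" by measurable
  also have "(\<lambda>z. enn2real (emeasure lborel (Pair z -` Q))) = (\<lambda>z. indicator \<Omega> z * vol z)"
  proof
    fix z show "enn2real (emeasure lborel (Pair z -` Q)) = indicator \<Omega> z * vol z"
    proof (cases "z \<in> \<Omega>")
      case True
      then have "Pair z -` Q = {v. M z v < 1}" by (auto simp: Q_def)
      then show ?thesis using True by (simp add: vol_def measure_def)
    next
      case False
      then have "Pair z -` Q = {}" by (auto simp: Q_def)
      then show ?thesis using False by simp
    qed
  qed
  finally show ?thesis .
qed

lemma ratio_measurable: "(\<lambda>z. indicator \<Omega> z * ennreal (\<omega> z / vol z)) \<in> borel_measurable borel"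
proof -
  have "(\<lambda>x. indicator \<Omega> x *\<^sub>R \<omega> x) \<in> borel_measurable borel"
    by (intro borel_measurable_continuous_on_indicator \<omega>_cont borel_open open_dom)
  then have "(\<lambda>z. ennreal ((indicator \<Omega> z *\<^sub>R \<omega> z) / (indicator \<Omega> z * vol z))) \<in> borel_measurable borel"
    using vol_measurable by measurable
  also have "(\<lambda>z. ennreal ((indicator \<Omega> z *\<^sub>R \<omega> z) / (indicator \<Omega> z * vol z)))
    = (\<lambda>z. indicator \<Omega> z * ennreal (\<omega> z / vol z))"
    by (auto simp: indicator_def)
  finally show ?thesis .
qed

lemma near_measurable [measurable]: "Measurable.pred (borel \<Otimes>\<^sub>M borel) (\<lambda>p. p \<in> near c ^^ Suc k)"
  by (rule near_pow_measurable)

lemma section_weight_le: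
  assumes w: "w \<in> \<Omega>"
  shows "(\<integral>\<^sup>+z. indicator (near c ^^ Suc k) (z, w) * (indicator \<Omega> z * ennreal (\<omega> z)) \<partial>lborel)
    \<le> ennreal (b ^ Suc k * \<omega> w * ((4 ^ Suc k * c) ^ DIM(complex^'n) * vol w))"
proof -
  define S where "S = {z. (z, w) \<in> near c ^^ Suc k}"
  have [measurable]: "S \<in> sets borel" unfolding S_def by (intro borel_open near_pow_sections)
  have "(\<integral>\<^sup>+z. indicator (near c ^^ Suc k) (z, w) * (indicator \<Omega> z * ennreal (\<omega> z)) \<partial>lborel)
      \<le> (\<integral>\<^sup>+z. ennreal (b ^ Suc k * \<omega> w) * indicator S z \<partial>lborel)"
  proof (rule nn_integral_mono)
    fix z
    show "indicator (near c ^^ Suc k) (z, w) * (indicator \<Omega> z * ennreal (\<omega> z)) \<le> ennreal (b ^ Suc k * \<omega> w) * indicator S z"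
    proof (cases "(z, w) \<in> near c ^^ Suc k")
      case True
      have "\<omega> z \<le> b ^ Suc k * \<omega> w" by (rule near_pow_weight[OF True near_pow_in_domain[OF True]])
      then show ?thesis using True near_pow_in_domain[OF True] by (simp add: S_def ennreal_leI del: relpow.simps)
    qed (simp del: relpow.simps)
  qed
  also have "\<dots> = ennreal (b ^ Suc k * \<omega> w) * emeasure lborel S"
    by (subst nn_integral_cmult_indicator) auto
  also have "\<dots> \<le> ennreal (b ^ Suc k * \<omega> w) * ennreal ((4 ^ Suc k * c) ^ DIM(complex^'n) * vol w)"
    unfolding S_def using c by (intro mult_left_mono emeasure_near_pow_left[OF w]) auto
  also have "\<dots> = ennreal (b ^ Suc k * \<omega> w * ((4 ^ Suc k * c) ^ DIM(complex^'n) * vol w))"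
    using b \<omega>_pos[OF w] by (intro ennreal_mult'[symmetric]) auto
  finally show ?thesis .
qed

text \<open>A Schur-type bound for the averaging operator. After exchanging the integrals, the
  points \<open>z\<close> from which \<open>w\<close> can be reached fill a set of measure at most a
  constant times \<open>vol w\<close>, and on it \<open>vol z\<close> and \<open>\<omega> z\<close>
  are comparable with their values at \<open>w\<close>.\<close>

lemma section_integral_le:
  assumes [measurable]: "F \<in> borel_measurable borel" and F0: "\<And>x. x \<notin> \<Omega> \<Longrightarrow> F x = 0"
  shows "(\<integral>\<^sup>+z. indicator \<Omega> z * ennreal (\<omega> z / vol z) * (\<integral>\<^sup>+w. indicator (near c ^^ Suc k) (z, w) * F w \<partial>lborel) \<partial>lborel)
    \<le> ennreal (b ^ Suc k * (2 ^ Suc k) ^ DIM(complex^'n) * (4 ^ Suc k * c) ^ DIM(complex^'n)) * (\<integral>\<^sup>+x. F x * ennreal (\<omega> x) \<partial>lborel)"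
proof -
  define D where "D = DIM(complex^'n)"
  define L :: real where "L = 2 ^ Suc k"
  define K where "K = b ^ Suc k * L ^ D * (4 ^ Suc k * c) ^ D"
  have L: "L > 0" by (simp add: L_def)
  have K: "K \<ge> 0" using L b c by (simp add: K_def)
  note [measurable] = ratio_measurable weight_measurable'
  define r where "r = (\<lambda>z. indicator \<Omega> z * ennreal (\<omega> z / vol z))"
  have [measurable]: "r \<in> borel_measurable borel" unfolding r_def by (rule ratio_measurable)
  have "(\<integral>\<^sup>+z. r z * (\<integral>\<^sup>+w. indicator (near c ^^ Suc k) (z, w) * F w \<partial>lborel) \<partial>lborel)
      = (\<integral>\<^sup>+z. \<integral>\<^sup>+w. r z * (indicator (near c ^^ Suc k) (z, w) * F w) \<partial>lborel \<partial>lborel)"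
    by (intro nn_integral_cong nn_integral_cmult[symmetric]) measurable
  also have "\<dots> = (\<integral>\<^sup>+w. \<integral>\<^sup>+z. r z * (indicator (near c ^^ Suc k) (z, w) * F w) \<partial>lborel \<partial>lborel)"
    by (rule lborel_pair.Fubini'[symmetric]) measurable
  also have "\<dots> \<le> (\<integral>\<^sup>+w. ennreal K * (indicator \<Omega> w * ennreal (\<omega> w) * F w) \<partial>lborel)"
  proof (rule nn_integral_mono)
    fix w
    show "(\<integral>\<^sup>+z. r z * (indicator (near c ^^ Suc k) (z, w) * F w) \<partial>lborel) \<le> ennreal K * (indicator \<Omega> w * ennreal (\<omega> w) * F w)"
    proof (cases "w \<in> \<Omega>")
      case w: True
      have V: "vol w > 0" by (rule emeasure_unit(2)[OF w])
      have "r z * indicator (near c ^^ Suc k) (z, w)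
          \<le> ennreal (L ^ D / vol w) * (indicator (near c ^^ Suc k) (z, w) * (indicator \<Omega> z * ennreal (\<omega> z)))" for z
      proof (cases "(z, w) \<in> near c ^^ Suc k")
        case True
        have z: "z \<in> \<Omega>" by (rule near_pow_in_domain[OF True])
        have "vol w \<le> L ^ D * vol z" using near_pow_vol(1)[OF True _ z] by (simp only: L_def D_def)
        then have "1 / vol z \<le> L ^ D / vol w"
          using V emeasure_unit(2)[OF z] by (simp add: field_simps)
        then have "\<omega> z * (1 / vol z) \<le> \<omega> z * (L ^ D / vol w)"
          using \<omega>_pos[OF z] by (intro mult_left_mono) auto
        then have "ennreal (\<omega> z / vol z) \<le> ennreal (L ^ D / vol w * \<omega> z)" by (intro ennreal_leI) (simp add: mult.commute)
        also have "\<dots> = ennreal (L ^ D / vol w) * ennreal (\<omega> z)"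
          using L V by (intro ennreal_mult') auto
        finally show ?thesis using True z by (simp add: r_def del: relpow.simps)
      qed (simp del: relpow.simps)
      then have "(\<integral>\<^sup>+z. r z * indicator (near c ^^ Suc k) (z, w) \<partial>lborel)
        \<le> (\<integral>\<^sup>+z. ennreal (L ^ D / vol w) * (indicator (near c ^^ Suc k) (z, w) * (indicator \<Omega> z * ennreal (\<omega> z))) \<partial>lborel)"
        by (rule nn_integral_mono)
      also have "\<dots> = ennreal (L ^ D / vol w) * (\<integral>\<^sup>+z. indicator (near c ^^ Suc k) (z, w) * (indicator \<Omega> z * ennreal (\<omega> z)) \<partial>lborel)"
        by (rule nn_integral_cmult) measurable
      also have "\<dots> \<le> ennreal (L ^ D / vol w) * ennreal (b ^ Suc k * \<omega> w * ((4 ^ Suc k * c) ^ D * vol w))"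
        unfolding D_def by (intro mult_left_mono section_weight_le[OF w]) auto
      also have "\<dots> = ennreal (L ^ D / vol w * (b ^ Suc k * \<omega> w * ((4 ^ Suc k * c) ^ D * vol w)))"
        using L V by (intro ennreal_mult'[symmetric]) auto
      also have "L ^ D / vol w * (b ^ Suc k * \<omega> w * ((4 ^ Suc k * c) ^ D * vol w)) = K * \<omega> w"
        using V by (simp add: K_def)
      also have "ennreal (K * \<omega> w) = ennreal K * ennreal (\<omega> w)" using K by (rule ennreal_mult')
      finally have 1: "(\<integral>\<^sup>+z. r z * indicator (near c ^^ Suc k) (z, w) \<partial>lborel) \<le> ennreal K * ennreal (\<omega> w)" .
      have "(\<integral>\<^sup>+z. r z * (indicator (near c ^^ Suc k) (z, w) * F w) \<partial>lborel)
        = (\<integral>\<^sup>+z. r z * indicator (near c ^^ Suc k) (z, w) * F w \<partial>lborel)" by (simp only: mult.assoc)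
      also have "\<dots> = (\<integral>\<^sup>+z. r z * indicator (near c ^^ Suc k) (z, w) \<partial>lborel) * F w"
        by (rule nn_integral_multc) measurable
      also have "\<dots> \<le> ennreal K * ennreal (\<omega> w) * F w" using 1 by (rule mult_right_mono) simp
      finally show ?thesis using w by (simp add: mult.assoc)
    qed (simp add: F0)
  qed
  also have "\<dots> = ennreal K * (\<integral>\<^sup>+w. indicator \<Omega> w * ennreal (\<omega> w) * F w \<partial>lborel)"
    by (rule nn_integral_cmult) measurable
  also have "(\<lambda>w. indicator \<Omega> w * ennreal (\<omega> w) * F w) = (\<lambda>w. F w * ennreal (\<omega> w))"
    using F0 by (auto simp: indicator_def mult.commute)
  finally show ?thesis by (simp only: r_def K_def L_def D_def)
qed

text \<open>Pointwise, \<open>\<bar>f\<bar>^p\<close> is bounded by \<open>\<epsilon>\<close> times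
  its neighbourhood mean or by the sum over nearby sample points. The first part integrates to at
  most half of the norm and is absorbed. In the second, integration over \<open>z\<close> gives
  \<open>a j\<close> the weighted volume of the set of points from which it is reached, which is at
  most a multiple of \<open>\<omega> (a j) * vol (a j)\<close>.\<close>

theorem sampling_inequality:
  assumes p: "1 \<le> p"
  shows "\<exists>C>0. \<exists>q>0. \<forall>\<gamma> t a f. 0 < \<gamma> \<longrightarrow> \<gamma> \<le> 1 \<longrightarrow> 0 < t \<longrightarrow> t < inverse C * \<gamma> powr q \<longrightarrow> (\<forall>j::nat. a j \<in> \<Omega>) \<longrightarrow>
    (\<forall>z\<in>\<Omega>. ennreal (\<gamma> * vol z) \<le> emeasure lborel ((\<Union>j. polyball (a j) t) \<inter> {x. (z, x) \<in> near step ^^ Suc m})) \<longrightarrow>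
    holomorphic_Cn f \<Omega> \<longrightarrow> (\<integral>\<^sup>+x. weight f p x * ennreal (\<omega> x) \<partial>lborel) < \<infinity> \<longrightarrow>
    (\<integral>\<^sup>+x. weight f p x * ennreal (\<omega> x) \<partial>lborel)
      \<le> ennreal C * (\<Sum>j. ennreal (cmod (f (a j)) powr p * (\<omega> (a j) * vol (a j))))"
proof -
  define D where "D = DIM(complex^'n)"
  define K where "K = b ^ Suc (m + 4) * (2 ^ Suc (m + 4)) ^ D * (4 ^ Suc (m + 4) * c) ^ D"
  have K: "K > 0" using b c by (simp add: K_def)
  define K' where "K' = b ^ Suc (Suc m) * (4 ^ Suc (Suc m) * c) ^ D"
  have K': "K' > 0" using b c by (simp add: K'_def)
  \<comment> \<open>\<open>K\<close> is the norm of the averaging operator from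
    \<open>section_integral_le\<close>, so the exceptional points contribute at most one half of the
    integral.\<close>
  define \<epsilon> where "\<epsilon> = 1 / (2 * K)"
  have \<epsilon>: "\<epsilon> > 0" using K by (simp add: \<epsilon>_def)
  obtain C0 q where C0: "C0 > 0" and q: "q > 0" and good:
    "\<And>\<gamma> t (a :: nat \<Rightarrow> complex^'n) f z. 0 < \<gamma> \<Longrightarrow> \<gamma> \<le> 1 \<Longrightarrow> 0 < t \<Longrightarrow> t < inverse C0 * \<gamma> powr q \<Longrightarrow> (\<And>j. a j \<in> \<Omega>) \<Longrightarrow> z \<in> \<Omega> \<Longrightarrow>
    ennreal (\<gamma> * vol z) \<le> emeasure lborel ((\<Union>j. polyball (a j) t) \<inter> {x. (z, x) \<in> near step ^^ Suc m}) \<Longrightarrow>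
    holomorphic_Cn f \<Omega> \<Longrightarrow>
    ennreal \<epsilon> * (\<integral>\<^sup>+w. indicator (near c ^^ Suc (m + 4)) (z, w) * weight f p w \<partial>lborel) \<le> ennreal (cmod (f z) powr p * vol z) \<Longrightarrow>
    ennreal (cmod (f z) powr p) \<le> (\<Sum>j. indicator (near c ^^ Suc (Suc m)) (z, a j) * ennreal (cmod (f (a j)) powr p))"
    using good_point[OF p \<epsilon>, of m] by (elim exE conjE) (simp del: relpow.simps)
  \<comment> \<open>One constant has two duties: as the threshold for \<open>t\<close> it must be at
    least \<open>C0\<close>, and as the factor in the inequality at least
    \<open>2 * K'\<close>.\<close>
  define C where "C = max C0 (2 * K')"
  have C: "C > 0" "C0 \<le> C" "2 * K' \<le> C" using C0 by (auto simp: C_def)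
  have "(\<integral>\<^sup>+x. weight f p x * ennreal (\<omega> x) \<partial>lborel)
      \<le> ennreal C * (\<Sum>j. ennreal (cmod (f (a j)) powr p * (\<omega> (a j) * vol (a j))))"
    if \<gamma>: "0 < \<gamma>" "\<gamma> \<le> 1" and t: "0 < t" "t < inverse C * \<gamma> powr q" and a: "\<And>j. a j \<in> \<Omega>"
      and cover: "\<And>z. z \<in> \<Omega> \<Longrightarrow> ennreal (\<gamma> * vol z) \<le> emeasure lborel ((\<Union>j. polyball (a j) t) \<inter> {x. (z, x) \<in> near step ^^ Suc m})"
      and f: "holomorphic_Cn f \<Omega>" and fin: "(\<integral>\<^sup>+x. weight f p x * ennreal (\<omega> x) \<partial>lborel) < \<infinity>"
    for \<gamma> t f and a :: "nat \<Rightarrow> complex^'n"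
  proof -
    note [measurable] = weight_measurable[OF f] weight_measurable' ratio_measurable
    have "inverse C * \<gamma> powr q \<le> inverse C0 * \<gamma> powr q"
      using C C0 by (intro mult_right_mono le_imp_inverse_le) auto
    then have t0: "t < inverse C0 * \<gamma> powr q" using t by simp
    define I where "I = (\<integral>\<^sup>+x. weight f p x * ennreal (\<omega> x) \<partial>lborel)"
    define A where "A = (\<lambda>z. \<integral>\<^sup>+w. indicator (near c ^^ Suc (m + 4)) (z, w) * weight f p w \<partial>lborel)"
    have [measurable]: "A \<in> borel_measurable borel" unfolding A_def by measurable
    define r where "r = (\<lambda>z. indicator \<Omega> z * ennreal (\<omega> z / vol z))"
    have [measurable]: "r \<in> borel_measurable borel" unfolding r_def by (rule ratio_measurable)
    define u where "u = (\<lambda>z. indicator \<Omega> z * ennreal (\<omega> z))"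
    have [measurable]: "u \<in> borel_measurable borel" unfolding u_def by (rule weight_measurable')
    define S where "S = (\<lambda>z. \<Sum>j. indicator (near c ^^ Suc (Suc m)) (z, a j) * ennreal (cmod (f (a j)) powr p))"
    have [measurable]: "S \<in> borel_measurable borel" unfolding S_def by measurable
    have pt: "weight f p z * ennreal (\<omega> z) \<le> S z * u z + ennreal \<epsilon> * (r z * A z)" for z
    proof (cases "z \<in> \<Omega>")
      case z: True
      have V: "vol z > 0" by (rule emeasure_unit(2)[OF z])
      show ?thesis
      proof (cases "ennreal \<epsilon> * A z \<le> ennreal (cmod (f z) powr p * vol z)")
        case True
        have "ennreal (cmod (f z) powr p) \<le> S z"
          unfolding S_def using True unfolding A_def by (rule good[OF \<gamma> t(1) t0 a z cover[OF z] f])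
        then have "weight f p z * ennreal (\<omega> z) \<le> S z * u z"
          using z by (simp add: weight_def u_def mult_right_mono)
        then show ?thesis by (rule order_trans) simp
      next
        case False
        then have "ennreal (cmod (f z) powr p * vol z) \<le> ennreal \<epsilon> * A z" by simp
        then have "ennreal (\<omega> z / vol z) * ennreal (cmod (f z) powr p * vol z) \<le> ennreal (\<omega> z / vol z) * (ennreal \<epsilon> * A z)"
          by (rule mult_left_mono) simp
        also have "ennreal (\<omega> z / vol z) * ennreal (cmod (f z) powr p * vol z) = ennreal (\<omega> z / vol z * (cmod (f z) powr p * vol z))"
          using V \<omega>_pos[OF z] by (intro ennreal_mult'[symmetric]) auto
        also have "\<omega> z / vol z * (cmod (f z) powr p * vol z) = cmod (f z) powr p * \<omega> z" using V by simp
        also have "ennreal (cmod (f z) powr p * \<omega> z) = weight f p z * ennreal (\<omega> z)"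
          using z by (simp add: weight_def ennreal_mult')
        also have "ennreal (\<omega> z / vol z) * (ennreal \<epsilon> * A z) = ennreal \<epsilon> * (r z * A z)"
          using z by (simp add: r_def mult_ac)
        finally show ?thesis by (rule order_trans) simp
      qed
    qed (simp add: weight_def)
    have "I \<le> (\<integral>\<^sup>+z. S z * u z + ennreal \<epsilon> * (r z * A z) \<partial>lborel)"
      unfolding I_def by (rule nn_integral_mono) (rule pt)
    also have "\<dots> = (\<integral>\<^sup>+z. S z * u z \<partial>lborel) + ennreal \<epsilon> * (\<integral>\<^sup>+z. r z * A z \<partial>lborel)"
      by (subst nn_integral_add, measurable, subst nn_integral_cmult, measurable)
    also have "\<dots> \<le> (\<integral>\<^sup>+z. S z * u z \<partial>lborel) + ennreal \<epsilon> * (ennreal K * I)"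
    proof (intro add_left_mono mult_left_mono)
      show "(\<integral>\<^sup>+z. r z * A z \<partial>lborel) \<le> ennreal K * I"
        unfolding r_def A_def I_def K_def D_def
      proof (rule section_integral_le)
        show "weight f p \<in> borel_measurable borel" by (rule weight_measurable[OF f])
      qed (simp add: weight_def)
    qed simp
    also have "ennreal \<epsilon> * (ennreal K * I) = ennreal (1/2) * I"
    proof -
      have "ennreal \<epsilon> * ennreal K = ennreal (\<epsilon> * K)" using \<epsilon> K by (intro ennreal_mult[symmetric]) auto
      also have "\<epsilon> * K = 1/2" using K by (simp add: \<epsilon>_def)
      finally show ?thesis by (simp only: mult.assoc[symmetric])
    qed
    finally have I1: "I \<le> (\<integral>\<^sup>+z. S z * u z \<partial>lborel) + ennreal (1/2) * I" .
    \<comment> \<open>Subtracting half of \<open>I\<close> from both sides requires \<open>I\<close>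
      to be finite.\<close>
    have I2: "I \<le> 2 * (\<integral>\<^sup>+z. S z * u z \<partial>lborel)"
    proof -
      obtain x where x: "I = ennreal x" "0 \<le> x" using fin unfolding I_def[symmetric] by (cases I) auto
      show ?thesis
      proof (cases "\<integral>\<^sup>+z. S z * u z \<partial>lborel")
        case (real y)
        have "ennreal (y + 1/2 * x) = ennreal y + ennreal (1/2) * ennreal x"
          using real x by (subst ennreal_mult'[symmetric], simp, intro ennreal_plus) auto
        then have "ennreal x \<le> ennreal (y + 1/2 * x)" using I1 unfolding x(1) real(2) by simp
        then have "x \<le> y + 1/2 * x" using real x by (subst (asm) ennreal_le_iff) auto
        then have "x \<le> 2 * y" by simp
        then have "ennreal x \<le> ennreal (2 * y)" by (rule ennreal_leI)
        then show ?thesis using real x by (simp add: ennreal_mult')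
      next
        case top
        then show ?thesis by (simp add: ennreal_mult_top)
      qed
    qed
    have "(\<integral>\<^sup>+z. S z * u z \<partial>lborel)
      = (\<integral>\<^sup>+z. (\<Sum>j. ennreal (cmod (f (a j)) powr p) * (indicator (near c ^^ Suc (Suc m)) (z, a j) * u z)) \<partial>lborel)"
      unfolding S_def ennreal_suminf_multc[symmetric] by (simp only: mult_ac)
    also have "\<dots> = (\<Sum>j. \<integral>\<^sup>+z. ennreal (cmod (f (a j)) powr p) * (indicator (near c ^^ Suc (Suc m)) (z, a j) * u z) \<partial>lborel)"
      by (rule nn_integral_suminf) measurable
    also have "\<dots> \<le> (\<Sum>j. ennreal K' * ennreal (cmod (f (a j)) powr p * (\<omega> (a j) * vol (a j))))"
    proof (intro suminf_le)
      fix j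
      have "(\<integral>\<^sup>+z. ennreal (cmod (f (a j)) powr p) * (indicator (near c ^^ Suc (Suc m)) (z, a j) * u z) \<partial>lborel)
        = ennreal (cmod (f (a j)) powr p) * (\<integral>\<^sup>+z. indicator (near c ^^ Suc (Suc m)) (z, a j) * u z \<partial>lborel)"
        by (rule nn_integral_cmult) measurable
      also have "\<dots> \<le> ennreal (cmod (f (a j)) powr p) * ennreal (b ^ Suc (Suc m) * \<omega> (a j) * ((4 ^ Suc (Suc m) * c) ^ D * vol (a j)))"
        unfolding u_def D_def by (intro mult_left_mono section_weight_le[OF a]) auto
      also have "\<dots> = ennreal (cmod (f (a j)) powr p * (b ^ Suc (Suc m) * \<omega> (a j) * ((4 ^ Suc (Suc m) * c) ^ D * vol (a j))))"
        by (intro ennreal_mult'[symmetric]) auto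
      also have "cmod (f (a j)) powr p * (b ^ Suc (Suc m) * \<omega> (a j) * ((4 ^ Suc (Suc m) * c) ^ D * vol (a j)))
          = K' * (cmod (f (a j)) powr p * (\<omega> (a j) * vol (a j)))"
        by (simp only: K'_def mult_ac)
      also have "ennreal \<dots> = ennreal K' * ennreal (cmod (f (a j)) powr p * (\<omega> (a j) * vol (a j)))"
        using K' by (intro ennreal_mult') auto
      finally show "(\<integral>\<^sup>+z. ennreal (cmod (f (a j)) powr p) * (indicator (near c ^^ Suc (Suc m)) (z, a j) * u z) \<partial>lborel)
        \<le> ennreal K' * ennreal (cmod (f (a j)) powr p * (\<omega> (a j) * vol (a j)))" .
    qed auto
    also have "\<dots> = ennreal K' * (\<Sum>j. ennreal (cmod (f (a j)) powr p * (\<omega> (a j) * vol (a j))))"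
      by (rule ennreal_suminf_cmult)
    finally have "2 * (\<integral>\<^sup>+z. S z * u z \<partial>lborel) \<le> 2 * (ennreal K' * (\<Sum>j. ennreal (cmod (f (a j)) powr p * (\<omega> (a j) * vol (a j)))))"
      by (rule mult_left_mono) simp
    also have "\<dots> = ennreal (2 * K') * (\<Sum>j. ennreal (cmod (f (a j)) powr p * (\<omega> (a j) * vol (a j))))"
      using K' by (simp add: ennreal_mult' mult.assoc)
    also have "\<dots> \<le> ennreal C * (\<Sum>j. ennreal (cmod (f (a j)) powr p * (\<omega> (a j) * vol (a j))))"
      using C by (intro mult_right_mono ennreal_leI) auto
    finally show ?thesis using I2 unfolding I_def by (rule order_trans[rotated])
  qed
  note main = this
  show ?thesis
  proof (rule exI[of _ C], rule conjI[OF C(1)], rule exI[of _ q], rule conjI[OF q], intro allI impI)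
    fix \<gamma> t f and a :: "nat \<Rightarrow> complex^'n"
    assume "0 < \<gamma>" "\<gamma> \<le> 1" "0 < t" "t < inverse C * \<gamma> powr q" "\<forall>j. a j \<in> \<Omega>"
      "\<forall>z\<in>\<Omega>. ennreal (\<gamma> * vol z) \<le> emeasure lborel ((\<Union>j. polyball (a j) t) \<inter> {x. (z, x) \<in> near step ^^ Suc m})"
      "holomorphic_Cn f \<Omega>" "(\<integral>\<^sup>+x. weight f p x * ennreal (\<omega> x) \<partial>lborel) < \<infinity>"
    then show "(\<integral>\<^sup>+x. weight f p x * ennreal (\<omega> x) \<partial>lborel)
      \<le> ennreal C * (\<Sum>j. ennreal (cmod (f (a j)) powr p * (\<omega> (a j) * vol (a j))))"
      by (intro main[of \<gamma> t a f]) (simp_all del: relpow.simps)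
  qed
qed

end

end

subsection \<open>Twice differentiable functions and bounds for the defining function\<close>

definition hess :: "('a::real_normed_vector \<Rightarrow> real) \<Rightarrow> 'a \<Rightarrow> 'a \<Rightarrow> 'a \<Rightarrow> real" where
  "hess f x u v = frechet_derivative (\<lambda>y. frechet_derivative f (at y) u) (at x) v"

abbreviation deriv_at :: "('a::real_normed_vector \<Rightarrow> real) \<Rightarrow> 'a \<Rightarrow> 'a \<Rightarrow> real" where
  "deriv_at f x \<equiv> frechet_derivative f (at x)"

locale C2_fun =
  fixes f :: "'a::euclidean_space \<Rightarrow> real" and U :: "'a set"
  assumes U: "open U" and C2: "Ck_on (Suc (Suc 0)) f U"
begin

lemma has_derivative_deriv_at: "x \<in> U \<Longrightarrow> (f has_derivative deriv_at f x) (at x)"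
  using C2 by (simp add: frechet_derivative_works)

lemma has_derivative_hess: "x \<in> U \<Longrightarrow> ((\<lambda>y. deriv_at f y u) has_derivative hess f x u) (at x)"
  using C2 by (simp add: frechet_derivative_works hess_def[abs_def])

lemma linear_deriv_at: "x \<in> U \<Longrightarrow> linear (deriv_at f x)"
  using has_derivative_deriv_at has_derivative_linear by blast

lemma linear_hess: "x \<in> U \<Longrightarrow> linear (hess f x u)"
  using has_derivative_hess has_derivative_linear by blast

text \<open>Linearity in the direction of the inner derivative comes from uniqueness of the outer
  one: \<open>deriv_at f y\<close> is linear at every \<open>y\<close> near \<open>x\<close>, not
  only at \<open>x\<close>.\<close>

lemma linear_hess_left: assumes x: "x \<in> U" shows "linear (\<lambda>u. hess f x u v)"
proof (rule linearI)
  fix u u' and r :: real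
  have "((\<lambda>y. deriv_at f y u + deriv_at f y u') has_derivative (\<lambda>v. hess f x u v + hess f x u' v)) (at x)"
    by (intro has_derivative_add has_derivative_hess x)
  then have "((\<lambda>y. deriv_at f y (u + u')) has_derivative (\<lambda>v. hess f x u v + hess f x u' v)) (at x)"
    by (rule has_derivative_transform_within_open[OF _ U x]) (simp add: linear_add[OF linear_deriv_at])
  from has_derivative_unique[OF this has_derivative_hess[OF x]]
  show "hess f x (u + u') v = hess f x u v + hess f x u' v" by metis
  have "((\<lambda>y. r * deriv_at f y u) has_derivative (\<lambda>v. r * hess f x u v)) (at x)"
    by (intro has_derivative_mult_right has_derivative_hess x)
  then have "((\<lambda>y. deriv_at f y (r *\<^sub>R u)) has_derivative (\<lambda>v. r * hess f x u v)) (at x)"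
    by (rule has_derivative_transform_within_open[OF _ U x]) (simp add: linear_scale[OF linear_deriv_at])
  from has_derivative_unique[OF this has_derivative_hess[OF x]]
  show "hess f x (r *\<^sub>R u) v = r *\<^sub>R hess f x u v" by (simp, metis)
qed

lemma deriv_at_expand:
  assumes x: "x \<in> U" shows "deriv_at f x v = (\<Sum>b\<in>Basis. (v \<bullet> b) * deriv_at f x b)"
proof -
  have "deriv_at f x (\<Sum>b\<in>Basis. (v \<bullet> b) *\<^sub>R b) = (\<Sum>b\<in>Basis. deriv_at f x ((v \<bullet> b) *\<^sub>R b))"
    by (rule linear_sum[OF linear_deriv_at[OF x]])
  then show ?thesis by (simp add: euclidean_representation linear_scale[OF linear_deriv_at[OF x]])
qed

lemma hess_expand:
  assumes x: "x \<in> U"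
  shows "hess f x u v = (\<Sum>b\<in>Basis. \<Sum>b'\<in>Basis. (u \<bullet> b) * (v \<bullet> b') * hess f x b b')"
proof -
  have 1: "hess f x u v = (\<Sum>b\<in>Basis. (u \<bullet> b) * hess f x b v)"
  proof -
    have "hess f x (\<Sum>b\<in>Basis. (u \<bullet> b) *\<^sub>R b) v = (\<Sum>b\<in>Basis. hess f x ((u \<bullet> b) *\<^sub>R b) v)"
      by (rule linear_sum[OF linear_hess_left[OF x]])
    then show ?thesis by (simp add: euclidean_representation linear_scale[OF linear_hess_left[OF x]])
  qed
  have 2: "hess f x b v = (\<Sum>b'\<in>Basis. (v \<bullet> b') * hess f x b b')" for b
  proof -
    have "hess f x b (\<Sum>b'\<in>Basis. (v \<bullet> b') *\<^sub>R b') = (\<Sum>b'\<in>Basis. hess f x b ((v \<bullet> b') *\<^sub>R b'))"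
      by (rule linear_sum[OF linear_hess[OF x]])
    then show ?thesis by (simp add: euclidean_representation linear_scale[OF linear_hess[OF x]])
  qed
  show ?thesis by (subst 1, intro sum.cong refl, subst 2, simp add: sum_distrib_left mult.assoc)
qed

text \<open>\<open>Ck_on\<close> gives continuity in the point for each fixed direction; the
  expansion in a basis makes it joint in point and direction.\<close>

lemma continuous_on_deriv_at:
  assumes g: "continuous_on S g" "g ` S \<subseteq> U" and v: "continuous_on S v"
  shows "continuous_on S (\<lambda>s. deriv_at f (g s) (v s))"
proof -
  have "continuous_on U (\<lambda>x. deriv_at f x b)" for b
    by (intro continuous_at_imp_continuous_on ballI has_derivative_continuous[OF has_derivative_hess])
  then have "continuous_on S (\<lambda>s. \<Sum>b\<in>Basis. (v s \<bullet> b) * deriv_at f (g s) b)"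
    by (intro continuous_intros v continuous_on_compose2[OF _ g])
  then show ?thesis
    by (rule continuous_on_eq) (use g in \<open>auto simp: deriv_at_expand[symmetric]\<close>)
qed

lemma continuous_on_hess:
  assumes g: "continuous_on S g" "g ` S \<subseteq> U" and uv: "continuous_on S u" "continuous_on S v"
  shows "continuous_on S (\<lambda>s. hess f (g s) (u s) (v s))"
proof -
  have "continuous_on U (\<lambda>x. hess f x b b')" for b b'
    using C2 by (simp add: hess_def)
  then have "continuous_on S (\<lambda>s. \<Sum>b\<in>Basis. \<Sum>b'\<in>Basis. (u s \<bullet> b) * (v s \<bullet> b') * hess f (g s) b b')"
    by (intro continuous_intros uv continuous_on_compose2[OF _ g])
  then show ?thesis
    by (rule continuous_on_eq) (use g in \<open>auto simp: hess_expand[symmetric]\<close>)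
qed

lemma continuous_on_fun: "continuous_on U f"
  by (intro continuous_at_imp_continuous_on ballI has_derivative_continuous[OF has_derivative_deriv_at])

lemma deriv_at_bound:
  assumes K: "compact K" "K \<subseteq> U"
  obtains L where "0 < L" "\<And>x v. x \<in> K \<Longrightarrow> \<bar>deriv_at f x v\<bar> \<le> L * norm v"
proof -
  have "continuous_on (K \<times> sphere 0 1) (\<lambda>p. deriv_at f (fst p) (snd p))"
    using K by (intro continuous_on_deriv_at continuous_intros) auto
  then have "bounded ((\<lambda>p. deriv_at f (fst p) (snd p)) ` (K \<times> sphere 0 1))"
    by (intro compact_imp_bounded compact_continuous_image compact_Times K compact_sphere)
  then obtain L where L: "L > 0" "\<And>p. p \<in> K \<times> sphere 0 1 \<Longrightarrow> \<bar>deriv_at f (fst p) (snd p)\<bar> \<le> L"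
    unfolding bounded_pos by (metis (no_types, lifting) image_eqI real_norm_def)
  have "\<bar>deriv_at f x v\<bar> \<le> L * norm v" if x: "x \<in> K" for x v
  proof (cases "v = 0")
    case True
    then show ?thesis using linear_0[OF linear_deriv_at] x K by auto
  next
    case False
    have "deriv_at f x v = deriv_at f x (norm v *\<^sub>R sgn v)" using False by (simp add: sgn_div_norm)
    also have "\<dots> = norm v * deriv_at f x (sgn v)"
      using linear_scale[OF linear_deriv_at, of x "norm v" "sgn v"] x K by auto
    finally show ?thesis
      using L(2)[of "(x, sgn v)"] x False by (simp add: abs_mult mult.commute norm_sgn mult_left_mono)
  qed
  with L(1) show thesis using that by blast
qed

lemma hess_bound:
  assumes K: "compact K" "K \<subseteq> U"
  obtains L where "0 < L" "\<And>x u v. x \<in> K \<Longrightarrow> \<bar>hess f x u v\<bar> \<le> L * norm u * norm v"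
proof -
  have "continuous_on (K \<times> (sphere 0 1 \<times> sphere 0 1)) (\<lambda>p. hess f (fst p) (fst (snd p)) (snd (snd p)))"
    using K by (intro continuous_on_hess continuous_intros) auto
  then have "bounded ((\<lambda>p. hess f (fst p) (fst (snd p)) (snd (snd p))) ` (K \<times> (sphere 0 1 \<times> sphere 0 1)))"
    by (intro compact_imp_bounded compact_continuous_image compact_Times K compact_sphere)
  then obtain L where L0: "L > 0"
    "\<And>y. y \<in> (\<lambda>p. hess f (fst p) (fst (snd p)) (snd (snd p))) ` (K \<times> (sphere 0 1 \<times> sphere 0 1)) \<Longrightarrow> norm y \<le> L"
    unfolding bounded_pos by blast
  have L: "\<bar>hess f x u v\<bar> \<le> L" if "x \<in> K" "norm u = 1" "norm v = 1" for x u v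
    using L0(2)[OF image_eqI[of _ _ "(x, u, v)"], of "hess f x u v"] that by simp
  have "\<bar>hess f x u v\<bar> \<le> L * norm u * norm v" if x: "x \<in> K" for x u v
  proof (cases "u = 0 \<or> v = 0")
    case True
    then show ?thesis using linear_0[OF linear_hess] linear_0[OF linear_hess_left] x K by auto
  next
    case False
    have x': "x \<in> U" using x K by auto
    have "hess f x u v = hess f x (norm u *\<^sub>R sgn u) (norm v *\<^sub>R sgn v)" using False by (simp add: sgn_div_norm)
    also have "\<dots> = norm u * norm v * hess f x (sgn u) (sgn v)"
      using linear_scale[OF linear_hess_left[OF x'], of "norm u" "sgn u"] linear_scale[OF linear_hess[OF x'], of _ "norm v" "sgn v"]
      by simp
    finally have "\<bar>hess f x u v\<bar> = norm u * norm v * \<bar>hess f x (sgn u) (sgn v)\<bar>" by (simp add: abs_mult)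
    also have "\<dots> \<le> norm u * norm v * L"
      using L[OF x, of "sgn u" "sgn v"] False by (intro mult_left_mono) (auto simp: norm_sgn)
    finally show ?thesis by (simp add: mult_ac)
  qed
  with L0(1) show thesis using that by blast
qed

lemma deriv_at_Lipschitz:
  assumes S: "convex S" "S \<subseteq> U" and L: "\<And>x u v. x \<in> S \<Longrightarrow> \<bar>hess f x u v\<bar> \<le> L * norm u * norm v"
    and zw: "z \<in> S" "w \<in> S"
  shows "\<bar>deriv_at f w u - deriv_at f z u\<bar> \<le> L * norm u * norm (w - z)"
proof -
  have "norm (deriv_at f w u - deriv_at f z u) \<le> L * norm u * norm (w - z)"
  proof (rule differentiable_bound[OF S(1)])
    show "((\<lambda>y. deriv_at f y u) has_derivative hess f x u) (at x within S)" if "x \<in> S" for x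
      using has_derivative_hess that S(2) has_derivative_at_withinI by blast
    show "onorm (hess f x u) \<le> L * norm u" if "x \<in> S" for x
      using L[OF that] by (intro onorm_le) auto
  qed (use zw in auto)
  then show ?thesis by simp
qed

text \<open>The mean value inequality for \<open>f - deriv_at f z\<close> on the segment from
  \<open>z\<close> to \<open>w\<close>, where the derivative differs from that at \<open>z\<close>
  by at most \<open>L * norm (w - z)\<close>. This yields the constant \<open>L\<close> rather than
  \<open>L / 2\<close>, which is enough.\<close>

lemma Taylor_bound:
  assumes S: "convex S" "S \<subseteq> U" and L: "0 \<le> L" "\<And>x u v. x \<in> S \<Longrightarrow> \<bar>hess f x u v\<bar> \<le> L * norm u * norm v"
    and zw: "z \<in> S" "w \<in> S"
  shows "\<bar>f w - f z - deriv_at f z (w - z)\<bar> \<le> L * (norm (w - z))\<^sup>2"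
proof -
  define T where "T = closed_segment z w"
  have T: "T \<subseteq> S" using S zw by (simp add: T_def closed_segment_subset)
  have z: "z \<in> U" using zw S by auto
  have "norm ((f w - deriv_at f z w) - (f z - deriv_at f z z)) \<le> (L * norm (w - z)) * norm (w - z)"
  proof (rule differentiable_bound[where S=T])
    show "convex T" by (simp add: T_def)
    fix x assume x: "x \<in> T"
    have "x \<in> U" using x T S by auto
    then have "(f has_derivative deriv_at f x) (at x within T)"
      using has_derivative_deriv_at has_derivative_at_withinI by blast
    moreover have "(deriv_at f z has_derivative deriv_at f z) (at x within T)"
      using linear_deriv_at[OF z] by (intro bounded_linear_imp_has_derivative) (simp add: linear_conv_bounded_linear)
    ultimately show "((\<lambda>x. f x - deriv_at f z x) has_derivative (\<lambda>v. deriv_at f x v - deriv_at f z v)) (at x within T)"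
      by (rule has_derivative_diff)
    show "onorm (\<lambda>v. deriv_at f x v - deriv_at f z v) \<le> L * norm (w - z)"
    proof (rule onorm_le)
      fix v
      have "norm (x - z) \<le> norm (w - z)" using x segment_bound[of x z w] by (simp add: T_def norm_minus_commute)
      have "\<bar>deriv_at f x v - deriv_at f z v\<bar> \<le> L * norm v * norm (x - z)"
        using x T zw by (intro deriv_at_Lipschitz[OF S L(2)]) auto
      also have "\<dots> \<le> L * norm v * norm (w - z)"
        using L(1) \<open>norm (x - z) \<le> norm (w - z)\<close> by (intro mult_left_mono) auto
      finally show "norm (deriv_at f x v - deriv_at f z v) \<le> L * norm (w - z) * norm v" by (simp add: mult_ac)
    qed
  qed (simp_all add: T_def)
  then show ?thesis
    using linear_diff[OF linear_deriv_at[OF z], of w z] by (simp add: power2_eq_square mult.assoc algebra_simps)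
qed

end

lemma vec_complex_expand:
  fixes w :: "complex^'n"
  shows "w = (\<Sum>j\<in>UNIV. Re (w $ j) *\<^sub>R axis j 1 + Im (w $ j) *\<^sub>R axis j \<i>)"
proof -
  have "(\<Sum>j\<in>UNIV. Re (w $ j) *\<^sub>R axis j 1 + Im (w $ j) *\<^sub>R axis j \<i>) $ i = w $ i" for i :: 'n
  proof -
    have "(\<Sum>j\<in>UNIV. Re (w $ j) *\<^sub>R axis j 1 + Im (w $ j) *\<^sub>R axis j \<i>) $ i
      = (\<Sum>j\<in>UNIV. if j = i then Re (w $ j) *\<^sub>R 1 + Im (w $ j) *\<^sub>R \<i> else 0)"
      unfolding sum_component by (intro sum.cong) (auto simp: axis_def)
    also have "\<dots> = w $ i" by (simp add: complex_eq_iff)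
    finally show ?thesis .
  qed
  then show ?thesis by (simp add: vec_eq_iff)
qed

lemma (in C2_fun) hess_complex_expand:
  fixes e e' :: "'n::finite \<Rightarrow> 'a"
  assumes x: "x \<in> U"
  shows "hess f x (\<Sum>k\<in>UNIV. a k *\<^sub>R e k + b k *\<^sub>R e' k) (\<Sum>j\<in>UNIV. a j *\<^sub>R e j + b j *\<^sub>R e' j)
    = (\<Sum>j\<in>UNIV. \<Sum>k\<in>UNIV. a k * a j * hess f x (e k) (e j) + a k * b j * hess f x (e k) (e' j)
        + b k * a j * hess f x (e' k) (e j) + b k * b j * hess f x (e' k) (e' j))"
proof -
  note l = linear_hess[OF x] and l' = linear_hess_left[OF x]
  show ?thesis
    unfolding linear_sum[OF l] linear_add[OF l] linear_scale[OF l]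
    unfolding linear_sum[OF l'] linear_add[OF l'] linear_scale[OF l']
    by (simp add: sum.distrib[symmetric] sum_distrib_left algebra_simps)
qed

text \<open>Up to normalisation the Levi form is the Laplacian of \<open>f\<close> along the complex
  line spanned by \<open>w\<close>. It is translated once into real second derivatives, which is the
  form used along holomorphic discs. The coefficients of \<open>\<i> *s w\<close> are those of
  \<open>w\<close> with \<open>(Re, Im)\<close> replaced by \<open>(- Im, Re)\<close>, and the terms
  agree for each pair \<open>j\<close>, \<open>k\<close>.\<close>

lemma Re_levi_form:
  fixes f :: "complex^'n::finite \<Rightarrow> real"
  assumes C2: "C2_fun f U" and x: "x \<in> U"
  shows "4 * Re (levi_form f x w) = hess f x w w + hess f x (\<i> *s w) (\<i> *s w)"
proof -
  interpret C2_fun f U by (rule C2)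
  define h where "h = hess f x"
  have d1: "dzbar k (\<lambda>x. complex_of_real (f x)) y
      = (of_real (deriv_at f y (axis k 1)) + \<i> * of_real (deriv_at f y (axis k \<i>))) / 2" if "y \<in> U" for y k
  proof -
    have "((\<lambda>x. complex_of_real (f x)) has_derivative (\<lambda>v. of_real (deriv_at f y v))) (at y)"
      by (intro has_derivative_of_real has_derivative_deriv_at that)
    from frechet_derivative_at[OF this] show ?thesis unfolding dzbar_def by metis
  qed
  have d2: "dz j (dzbar k (\<lambda>x. complex_of_real (f x))) x
      = ((of_real (h (axis k 1) (axis j 1)) + \<i> * of_real (h (axis k \<i>) (axis j 1)))
        - \<i> * (of_real (h (axis k 1) (axis j \<i>)) + \<i> * of_real (h (axis k \<i>) (axis j \<i>)))) / 4" for j k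
  proof -
    have "((\<lambda>y. (of_real (deriv_at f y (axis k 1)) + \<i> * of_real (deriv_at f y (axis k \<i>))) / 2)
      has_derivative (\<lambda>v. (of_real (h (axis k 1) v) + \<i> * of_real (h (axis k \<i>) v)) / 2)) (at x)"
      unfolding h_def
      by (intro bounded_linear.has_derivative[OF bounded_linear_divide] has_derivative_add has_derivative_of_real has_derivative_mult_right has_derivative_hess x)
    then have "(dzbar k (\<lambda>x. complex_of_real (f x)) has_derivative
        (\<lambda>v. (of_real (h (axis k 1) v) + \<i> * of_real (h (axis k \<i>) v)) / 2)) (at x)"
      by (rule has_derivative_transform_within_open[OF _ U x]) (simp add: d1)
    note fd = frechet_derivative_at[OF this, symmetric]
    show ?thesis unfolding dz_def fd by (simp add: field_simps)
  qed
  define a where "a j = Re (w $ j)" for j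
  define b where "b j = Im (w $ j)" for j
  have w: "w = (\<Sum>j\<in>UNIV. a j *\<^sub>R axis j 1 + b j *\<^sub>R axis j \<i>)"
    unfolding a_def b_def by (rule vec_complex_expand)
  have iw: "\<i> *s w = (\<Sum>j\<in>UNIV. (- b j) *\<^sub>R axis j 1 + a j *\<^sub>R axis j \<i>)"
    using vec_complex_expand[of "\<i> *s w"] by (simp add: a_def b_def)
  have "hess f x w w + hess f x (\<i> *s w) (\<i> *s w)
    = (\<Sum>j\<in>UNIV. \<Sum>k\<in>UNIV. (a k * a j + b k * b j) * (h (axis k 1) (axis j 1) + h (axis k \<i>) (axis j \<i>))
        + (a k * b j - b k * a j) * (h (axis k 1) (axis j \<i>) - h (axis k \<i>) (axis j 1)))"
    unfolding iw hess_complex_expand[OF x]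
    apply (subst (1 2) w)
    unfolding hess_complex_expand[OF x] sum.distrib[symmetric] h_def
    by (intro sum.cong refl) (simp add: algebra_simps)
  also have "\<dots> = (\<Sum>j\<in>UNIV. \<Sum>k\<in>UNIV. Re (4 * (dz j (dzbar k (\<lambda>x. complex_of_real (f x))) x * w $ j * cnj (w $ k))))"
    unfolding d2 by (intro sum.cong refl) (simp add: a_def b_def algebra_simps)
  also have "\<dots> = 4 * Re (levi_form f x w)"
    unfolding levi_form_def by (simp add: sum_distrib_left)
  finally show ?thesis by simp
qed

text \<open>The uniform constants that compactness extracts from the domain: \<open>L\<close> bounds
  from above, \<open>\<kappa>\<close> from below, and \<open>\<eta>\<close> is a radius on which
  Taylor's formula is valid. \<open>deriv_le\<close> has no restriction to this radius, since a
  holomorphic disc may run far from its centre. \<open>nondegenerate\<close> says that a point is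
  deep inside or that the gradient there is not small.\<close>

locale psc_bounds =
  fixes \<Omega> :: "(complex^'n::finite) set" and \<rho> :: "complex^'n \<Rightarrow> real" and U :: "(complex^'n) set"
    and L \<eta> \<kappa> :: real
  assumes open_domain: "open \<Omega>" and connected_domain: "connected \<Omega>" and bounded_domain: "bounded \<Omega>"
    and U: "C2_fun \<rho> U" "\<Omega> = {z \<in> U. \<rho> z < 0}"
    and pos: "0 < L" "0 < \<eta>" "0 < \<kappa>"
    and near_U: "z \<in> \<Omega> \<Longrightarrow> norm (w - z) \<le> \<eta> \<Longrightarrow> w \<in> U"
    and deriv_Lipschitz: "z \<in> \<Omega> \<Longrightarrow> norm (w - z) \<le> \<eta> \<Longrightarrow> \<bar>deriv_at \<rho> w v - deriv_at \<rho> z v\<bar> \<le> L * norm v * norm (w - z)"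
    and Taylor: "z \<in> \<Omega> \<Longrightarrow> norm (w - z) \<le> \<eta> \<Longrightarrow> \<bar>\<rho> w - \<rho> z - deriv_at \<rho> z (w - z)\<bar> \<le> L * (norm (w - z))\<^sup>2"
    and deriv_le: "z \<in> \<Omega> \<Longrightarrow> w \<in> \<Omega> \<Longrightarrow> deriv_at \<rho> z (w - z) \<le> \<rho> w - \<rho> z + L * (norm (w - z))\<^sup>2"
    and depth_le: "z \<in> \<Omega> \<Longrightarrow> - \<rho> z \<le> L"
    and levi_ge: "z \<in> \<Omega> \<Longrightarrow> 4 * \<kappa> * (norm w)\<^sup>2 \<le> hess \<rho> z w w + hess \<rho> z (\<i> *s w) (\<i> *s w)"
    and nondegenerate: "z \<in> \<Omega> \<Longrightarrow> \<kappa> \<le> - \<rho> z \<or> (\<exists>u. norm u \<le> 1 \<and> \<kappa> \<le> \<bar>deriv_at \<rho> z u\<bar>)"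
    and depth_le_dist: "z \<in> \<Omega> \<Longrightarrow> - \<rho> z \<le> L * infdist z (frontier \<Omega>)"

text \<open>The sum over the basis stands in for the norm of the gradient and is visibly continuous
  in the point.\<close>

lemma C2_fun_abs_deriv_sum_pos:
  fixes f :: "'a::euclidean_space \<Rightarrow> real"
  assumes "GDERIV f z :> g" "g \<noteq> 0"
  shows "0 < (\<Sum>b\<in>Basis. \<bar>deriv_at f z b\<bar>)"
proof -
  have "deriv_at f z = (\<lambda>h. h \<bullet> g)"
    using assms(1) unfolding gderiv_def by (metis frechet_derivative_at)
  moreover obtain b where "b \<in> Basis" "g \<bullet> b \<noteq> 0" using assms(2) by (metis euclidean_all_zero_iff)
  ultimately show ?thesis
    by (intro sum_pos2[of _ b]) (auto simp: inner_commute)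
qed

lemma strongly_pseudoconvex_bounds:
  fixes \<Omega> :: "(complex^'n::finite) set"
  assumes "strongly_pseudoconvex \<Omega> \<rho>"
  obtains U L \<eta> \<kappa> where "psc_bounds \<Omega> \<rho> U L \<eta> \<kappa>"
proof -
  from assms obtain U where op: "open \<Omega>" and con: "connected \<Omega>" and ne: "\<Omega> \<noteq> {}" and bd: "bounded \<Omega>"
    and oU: "open U" and clU: "closure \<Omega> \<subseteq> U" and sm: "smooth_on \<rho> U" and psh: "strictly_psh_on \<rho> U"
    and \<Omega>: "\<Omega> = {z \<in> U. \<rho> z < 0}" and gr: "\<And>z. z \<in> frontier \<Omega> \<Longrightarrow> \<exists>g. GDERIV \<rho> z :> g \<and> g \<noteq> 0"
    unfolding strongly_pseudoconvex_def by blast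
  have "Ck_on (Suc (Suc 0)) \<rho> U" using sm unfolding smooth_on_def by blast
  then have C2f: "C2_fun \<rho> U" using oU by unfold_locales
  interpret C2_fun \<rho> U by (rule C2f)
  define K where "K = closure \<Omega>"
  have K: "compact K" "K \<subseteq> U" "\<Omega> \<subseteq> K" "K \<noteq> {}"
    using bd clU ne closure_subset by (auto simp: K_def)
  obtain \<eta> where \<eta>: "\<eta> > 0" "(\<Union>x\<in>K. cball x \<eta>) \<subseteq> U"
    using compact_subset_open_imp_cball_epsilon_subset[OF K(1) oU K(2)] .
  \<comment> \<open>A compact neighbourhood of the closure that is still inside \<open>U\<close>.
    Bounds are taken on it because points \<open>w\<close> within \<open>\<eta>\<close> of
    \<open>z\<close> may leave \<open>\<Omega>\<close>.\<close>
  define K' where "K' = (\<Union>x\<in>K. \<Union>y\<in>cball 0 \<eta>. {x + y})"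
  have "compact K'" unfolding K'_def by (intro compact_sums' K compact_cball)
  have cb: "cball x \<eta> \<subseteq> K'" if "x \<in> K" for x
  proof
    fix y assume "y \<in> cball x \<eta>"
    then have "y - x \<in> cball 0 \<eta>" by (simp add: dist_norm norm_minus_commute)
    then show "y \<in> K'" unfolding K'_def using that by (intro UN_I[of x] UN_I[of "y - x"]) auto
  qed
  have K'U: "K' \<subseteq> U"
  proof
    fix y assume "y \<in> K'"
    then obtain x u where "x \<in> K" "norm u \<le> \<eta>" "y = x + u" by (auto simp: K'_def)
    then have "y \<in> (\<Union>x\<in>K. cball x \<eta>)" by (intro UN_I[of x]) (auto simp: dist_norm)
    then show "y \<in> U" using \<eta> by blast
  qed
  obtain L1 where L1: "0 < L1" "\<And>x v. x \<in> K' \<Longrightarrow> \<bar>deriv_at \<rho> x v\<bar> \<le> L1 * norm v"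
    using deriv_at_bound[OF \<open>compact K'\<close> K'U] by blast
  obtain L2 where L2: "0 < L2" "\<And>x u v. x \<in> K' \<Longrightarrow> \<bar>hess \<rho> x u v\<bar> \<le> L2 * norm u * norm v"
    using hess_bound[OF \<open>compact K'\<close> K'U] by blast
  have contK: "continuous_on K \<rho>" using continuous_on_fun K(2) by (rule continuous_on_subset)
  have "bounded (\<rho> ` K)" by (intro compact_imp_bounded compact_continuous_image contK K)
  then obtain L0 where L0: "0 < L0" "\<And>y. y \<in> \<rho> ` K \<Longrightarrow> norm y \<le> L0" unfolding bounded_pos by blast
  have depth: "- \<rho> z \<le> L0" if "z \<in> K" for z using L0(2)[of "\<rho> z"] that by auto
  have \<rho>K: "\<rho> z \<le> 0" if "z \<in> K" for z
  proof (rule continuous_le_on_closure[of \<Omega> \<rho>])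
    show "continuous_on (closure \<Omega>) \<rho>" using contK by (simp add: K_def)
  qed (use that \<Omega> in \<open>auto simp: K_def\<close>)
  have fr: "z \<in> K" "\<rho> z = 0" if "z \<in> frontier \<Omega>" for z
  proof -
    show "z \<in> K" using that by (simp add: K_def frontier_def)
    moreover have "z \<notin> \<Omega>" using that op by (simp add: frontier_def interior_open)
    ultimately show "\<rho> z = 0" using \<rho>K[of z] K(2) \<Omega> by force
  qed
  \<comment> \<open>The depth is positive inside and the gradient does not vanish on the boundary;
    their maximum is continuous, hence bounded below on the compact closure.\<close>
  have "0 < max (- \<rho> z) (\<Sum>b\<in>Basis. \<bar>deriv_at \<rho> z b\<bar>)" if z: "z \<in> K" for z
  proof (cases "z \<in> \<Omega>")
    case False
    then have "z \<in> frontier \<Omega>" using z op by (simp add: K_def frontier_def interior_open)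
    then show ?thesis using gr C2_fun_abs_deriv_sum_pos by (metis less_max_iff_disj)
  qed (use \<Omega> in auto)
  moreover have "continuous_on K (\<lambda>z. max (- \<rho> z) (\<Sum>b\<in>Basis. \<bar>deriv_at \<rho> z b\<bar>))"
    using K(2) by (intro continuous_intros contK continuous_on_deriv_at) auto
  then obtain z0 where "z0 \<in> K" "\<And>z. z \<in> K \<Longrightarrow> max (- \<rho> z0) (\<Sum>b\<in>Basis. \<bar>deriv_at \<rho> z0 b\<bar>) \<le> max (- \<rho> z) (\<Sum>b\<in>Basis. \<bar>deriv_at \<rho> z b\<bar>)"
    using continuous_attains_inf[OF K(1,4)] by blast
  ultimately obtain \<mu> where \<mu>: "0 < \<mu>" "\<And>z. z \<in> K \<Longrightarrow> \<mu> \<le> max (- \<rho> z) (\<Sum>b\<in>Basis. \<bar>deriv_at \<rho> z b\<bar>)"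
    by blast
  have lev0: "0 < hess \<rho> z w w + hess \<rho> z (\<i> *s w) (\<i> *s w)" if "z \<in> K" "w \<noteq> 0" for z w
  proof -
    have z: "z \<in> U" using that K(2) by auto
    then have "0 < Re (levi_form \<rho> z w)" using psh that unfolding strictly_psh_on_def by blast
    then show ?thesis using Re_levi_form[OF C2f z, of w] by linarith
  qed
  define lev where "lev p = hess \<rho> (fst p) (snd p) (snd p) + hess \<rho> (fst p) (\<i> *s snd p) (\<i> *s snd p)" for p :: "(complex^'n) \<times> (complex^'n)"
  have "continuous_on (K \<times> sphere 0 1) lev"
    unfolding lev_def using K(2) by (intro continuous_intros continuous_on_hess) auto
  moreover have "K \<times> sphere (0::complex^'n) 1 \<noteq> {}" using K(4) by simp
  moreover have "compact (K \<times> sphere (0::complex^'n) 1)" by (intro compact_Times K compact_sphere)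
  ultimately have "\<exists>p\<in>K \<times> sphere 0 1. \<forall>y\<in>K \<times> sphere 0 1. lev p \<le> lev y"
    by (intro continuous_attains_inf)
  then obtain p0 where p0: "p0 \<in> K \<times> sphere 0 1" "\<And>p. p \<in> K \<times> sphere 0 1 \<Longrightarrow> lev p0 \<le> lev p"
    by blast
  define \<nu> where "\<nu> = lev p0"
  have "fst p0 \<in> K" "snd p0 \<noteq> 0" using p0(1) by auto
  then have \<nu>0: "0 < \<nu>" unfolding \<nu>_def lev_def by (rule lev0)
  have \<nu>: "\<nu> * (norm w)\<^sup>2 \<le> hess \<rho> z w w + hess \<rho> z (\<i> *s w) (\<i> *s w)" if z: "z \<in> K" for z w
  proof (cases "w = 0")
    case True
    then show ?thesis using linear_0[OF linear_hess, of z] z K(2) by auto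
  next
    case False
    have z': "z \<in> U" using z K(2) by auto
    define s where "s = sgn w"
    have w: "w = norm w *\<^sub>R s" using False by (simp add: s_def sgn_div_norm)
    have iw: "\<i> *s w = norm w *\<^sub>R (\<i> *s s)"
      by (subst w) (simp add: scaleR_eq_vector_scalar_mult vector_smult_assoc mult.commute)
    have sc: "hess \<rho> z (r *\<^sub>R v) (r *\<^sub>R v) = r\<^sup>2 * hess \<rho> z v v" for r v
      using linear_scale[OF linear_hess_left[OF z'], of r v] linear_scale[OF linear_hess[OF z'], of _ r v]
      by (simp add: power2_eq_square)
    have "hess \<rho> z w w = (norm w)\<^sup>2 * hess \<rho> z s s" using sc[of "norm w" s] w by simp
    moreover have "hess \<rho> z (\<i> *s w) (\<i> *s w) = (norm w)\<^sup>2 * hess \<rho> z (\<i> *s s) (\<i> *s s)"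
      unfolding iw by (rule sc)
    ultimately have "hess \<rho> z w w + hess \<rho> z (\<i> *s w) (\<i> *s w) = (norm w)\<^sup>2 * lev (z, s)"
      by (simp add: lev_def algebra_simps)
    moreover have "\<nu> \<le> lev (z, s)" using p0(2)[of "(z, s)"] z False by (simp add: \<nu>_def s_def norm_sgn)
    then have "\<nu> * (norm w)\<^sup>2 \<le> lev (z, s) * (norm w)\<^sup>2" by (intro mult_right_mono) auto
    ultimately show ?thesis by (simp only: mult.commute)
  qed
  define d where "d = real (DIM(complex^'n))"
  have d: "d > 0" by (simp add: d_def)
  \<comment> \<open>\<open>\<nu> / 4\<close> because of the factor 4 in \<open>levi_ge\<close>;
    \<open>\<mu> / d\<close> because one of the \<open>d\<close> terms of the derivative sum must
    reach this share.\<close>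
  define \<kappa> where "\<kappa> = min (\<nu> / 4) (min \<mu> (\<mu> / d))"
  have \<kappa>: "0 < \<kappa>" "4 * \<kappa> \<le> \<nu>" "\<kappa> \<le> \<mu>" "\<kappa> \<le> \<mu> / d" using \<nu>0 \<mu> d by (auto simp: \<kappa>_def)
  \<comment> \<open>The quotients by powers of \<open>\<eta>\<close> handle points farther apart
    than \<open>\<eta>\<close>: \<open>L1 / \<eta> + L0 / \<eta>\<^sup>2\<close> in
    \<open>deriv_le\<close>, and \<open>L0 / \<eta>\<close> when the nearest boundary point is far
    from \<open>z\<close>.\<close>
  define L where "L = L0 + L1 + L2 + L1 / \<eta> + L0 / \<eta>\<^sup>2 + L0 / \<eta>"
  have Lpos: "0 < L1 / \<eta>" "0 < L0 / \<eta>\<^sup>2" "0 < L0 / \<eta>" using L0 L1 \<eta> by auto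
  have L: "0 < L" "L0 \<le> L" "L1 \<le> L" "L2 \<le> L" "L1 / \<eta> + L0 / \<eta>\<^sup>2 \<le> L" "L0 / \<eta> \<le> L"
    using Lpos L0(1) L1(1) L2(1) unfolding L_def by linarith+
  have cbz: "convex (cball z \<eta>)" "cball z \<eta> \<subseteq> U" "cball z \<eta> \<subseteq> K'" "z \<in> cball z \<eta>" if "z \<in> K" for z
    using cb[OF that] K'U \<eta>(1) by auto
  have cbw: "w \<in> cball z \<eta>" if "norm (w - z) \<le> \<eta>" for w z :: "complex^'n" using that by (simp add: dist_norm norm_minus_commute)
  have tay: "\<bar>\<rho> w - \<rho> z - deriv_at \<rho> z (w - z)\<bar> \<le> L * (norm (w - z))\<^sup>2" if "z \<in> \<Omega>" "norm (w - z) \<le> \<eta>" for z w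
  proof -
    have z: "z \<in> K" using that K by auto
    have "\<bar>\<rho> w - \<rho> z - deriv_at \<rho> z (w - z)\<bar> \<le> L2 * (norm (w - z))\<^sup>2"
      using cbz[OF z] cbw[OF that(2)] L2 by (intro Taylor_bound[of "cball z \<eta>"]) auto
    also have "\<dots> \<le> L * (norm (w - z))\<^sup>2" using L by (intro mult_right_mono) auto
    finally show ?thesis .
  qed
  have "psc_bounds \<Omega> \<rho> U L \<eta> \<kappa>"
  proof
    show "\<Omega> = {z \<in> U. \<rho> z < 0}" by (rule \<Omega>)
    fix z w v :: "complex^'n" assume z: "z \<in> \<Omega>"
    then have zK: "z \<in> K" using K by auto
    show "- \<rho> z \<le> L" using depth[OF zK] L by linarith
    show "4 * \<kappa> * (norm w)\<^sup>2 \<le> hess \<rho> z w w + hess \<rho> z (\<i> *s w) (\<i> *s w)"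
      using \<nu>[OF zK, of w] mult_right_mono[OF \<kappa>(2), of "(norm w)\<^sup>2"] by simp
    show "\<kappa> \<le> - \<rho> z \<or> (\<exists>u. norm u \<le> 1 \<and> \<kappa> \<le> \<bar>deriv_at \<rho> z u\<bar>)"
    proof (rule ccontr)
      assume *: "\<not> ?thesis"
      have lt: "\<bar>deriv_at \<rho> z b\<bar> < \<kappa>" if "b \<in> Basis" for b
        using * norm_Basis[OF that] by (metis order_refl not_le)
      from * have "\<mu> \<le> (\<Sum>b\<in>Basis. \<bar>deriv_at \<rho> z b\<bar>)" using \<mu>(2)[OF zK] \<kappa>(3) by auto
      also have "\<dots> < (\<Sum>b\<in>(Basis :: (complex^'n) set). \<kappa>)"
        by (intro sum_strict_mono lt) auto
      also have "\<dots> = d * \<kappa>" by (simp add: d_def)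
      also have "\<dots> \<le> \<mu>" using \<kappa>(4) d by (simp add: field_simps)
      finally show False by simp
    qed
    have "frontier \<Omega> \<noteq> {}" using ne bd frontier_eq_empty[of \<Omega>] not_bounded_UNIV by metis
    then obtain b where b: "b \<in> frontier \<Omega>" "infdist z (frontier \<Omega>) = dist z b"
      using infdist_attains_inf[of "frontier \<Omega>" z] by (auto simp: frontier_closed)
    show "- \<rho> z \<le> L * infdist z (frontier \<Omega>)"
    proof (cases "dist z b \<le> \<eta>")
      case True
      have "norm (\<rho> b - \<rho> z) \<le> L1 * norm (b - z)"
      proof (rule differentiable_bound[where S="cball z \<eta>"])
        show "(\<rho> has_derivative deriv_at \<rho> x) (at x within cball z \<eta>)" if "x \<in> cball z \<eta>" for x
          using has_derivative_deriv_at cbz[OF zK] that has_derivative_at_withinI by blast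
        show "onorm (deriv_at \<rho> x) \<le> L1" if "x \<in> cball z \<eta>" for x
          using L1 cbz[OF zK] that by (intro onorm_le) auto
      qed (use True \<eta> in auto)
      also have "\<dots> \<le> L * norm (b - z)" using L by (intro mult_right_mono) auto
      finally show ?thesis using fr[OF b(1)] b(2) by (simp add: dist_norm norm_minus_commute)
    next
      case False
      have "- \<rho> z \<le> L0 / \<eta> * \<eta>" using depth[OF zK] \<eta> by simp
      also have "\<dots> \<le> L * dist z b" using L Lpos False \<eta> by (intro mult_mono) auto
      finally show ?thesis by (simp add: b(2))
    qed
    show "deriv_at \<rho> z (w - z) \<le> \<rho> w - \<rho> z + L * (norm (w - z))\<^sup>2" if w: "w \<in> \<Omega>"
    proof (cases "norm (w - z) \<le> \<eta>")
      case True
      then show ?thesis using tay[OF z True] by linarith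
    next
      case False
      define t where "t = norm (w - z)"
      have t: "\<eta> < t" using False by (simp add: t_def)
      have "deriv_at \<rho> z (w - z) \<le> L1 * t"
        using L1(2)[OF subsetD[OF cbz(3)[OF zK] cbz(4)[OF zK]], of "w - z"] by (simp add: t_def)
      also have "\<dots> \<le> L1 / \<eta> * t\<^sup>2"
      proof -
        have "L1 / \<eta> * (\<eta> * t) \<le> L1 / \<eta> * (t * t)" using t \<eta> Lpos by (intro mult_left_mono mult_right_mono) auto
        then show ?thesis using \<eta> by (simp add: power2_eq_square)
      qed
      finally have 1: "deriv_at \<rho> z (w - z) \<le> L1 / \<eta> * t\<^sup>2" .
      have "L0 / \<eta>\<^sup>2 * \<eta>\<^sup>2 \<le> L0 / \<eta>\<^sup>2 * t\<^sup>2" using t \<eta> Lpos by (intro mult_left_mono power_mono) auto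
      then have 2: "L0 \<le> L0 / \<eta>\<^sup>2 * t\<^sup>2" using \<eta> by simp
      have "(L1 / \<eta> + L0 / \<eta>\<^sup>2) * t\<^sup>2 \<le> L * t\<^sup>2" using L by (intro mult_right_mono) auto
      then have 3: "L1 / \<eta> * t\<^sup>2 + L0 / \<eta>\<^sup>2 * t\<^sup>2 \<le> L * t\<^sup>2" by (simp only: distrib_right)
      have "- \<rho> w \<le> L0" "\<rho> z \<le> 0" using depth[of w] \<rho>K[OF zK] w K(3) by auto
      then show ?thesis using 1 2 3 unfolding t_def[symmetric] by linarith
    qed
    assume wz: "norm (w - z) \<le> \<eta>"
    show "w \<in> U" using cbz(2)[OF zK] cbw[OF wz] by (rule subsetD)
    show "\<bar>\<rho> w - \<rho> z - deriv_at \<rho> z (w - z)\<bar> \<le> L * (norm (w - z))\<^sup>2" by (rule tay[OF z wz])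
    have "\<bar>deriv_at \<rho> w v - deriv_at \<rho> z v\<bar> \<le> L2 * norm v * norm (w - z)"
      using cbz[OF zK] cbw[OF wz] L2 by (intro deriv_at_Lipschitz[of "cball z \<eta>"]) auto
    also have "\<dots> \<le> L * norm v * norm (w - z)" using L by (intro mult_right_mono) auto
    finally show "\<bar>deriv_at \<rho> w v - deriv_at \<rho> z v\<bar> \<le> L * norm v * norm (w - z)" .
  qed (use op con bd C2f L \<eta> \<kappa> in auto)
  then show thesis by (rule that)
qed

subsection \<open>Mean values of plurisubharmonic functions along holomorphic discs\<close>

definition vderiv :: "(complex \<Rightarrow> complex^'n) \<Rightarrow> complex \<Rightarrow> complex^'n" where
  "vderiv \<phi> \<zeta> = (\<chi> i. deriv (\<lambda>\<zeta>. \<phi> \<zeta> $ i) \<zeta>)"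

definition vholomorphic :: "(complex \<Rightarrow> complex^'n) \<Rightarrow> bool" where
  "vholomorphic \<phi> \<longleftrightarrow> (\<forall>i. (\<lambda>\<zeta>. \<phi> \<zeta> $ i) holomorphic_on ball 0 1)"

lemma vholomorphic_vderiv: "vholomorphic \<phi> \<Longrightarrow> vholomorphic (vderiv \<phi>)"
  by (auto simp: vholomorphic_def vderiv_def intro!: holomorphic_deriv)

lemma vholomorphic_scale: "vholomorphic \<phi> \<Longrightarrow> vholomorphic (\<lambda>\<zeta>. \<zeta> *s \<phi> \<zeta>)"
  by (auto simp: vholomorphic_def intro!: holomorphic_intros)

lemma vholomorphic_continuous_on:
  fixes \<phi> :: "complex \<Rightarrow> complex^'n::finite"
  assumes "vholomorphic \<phi>" "continuous_on S g" "\<And>x. x \<in> S \<Longrightarrow> norm (g x) < 1"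
  shows "continuous_on S (\<lambda>x. \<phi> (g x))"
proof -
  have "continuous_on (ball 0 1) (\<lambda>\<zeta>. \<chi> i. \<phi> \<zeta> $ i)"
  proof (rule continuous_on_vec_lambda)
    fix i show "continuous_on (ball 0 1) (\<lambda>\<zeta>. \<phi> \<zeta> $ i)"
      using assms(1) unfolding vholomorphic_def by (intro holomorphic_on_imp_continuous_on) blast
  qed
  then have "continuous_on (ball 0 1) \<phi>" by (simp only: vec_nth_inverse)
  then show ?thesis by (rule continuous_on_compose2[OF _ assms(2)]) (use assms(3) in auto)
qed

lemma has_vector_derivative_vholomorphic:
  fixes \<phi> :: "complex \<Rightarrow> complex^'n::finite"
  assumes \<phi>: "vholomorphic \<phi>" and g: "(g has_vector_derivative g') (at t within S)" "norm (g t) < 1"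
  shows "((\<lambda>t. \<phi> (g t)) has_vector_derivative g' *s vderiv \<phi> (g t)) (at t within S)"
proof -
  have comp: "((\<lambda>t. \<phi> (g t) $ i) has_vector_derivative g' * deriv (\<lambda>\<zeta>. \<phi> \<zeta> $ i) (g t)) (at t within S)" for i
  proof -
    have "((\<lambda>\<zeta>. \<phi> \<zeta> $ i) has_field_derivative deriv (\<lambda>\<zeta>. \<phi> \<zeta> $ i) (g t)) (at (g t) within g ` S)"
      by (rule has_field_derivative_at_within, rule holomorphic_derivI[of _ "ball 0 1"])
        (use \<phi> g(2) in \<open>auto simp: vholomorphic_def\<close>)
    from field_vector_diff_chain_within[OF g(1) this] show ?thesis by (simp add: o_def)
  qed
  show ?thesis unfolding has_vector_derivative_def
  proof (subst has_derivative_componentwise_within, intro ballI)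
    fix b :: "complex^'n" assume "b \<in> Basis"
    then obtain i u where b: "b = axis i u" by (auto simp: Basis_vec_def)
    have "((\<lambda>t. \<phi> (g t) $ i \<bullet> u) has_derivative (\<lambda>x. (x *\<^sub>R (g' * deriv (\<lambda>\<zeta>. \<phi> \<zeta> $ i) (g t))) \<bullet> u)) (at t within S)"
      using comp[of i] unfolding has_vector_derivative_def by (intro has_derivative_inner_left)
    then show "((\<lambda>t. \<phi> (g t) \<bullet> b) has_derivative (\<lambda>x. (x *\<^sub>R (g' *s vderiv \<phi> (g t))) \<bullet> b)) (at t within S)"
      by (simp add: b inner_axis vderiv_def)
  qed
qed

lemma (in C2_fun) has_vector_derivative_comp:
  assumes g: "(g has_vector_derivative g') (at t within S)" and gt: "g t \<in> U"
  shows "((\<lambda>t. f (g t)) has_vector_derivative deriv_at f (g t) g') (at t within S)"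
proof -
  have "((\<lambda>t. f (g t)) has_derivative (\<lambda>x. deriv_at f (g t) (x *\<^sub>R g'))) (at t within S)"
    using has_derivative_in_compose[OF g[unfolded has_vector_derivative_def]
        has_derivative_at_withinI[OF has_derivative_deriv_at[OF gt]]] .
  then show ?thesis
    unfolding has_vector_derivative_def by (simp add: linear_scale[OF linear_deriv_at[OF gt]])
qed

lemma (in C2_fun) has_vector_derivative_deriv_at:
  assumes g: "(g has_vector_derivative g') (at t within S)" and gt: "\<And>s. s \<in> S \<Longrightarrow> g s \<in> U" and t: "t \<in> S"
    and v: "(v has_vector_derivative v') (at t within S)"
  shows "((\<lambda>t. deriv_at f (g t) (v t)) has_vector_derivative hess f (g t) (v t) g' + deriv_at f (g t) v') (at t within S)"
proof -
  have gU: "g t \<in> U" using gt t by auto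
  have d: "((\<lambda>t. deriv_at f (g t) b) has_vector_derivative hess f (g t) b g') (at t within S)" for b
  proof -
    have "((\<lambda>t. deriv_at f (g t) b) has_derivative (\<lambda>x. hess f (g t) b (x *\<^sub>R g'))) (at t within S)"
      using has_derivative_in_compose[OF g[unfolded has_vector_derivative_def]
          has_derivative_at_withinI[OF has_derivative_hess[OF gU]]] .
    then show ?thesis
      unfolding has_vector_derivative_def by (simp add: linear_scale[OF linear_hess[OF gU]])
  qed
  have vb: "((\<lambda>t. v t \<bullet> b) has_vector_derivative v' \<bullet> b) (at t within S)" for b
    by (rule bounded_linear.has_vector_derivative[OF bounded_linear_inner_left v])
  have "((\<lambda>t. \<Sum>b\<in>Basis. (v t \<bullet> b) * deriv_at f (g t) b) has_vector_derivative
      (\<Sum>b\<in>Basis. (v t \<bullet> b) * hess f (g t) b g' + (v' \<bullet> b) * deriv_at f (g t) b)) (at t within S)"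
    by (intro has_vector_derivative_sum has_vector_derivative_mult d vb)
  moreover have "(\<Sum>b\<in>Basis. (v t \<bullet> b) * hess f (g t) b g') = hess f (g t) (v t) g'"
  proof -
    have "hess f (g t) (\<Sum>b\<in>Basis. (v t \<bullet> b) *\<^sub>R b) g' = (\<Sum>b\<in>Basis. hess f (g t) ((v t \<bullet> b) *\<^sub>R b) g')"
      by (rule linear_sum[OF linear_hess_left[OF gU]])
    then show ?thesis by (simp add: euclidean_representation linear_scale[OF linear_hess_left[OF gU]])
  qed
  ultimately have "((\<lambda>t. \<Sum>b\<in>Basis. (v t \<bullet> b) * deriv_at f (g t) b) has_vector_derivative
      hess f (g t) (v t) g' + deriv_at f (g t) v') (at t within S)"
    by (simp add: sum.distrib deriv_at_expand[OF gU, symmetric])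
  then show ?thesis
    by (rule has_vector_derivative_transform[OF t, rotated]) (use gt in \<open>simp add: deriv_at_expand[symmetric]\<close>)
qed

text \<open>
  With \<open>W r\<close> the mean of \<open>f \<circ> \<phi>\<close> over the circle of radius \<open>r\<close> and \<open>A r = r W' r\<close>, the angular
  derivatives integrate to zero, and \<open>r A' r\<close> is the mean of the Levi form at \<open>\<zeta> \<phi>' \<zeta>\<close>.
\<close>
lemma plurisubharmonic_mean_value:
  fixes \<phi> :: "complex \<Rightarrow> complex^'n::finite"
  assumes "C2_fun u U'" and \<phi>: "vholomorphic \<phi>" "\<And>\<zeta>. norm \<zeta> < 1 \<Longrightarrow> \<phi> \<zeta> \<in> U'"
    and lev: "\<And>\<zeta> v. norm \<zeta> < 1 \<Longrightarrow> 0 \<le> hess u (\<phi> \<zeta>) v v + hess u (\<phi> \<zeta>) (\<i> *s v) (\<i> *s v)"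
    and R: "0 < R" "R < 1"
  shows "u (\<phi> 0) \<le> integral {0..1} (\<lambda>t. u (\<phi> (of_real R * cis (2 * pi * t))))"
proof -
  interpret u: C2_fun u U' by fact
  define e where "e = (\<lambda>t. cis (2 * pi * t))"
  have e_cont: "continuous_on S e" for S unfolding e_def by (intro continuous_intros)
  have e1: "norm (of_real r * e t) < 1" if "r \<in> {0..R}" for r t
    using that R by (simp add: e_def norm_mult)
  \<comment> \<open>\<open>Q r t\<close> is \<open>r\<close> times the radial derivative
    \<open>P' r t\<close>. Working with it keeps \<open>A\<close> differentiable down to
    \<open>r = 0\<close>, where it vanishes.\<close>
  define q where "q = (\<lambda>\<zeta>. \<zeta> *s vderiv \<phi> \<zeta>)"
  have q: "vholomorphic q" unfolding q_def by (intro vholomorphic_scale vholomorphic_vderiv \<phi>)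
  define P where "P = (\<lambda>r t. \<phi> (of_real r * e t))"
  define Q where "Q = (\<lambda>r t. q (of_real r * e t))"
  define P' where "P' = (\<lambda>r t. e t *s vderiv \<phi> (of_real r * e t))"
  define Q' where "Q' = (\<lambda>r t. e t *s vderiv q (of_real r * e t))"
  have PU: "P r t \<in> U'" if "r \<in> {0..R}" for r t using \<phi>(2)[OF e1[OF that]] by (simp add: P_def)
  have dr: "((\<lambda>r. of_real r * e t) has_vector_derivative e t) (at r within {0..R})" for r t
    by (auto intro!: derivative_eq_intros simp: has_vector_derivative_def scaleR_conv_of_real)
  have dP: "((\<lambda>r. P r t) has_vector_derivative P' r t) (at r within {0..R})" if "r \<in> {0..R}" for r t
    unfolding P_def P'_def by (rule has_vector_derivative_vholomorphic[OF \<phi>(1) dr e1[OF that]])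
  have dQ: "((\<lambda>r. Q r t) has_vector_derivative Q' r t) (at r within {0..R})" if "r \<in> {0..R}" for r t
    unfolding Q_def Q'_def by (rule has_vector_derivative_vholomorphic[OF q dr e1[OF that]])
  have cont: "continuous_on ({0..R} \<times> {0..1}) (\<lambda>p. P (fst p) (snd p))"
    "continuous_on ({0..R} \<times> {0..1}) (\<lambda>p. Q (fst p) (snd p))"
    "continuous_on ({0..R} \<times> {0..1}) (\<lambda>p. P' (fst p) (snd p))"
    "continuous_on ({0..R} \<times> {0..1}) (\<lambda>p. Q' (fst p) (snd p))"
    unfolding P_def Q_def P'_def Q'_def
    by (intro vholomorphic_continuous_on \<phi> q vholomorphic_vderiv continuous_intros continuous_on_compose2[OF e_cont[of UNIV]];
        use e1 in auto)+
  note slice = continuous_on_compose2[OF _ continuous_on_Pair[OF continuous_on_const continuous_on_id]]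
  have img: "Pair r ` {0..1} \<subseteq> {0..R} \<times> {0..1::real}" if "r \<in> {0..R}" for r using that by auto
  have sl: "continuous_on {0..1} (P r)" "continuous_on {0..1} (Q r)" "continuous_on {0..1} (P' r)" "continuous_on {0..1} (Q' r)"
    if "r \<in> {0..R}" for r
    using slice[OF cont(1) img[OF that]] slice[OF cont(2) img[OF that]] slice[OF cont(3) img[OF that]] slice[OF cont(4) img[OF that]]
    by simp_all
  define W where "W = (\<lambda>r. integral {0..1} (\<lambda>t. u (P r t)))"
  define A where "A = (\<lambda>r. integral {0..1} (\<lambda>t. deriv_at u (P r t) (Q r t)))"
  define W' where "W' = (\<lambda>r. integral {0..1} (\<lambda>t. deriv_at u (P r t) (P' r t)))"
  define A' where "A' = (\<lambda>r. integral {0..1} (\<lambda>t. hess u (P r t) (Q r t) (P' r t) + deriv_at u (P r t) (Q' r t)))"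
  have dW: "(W has_vector_derivative W' r) (at r within {0..R})" if r: "r \<in> {0..R}" for r
    unfolding W_def W'_def
  proof (rule leibniz_rule_vector_derivative[where a=0 and b="1::real", unfolded cbox_interval])
    show "((\<lambda>r. u (P r t)) has_vector_derivative deriv_at u (P r t) (P' r t)) (at r within {0..R})" if "r \<in> {0..R}" for r t
      by (rule u.has_vector_derivative_comp[OF dP[OF that] PU[OF that]])
    show "(\<lambda>t. u (P r t)) integrable_on {0..1}" if "r \<in> {0..R}" for r
      using sl[OF that] PU[OF that] by (intro integrable_continuous_real continuous_on_compose2[OF u.continuous_on_fun]) auto
    show "continuous_on ({0..R} \<times> {0..1}) (\<lambda>(r, t). deriv_at u (P r t) (P' r t))"
      unfolding case_prod_unfold using PU by (intro u.continuous_on_deriv_at cont) auto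
  qed (use r in auto)
  have dA: "(A has_vector_derivative A' r) (at r within {0..R})" if r: "r \<in> {0..R}" for r
    unfolding A_def A'_def
  proof (rule leibniz_rule_vector_derivative[where a=0 and b="1::real", unfolded cbox_interval])
    show "((\<lambda>r. deriv_at u (P r t) (Q r t)) has_vector_derivative
        hess u (P r t) (Q r t) (P' r t) + deriv_at u (P r t) (Q' r t)) (at r within {0..R})" if "r \<in> {0..R}" for r t
      by (rule u.has_vector_derivative_deriv_at[OF dP[OF that] _ that dQ[OF that]]) (rule PU)
    show "(\<lambda>t. deriv_at u (P r t) (Q r t)) integrable_on {0..1}" if "r \<in> {0..R}" for r
      using sl[OF that] PU[OF that] by (intro integrable_continuous_real u.continuous_on_deriv_at) auto
    show "continuous_on ({0..R} \<times> {0..1}) (\<lambda>(r, t). hess u (P r t) (Q r t) (P' r t) + deriv_at u (P r t) (Q' r t))"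
      unfolding case_prod_unfold using PU by (intro continuous_on_add u.continuous_on_hess u.continuous_on_deriv_at cont) auto
  qed (use r in auto)
  have A'_nonneg: "0 \<le> A' r" if r: "r \<in> {0<..<R}" for r
  proof -
    have r': "r \<in> {0..R}" using r by auto
    define S where "S = (\<lambda>t. of_real r *s Q' r t)"
    have rQ: "r *\<^sub>R P' r t = Q r t" "r *\<^sub>R Q' r t = S t" for t
      by (simp_all add: P'_def Q_def q_def S_def scaleR_eq_vector_scalar_mult vector_smult_assoc)
    have S_cont: "continuous_on {0..1} S" unfolding S_def by (intro continuous_intros sl r')
    \<comment> \<open>\<open>2 \<pi> B\<close> is the angular derivative of \<open>u\<close> along
      the circle. As \<open>B\<close> is periodic, the integral of its derivative is zero; this
      trades the first-order term with \<open>S\<close> for the Hessian in direction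
      \<open>\<i> *s Q r t\<close>.\<close>
    define B where "B = (\<lambda>t. deriv_at u (P r t) (\<i> *s Q r t))"
    have dt: "((\<lambda>t. of_real r * e t) has_vector_derivative 2 * pi * \<i> * (of_real r * e t)) (at t within {0..1})" for t
    proof -
      have e: "e t = exp (2 * pi * \<i> * of_real t)" for t by (simp add: e_def cis_conv_exp mult_ac)
      have "((\<lambda>z. of_real r * exp (2 * pi * \<i> * z)) has_field_derivative 2 * pi * \<i> * (of_real r * exp (2 * pi * \<i> * of_real t))) (at (of_real t))"
        by (auto intro!: derivative_eq_intros)
      from has_vector_derivative_real_field[OF this] show ?thesis by (simp only: e)
    qed
    have dP_t: "(P r has_vector_derivative (2 * pi) *\<^sub>R (\<i> *s Q r t)) (at t within {0..1})" for t
    proof -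
      have "(P r has_vector_derivative (2 * pi * \<i> * (of_real r * e t)) *s vderiv \<phi> (of_real r * e t)) (at t within {0..1})"
        unfolding P_def by (rule has_vector_derivative_vholomorphic[OF \<phi>(1) dt e1[OF r']])
      then show ?thesis
        by (simp add: Q_def q_def scaleR_eq_vector_scalar_mult vector_smult_assoc mult_ac)
    qed
    have dQ_t: "((\<lambda>t. \<i> *s Q r t) has_vector_derivative (- 2 * pi) *\<^sub>R S t) (at t within {0..1})" for t
    proof -
      have dq: "(Q r has_vector_derivative (2 * pi * \<i> * (of_real r * e t)) *s vderiv q (of_real r * e t)) (at t within {0..1})"
        unfolding Q_def by (rule has_vector_derivative_vholomorphic[OF q dt e1[OF r']])
      have bl: "bounded_linear ((*s) \<i> :: complex^'n \<Rightarrow> complex^'n)"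
        by (intro bounded_linear_intro[where K=1]) (simp_all add: vec_eq_iff algebra_simps norm_vector_scalar_mult)
      have "((\<lambda>t. \<i> *s Q r t) has_vector_derivative \<i> *s ((2 * pi * \<i> * (of_real r * e t)) *s vderiv q (of_real r * e t))) (at t within {0..1})"
        by (rule bounded_linear.has_vector_derivative[OF bl dq])
      moreover have "\<i> *s ((2 * pi * \<i> * (of_real r * e t)) *s vderiv q (of_real r * e t)) = (- 2 * pi) *\<^sub>R S t"
      proof -
        have "\<i> * (2 * pi * \<i> * (of_real r * e t)) = complex_of_real (- 2 * pi) * (of_real r * e t)"
          by (simp add: algebra_simps)
        then show ?thesis unfolding S_def Q'_def scaleR_eq_vector_scalar_mult vector_smult_assoc by (simp only:  mult.assoc)
      qed
      ultimately show ?thesis by simp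
    qed
    have l: "linear (deriv_at u (P r t))" "linear (hess u (P r t) v)" for t v
      using u.linear_deriv_at u.linear_hess PU[OF r'] by blast+
    have dB: "(B has_vector_derivative 2 * pi * (hess u (P r t) (\<i> *s Q r t) (\<i> *s Q r t) - deriv_at u (P r t) (S t))) (at t within {0..1})"
      if t: "t \<in> {0..1}" for t
    proof -
      have "(B has_vector_derivative hess u (P r t) (\<i> *s Q r t) ((2 * pi) *\<^sub>R (\<i> *s Q r t)) + deriv_at u (P r t) ((- 2 * pi) *\<^sub>R S t))
         (at t within {0..1})"
        unfolding B_def by (rule u.has_vector_derivative_deriv_at[OF dP_t _ t dQ_t]) (rule PU[OF r'])
      then show ?thesis by (simp only: linear_scale[OF l(1)] linear_scale[OF l(2)]) (simp add: algebra_simps)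
    qed
    have "((\<lambda>t. 2 * pi * (hess u (P r t) (\<i> *s Q r t) (\<i> *s Q r t) - deriv_at u (P r t) (S t))) has_integral B 1 - B 0) {0..1}"
      using dB by (intro fundamental_theorem_of_calculus) auto
    moreover have "B 1 = B 0" by (simp add: B_def P_def Q_def e_def)
    ultimately have "((\<lambda>t. inverse (2 * pi) * (2 * pi * (hess u (P r t) (\<i> *s Q r t) (\<i> *s Q r t) - deriv_at u (P r t) (S t)))) has_integral inverse (2 * pi) * 0) {0..1}"
      by (intro has_integral_mult_right) simp
    then have z: "((\<lambda>t. hess u (P r t) (\<i> *s Q r t) (\<i> *s Q r t) - deriv_at u (P r t) (S t)) has_integral 0) {0..1}"
      by (simp add: mult.assoc[symmetric])
    have "(\<lambda>t. hess u (P r t) (Q r t) (P' r t) + deriv_at u (P r t) (Q' r t)) integrable_on {0..1}"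
      using sl[OF r'] PU[OF r'] by (intro integrable_continuous_real continuous_on_add u.continuous_on_hess u.continuous_on_deriv_at) auto
    then have "((\<lambda>t. hess u (P r t) (Q r t) (P' r t) + deriv_at u (P r t) (Q' r t)) has_integral A' r) {0..1}"
      by (simp add: A'_def has_integral_integral)
    then have "((\<lambda>t. r * (hess u (P r t) (Q r t) (P' r t) + deriv_at u (P r t) (Q' r t))) has_integral r * A' r) {0..1}"
      by (rule has_integral_mult_right)
    moreover have "r * (hess u (P r t) (Q r t) (P' r t) + deriv_at u (P r t) (Q' r t)) = hess u (P r t) (Q r t) (Q r t) + deriv_at u (P r t) (S t)" for t
      unfolding rQ[symmetric] linear_scale[OF l(1)] linear_scale[OF l(2)] by (simp add: algebra_simps)
    ultimately have "((\<lambda>t. hess u (P r t) (Q r t) (Q r t) + deriv_at u (P r t) (S t)) has_integral r * A' r) {0..1}" by simp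
    from has_integral_add[OF this z]
    have "((\<lambda>t. hess u (P r t) (Q r t) (Q r t) + hess u (P r t) (\<i> *s Q r t) (\<i> *s Q r t)) has_integral r * A' r) {0..1}"
      by (simp add: algebra_simps)
    then have "0 \<le> r * A' r"
      by (rule has_integral_nonneg) (use lev[OF e1[OF r']] in \<open>simp add: P_def\<close>)
    then show ?thesis using r by (simp add: zero_le_mult_iff)
  qed
  have "A 0 = 0"
  proof -
    have "deriv_at u (P 0 t) 0 = 0" for t
      using linear_0[OF u.linear_deriv_at[OF PU[of 0 t]]] R by simp
    then show ?thesis by (simp add: A_def Q_def q_def vec_eq_iff)
  qed
  have at: "(at r within {0..R}) = at r" if "r \<in> {0<..<R}" for r
    using that by (intro at_within_interior) auto
  have cA: "continuous_on {0..R} A" "continuous_on {0..R} W"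
    using continuous_on_vector_derivative[of "{0..R}" A A'] continuous_on_vector_derivative[of "{0..R}" W W'] dA dW
    by blast+
  have A_nonneg: "0 \<le> A r" if r: "r \<in> {0<..<R}" for r
  proof -
    have "A 0 \<le> A r"
    proof (rule DERIV_nonneg_imp_increasing_open[of 0 r A])
      show "\<exists>y. DERIV A x :> y \<and> 0 \<le> y" if "0 < x" "x < r" for x
        using dA[of x] at[of x] A'_nonneg[of x] that r
        by (intro exI[of _ "A' x"]) (auto simp: has_real_derivative_iff_has_vector_derivative)
      show "continuous_on {0..r} A" by (rule continuous_on_subset[OF cA(1)]) (use r in auto)
    qed (use r in auto)
    then show ?thesis using \<open>A 0 = 0\<close> by simp
  qed
  have W'_nonneg: "0 \<le> W' r" if r: "r \<in> {0<..<R}" for r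
  proof -
    have r': "r \<in> {0..R}" using r by auto
    have "r *\<^sub>R P' r t = Q r t" for t
      by (simp_all add: P'_def Q_def q_def scaleR_eq_vector_scalar_mult vector_smult_assoc)
    then have "deriv_at u (P r t) (Q r t) = r * deriv_at u (P r t) (P' r t)" for t
      using linear_scale[OF u.linear_deriv_at[OF PU[OF r']]] by (metis real_scaleR_def)
    then have "A r = r * W' r" by (simp add: A_def W'_def)
    then show ?thesis using A_nonneg[OF r] r by (simp add: zero_le_mult_iff)
  qed
  have "W 0 \<le> W R"
  proof (rule DERIV_nonneg_imp_increasing_open[of 0 R W])
    show "\<exists>y. DERIV W x :> y \<and> 0 \<le> y" if "0 < x" "x < R" for x
      using dW[of x] at[of x] W'_nonneg[of x] that
      by (intro exI[of _ "W' x"]) (auto simp: has_real_derivative_iff_has_vector_derivative)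
  qed (use R cA in auto)
  then show ?thesis by (simp add: W_def P_def e_def)
qed

text \<open>Subtracting \<open>k\<close> times the squared distance lowers the sum of the Hessians
  in directions \<open>v\<close> and \<open>\<i> *s v\<close> by \<open>4 * k * (norm v)^2\<close>,
  which matches the normalisation in \<open>levi_ge\<close>.\<close>

lemma C2_fun_diff_norm_sq:
  fixes f :: "'a::euclidean_space \<Rightarrow> real"
  assumes "C2_fun f U"
  shows "C2_fun (\<lambda>x. f x - k * (norm (x - z))\<^sup>2) U"
    and "x \<in> U \<Longrightarrow> hess (\<lambda>x. f x - k * (norm (x - z))\<^sup>2) x u v = hess f x u v - 2 * k * (u \<bullet> v)"
proof -
  interpret C2_fun f U by fact
  define g where "g = (\<lambda>x. f x - k * (norm (x - z))\<^sup>2)"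
  have dg: "(g has_derivative (\<lambda>v. deriv_at f x v - k * (2 * ((x - z) \<bullet> v)))) (at x)" if "x \<in> U" for x
    unfolding g_def power2_norm_eq_inner
    by (auto intro!: derivative_eq_intros has_derivative_deriv_at that simp: inner_commute)
  have dg': "deriv_at g x = (\<lambda>v. deriv_at f x v - k * (2 * ((x - z) \<bullet> v)))" if "x \<in> U" for x
    using frechet_derivative_at[OF dg[OF that]] by simp
  have hg: "((\<lambda>y. deriv_at g y u) has_derivative (\<lambda>v. hess f x u v - 2 * k * (u \<bullet> v))) (at x)" if x: "x \<in> U" for x u
  proof -
    have "((\<lambda>y. deriv_at f y u - k * (2 * ((y - z) \<bullet> u))) has_derivative (\<lambda>v. hess f x u v - 2 * k * (u \<bullet> v))) (at x)"
      by (auto intro!: derivative_eq_intros has_derivative_hess x simp: inner_commute)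
    then show ?thesis
      by (rule has_derivative_transform_within_open[OF _ U x]) (simp add: dg')
  qed
  have hess_g: "hess g x u v = hess f x u v - 2 * k * (u \<bullet> v)" if "x \<in> U" for x u v
    unfolding hess_def[of g] frechet_derivative_at[OF hg[OF that], symmetric] ..
  have "continuous_on U (\<lambda>x. hess g x u v)" for u v
  proof (rule continuous_on_eq)
    show "continuous_on U (\<lambda>x. hess f x u v - 2 * k * (u \<bullet> v))"
      by (intro continuous_intros continuous_on_hess) auto
  qed (simp add: hess_g)
  moreover have "g differentiable (at x)" if "x \<in> U" for x
    using dg[OF that] by (rule differentiableI)
  moreover have "(\<lambda>y. deriv_at g y u) differentiable (at x)" if "x \<in> U" for x u
    using hg[OF that] by (rule differentiableI)
  ultimately have "Ck_on (Suc (Suc 0)) g U" by (simp add: hess_def)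
  then show "C2_fun (\<lambda>x. f x - k * (norm (x - z))\<^sup>2) U"
    using U by (simp only: C2_fun_def g_def)
  show "x \<in> U \<Longrightarrow> hess (\<lambda>x. f x - k * (norm (x - z))\<^sup>2) x u v = hess f x u v - 2 * k * (u \<bullet> v)"
    using hess_g by (simp only: g_def)
qed

lemma norm_imaginary_mult: "norm (\<i> *s (v::complex^'n)) = norm v"
  by (simp add: norm_vector_scalar_mult)

lemma holomorphic_discs_iff:
  "\<phi> \<in> holomorphic_discs \<Omega> \<longleftrightarrow> vholomorphic \<phi> \<and> (\<forall>\<zeta>. norm \<zeta> < 1 \<longrightarrow> \<phi> \<zeta> \<in> \<Omega>)"
  by (auto simp: holomorphic_discs_def vholomorphic_def)

text \<open>The first Fourier coefficient of \<open>g\<close> on the circle is \<open>R\<close>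
  times the derivative at 0. The second bound involves the real part alone, which matters because
  only \<open>Re (ell z v)\<close>, the real derivative of \<open>\<rho>\<close>, is controlled on
  \<open>\<Omega>\<close>.\<close>

lemma norm_deriv_le_circle:
  assumes g: "g holomorphic_on ball 0 1" and R: "0 < R" "R < 1" and g0: "g 0 = 0"
  shows "R * norm (deriv g 0) \<le> integral {0..1} (\<lambda>t. norm (g (of_real R * cis (2 * pi * t))))" (is ?a)
    and "R * norm (deriv g 0) \<le> 2 * integral {0..1} (\<lambda>t. \<bar>Re (g (of_real R * cis (2 * pi * t)))\<bar>)" (is ?b)
proof -
  define e where "e = (\<lambda>t. cis (2 * pi * t))"
  obtain h where h: "h holomorphic_on ball 0 1" "\<And>z. norm z < 1 \<Longrightarrow> g z = z * h z" "deriv g 0 = h 0"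
    using Schwarz3[OF g g0] by metis
  have e1: "norm (of_real R * e t) < 1" for t using R by (simp add: e_def norm_mult)
  have e_cont: "continuous_on {0..1} e" unfolding e_def by (intro continuous_intros)
  have g_cont: "continuous_on {0..1} (\<lambda>t. g (of_real R * e t))"
    using e1 by (intro continuous_on_compose2[OF holomorphic_on_imp_continuous_on[OF g]] continuous_intros e_cont) auto
  have ee: "e t * cnj (e t) = 1" for t by (simp add: e_def cis_cnj cis_mult)
  have "((\<lambda>t. h (of_real R * e t)) has_integral h 0) {0..1}"
    using circle_mean_value[OF h(1) R] by (simp add: e_def)
  then have "((\<lambda>t. of_real R * h (of_real R * e t)) has_integral of_real R * h 0) {0..1}"
    by (rule has_integral_mult_right)
  moreover have "of_real R * h (of_real R * e t) = g (of_real R * e t) * cnj (e t)" for t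
    using h(2)[OF e1[of t]] ee[of t] by (simp add: mult_ac)
  ultimately have 1: "((\<lambda>t. g (of_real R * e t) * cnj (e t)) has_integral of_real R * h 0) {0..1}"
    by simp
  have "norm (of_real R * h 0) \<le> integral {0..1} (\<lambda>t. norm (g (of_real R * e t)))"
    unfolding integral_unique[OF 1, symmetric]
    using g_cont by (intro integral_norm_bound_integral has_integral_integrable[OF 1] integrable_continuous_real continuous_intros)
      (auto simp: norm_mult e_def)
  then show ?a using R by (simp add: norm_mult h(3) e_def)
  \<comment> \<open>The Fourier coefficient of index -1 vanishes. Adding its conjugate replaces
    \<open>g\<close> by \<open>2 Re g\<close> without changing the coefficient of index 1.\<close>
  have "(\<lambda>z. z * g z) holomorphic_on ball 0 1" by (intro holomorphic_intros g)
  from circle_mean_value[OF this R]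
  have "((\<lambda>t. of_real R * e t * g (of_real R * e t)) has_integral 0) {0..1}" by (simp add: e_def)
  then have "((\<lambda>t. inverse (of_real R) * (of_real R * e t * g (of_real R * e t))) has_integral inverse (of_real R) * 0) {0..1}"
    by (rule has_integral_mult_right)
  then have "((\<lambda>t. e t * g (of_real R * e t)) has_integral 0) {0..1}"
    using R by (simp add: mult.assoc[symmetric])
  from has_integral_linear[OF this bounded_linear_cnj]
  have "((\<lambda>t. cnj (e t * g (of_real R * e t))) has_integral cnj 0) {0..1}" by (simp only: o_def)
  from has_integral_add[OF 1 this]
  have "((\<lambda>t. g (of_real R * e t) * cnj (e t) + cnj (e t * g (of_real R * e t))) has_integral of_real R * h 0) {0..1}"
    by simp
  moreover have "a * cnj b + cnj (b * a) = of_real (2 * Re a) * cnj b" for a b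
    by (simp add: complex_eq_iff)
  ultimately have 2: "((\<lambda>t. of_real (2 * Re (g (of_real R * e t))) * cnj (e t)) has_integral of_real R * h 0) {0..1}"
    by (simp only:)
  have "norm (of_real R * h 0) \<le> integral {0..1} (\<lambda>t. 2 * \<bar>Re (g (of_real R * e t))\<bar>)"
    unfolding integral_unique[OF 2, symmetric]
    using g_cont by (intro integral_norm_bound_integral has_integral_integrable[OF 2] integrable_continuous_real continuous_intros)
      (auto simp: norm_mult e_def)
  then show ?b using R by (simp add: norm_mult h(3) e_def)
qed

context psc_bounds
begin

lemma C2_\<rho>: "C2_fun \<rho> U" by (rule U(1))

definition \<delta> :: "complex^'n \<Rightarrow> real" where "\<delta> z = - \<rho> z"

definition ell :: "complex^'n \<Rightarrow> complex^'n \<Rightarrow> complex" where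
  "ell z v = of_real (deriv_at \<rho> z v) - \<i> * of_real (deriv_at \<rho> z (\<i> *s v))"

definition Mnorm :: "complex^'n \<Rightarrow> complex^'n \<Rightarrow> real" where
  "Mnorm z v = cmod (ell z v) / \<delta> z + norm v / sqrt (\<delta> z)"

lemma in_U: "z \<in> \<Omega> \<Longrightarrow> z \<in> U" using U(2) by auto

lemma \<delta>_pos: "z \<in> \<Omega> \<Longrightarrow> 0 < \<delta> z" using U(2) by (auto simp: \<delta>_def)

lemma Re_ell: "Re (ell z v) = deriv_at \<rho> z v" by (simp add: ell_def)

lemma ell_add: "z \<in> U \<Longrightarrow> ell z (v + w) = ell z v + ell z w"
  using linear_add[OF C2_fun.linear_deriv_at[OF C2_\<rho>]] by (simp add: ell_def vector_add_ldistrib algebra_simps)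

lemma ell_scale: assumes z: "z \<in> U" shows "ell z (a *s v) = a * ell z v"
proof -
  note l = C2_fun.linear_deriv_at[OF C2_\<rho> z]
  have split: "a *s v = Re a *\<^sub>R v + Im a *\<^sub>R (\<i> *s v)"
    by (simp add: vec_eq_iff complex_eq_iff)
  have split': "\<i> *s (a *s v) = Re a *\<^sub>R (\<i> *s v) + (- Im a) *\<^sub>R v"
    by (simp add: vec_eq_iff complex_eq_iff)
  show ?thesis unfolding ell_def split'
    by (subst split) (simp add: linear_add[OF l] linear_scale[OF l] linear_neg[OF l] linear_diff[OF l] complex_eq_iff)
qed

text \<open>The comparison function is \<open>- \<delta> z\<close> at the centre, and on the circle
  at most \<open>- \<kappa>\<close> times the squared displacement, because
  \<open>\<rho> < 0\<close> there.\<close>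

lemma mean_square_displacement_le:
  assumes \<phi>: "\<phi> \<in> holomorphic_discs \<Omega>" and z: "\<phi> 0 = z" and R: "0 < R" "R < 1"
  shows "integral {0..1} (\<lambda>t. (norm (\<phi> (of_real R * cis (2 * pi * t)) - z))\<^sup>2) \<le> \<delta> z / \<kappa>"
proof -
  define P where "P = (\<lambda>t. \<phi> (of_real R * cis (2 * pi * t)))"
  have \<phi>': "vholomorphic \<phi>" "\<And>\<zeta>. norm \<zeta> < 1 \<Longrightarrow> \<phi> \<zeta> \<in> \<Omega>" using \<phi> by (auto simp: holomorphic_discs_iff)
  define u where "u = (\<lambda>x. \<rho> x - \<kappa> * (norm (x - z))\<^sup>2)"
  have C2u: "C2_fun u U" unfolding u_def by (rule C2_fun_diff_norm_sq[OF C2_\<rho>])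
  have "u (\<phi> 0) \<le> integral {0..1} (\<lambda>t. u (P t))"
    unfolding P_def
  proof (rule plurisubharmonic_mean_value[OF C2u \<phi>'(1)])
    fix \<zeta> :: complex and v assume \<zeta>: "norm \<zeta> < 1"
    show "\<phi> \<zeta> \<in> U" using \<phi>'(2)[OF \<zeta>] by (rule in_U)
    then show "0 \<le> hess u (\<phi> \<zeta>) v v + hess u (\<phi> \<zeta>) (\<i> *s v) (\<i> *s v)"
      using levi_ge[OF \<phi>'(2)[OF \<zeta>], of v] C2_fun_diff_norm_sq(2)[OF C2_\<rho>, of "\<phi> \<zeta>" \<kappa> z]
      by (simp add: u_def power2_norm_eq_inner[symmetric] norm_imaginary_mult)
  qed (use R in auto)
  moreover have nR: "norm (of_real R * cis (2 * pi * t)) < 1" for t using R by (simp add: norm_mult)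
  have P_cont: "continuous_on {0..1} P"
    unfolding P_def using nR by (intro vholomorphic_continuous_on \<phi>' continuous_intros)
  have P\<Omega>: "P t \<in> \<Omega>" for t using \<phi>'(2) nR by (simp add: P_def)
  have i1: "(\<lambda>t. u (P t)) integrable_on {0..1}"
    using P\<Omega> in_U
    by (intro integrable_continuous_real continuous_on_compose2[OF C2_fun.continuous_on_fun[OF C2u] P_cont]) auto
  have i2: "(\<lambda>t. (norm (P t - z))\<^sup>2) integrable_on {0..1}"
    by (intro integrable_continuous_real continuous_intros P_cont)
  have "integral {0..1} (\<lambda>t. u (P t)) \<le> integral {0..1} (\<lambda>t. - \<kappa> * (norm (P t - z))\<^sup>2)"
  proof (rule integral_le[OF i1])
    show "(\<lambda>t. - \<kappa> * (norm (P t - z))\<^sup>2) integrable_on {0..1}" using integrable_cmul[OF i2, of "- \<kappa>"] by simp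
    show "u (P t) \<le> - \<kappa> * (norm (P t - z))\<^sup>2" for t using \<delta>_pos[OF P\<Omega>[of t]] by (simp add: u_def \<delta>_def)
  qed
  ultimately have "- \<delta> z \<le> - \<kappa> * integral {0..1} (\<lambda>t. (norm (P t - z))\<^sup>2)"
    by (simp add: u_def z \<delta>_def)
  then show ?thesis using pos by (simp add: P_def pos_le_divide_eq mult.commute)
qed

text \<open>All directions are bounded by the mean displacement, of order
  \<open>sqrt (\<delta> z)\<close>. For the part seen by \<open>ell z\<close> one order is gained:
  along the disc the real part is at most \<open>\<delta> z\<close> plus a multiple of the squared
  displacement, and it has mean zero, so this one-sided bound controls its mean absolute
  value.\<close>

lemma Mnorm_vderiv_le:
  assumes \<phi>: "\<phi> \<in> holomorphic_discs \<Omega>" and z: "\<phi> 0 = z"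
  shows "Mnorm z (vderiv \<phi> 0) \<le> 8 * (1 + L / \<kappa>) + 2 / sqrt \<kappa>"
proof -
  define P where "P = (\<lambda>t. \<phi> (of_real (1/2) * cis (2 * pi * t)))"
  have \<phi>': "vholomorphic \<phi>" "\<And>\<zeta>. norm \<zeta> < 1 \<Longrightarrow> \<phi> \<zeta> \<in> \<Omega>" using \<phi> by (auto simp: holomorphic_discs_iff)
  have z\<Omega>: "z \<in> \<Omega>" using \<phi>'(2)[of 0] z by simp
  have zU: "z \<in> U" by (rule in_U[OF z\<Omega>])
  have \<delta>0: "\<delta> z > 0" by (rule \<delta>_pos[OF z\<Omega>])
  have nR: "norm (of_real (1/2) * cis (2 * pi * t)) < 1" for t by (simp add: norm_mult)
  have P_cont: "continuous_on {0..1} P"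
    unfolding P_def using nR by (intro vholomorphic_continuous_on \<phi>' continuous_intros)
  have P\<Omega>: "P t \<in> \<Omega>" for t using \<phi>'(2)[OF nR] by (simp only: P_def)
  have m2: "integral {0..1} (\<lambda>t. (norm (P t - z))\<^sup>2) \<le> \<delta> z / \<kappa>"
    using mean_square_displacement_le[OF \<phi> z, of "1/2"] by (simp add: P_def)
  have i2: "(\<lambda>t. (norm (P t - z))\<^sup>2) integrable_on {0..1}" and i1: "(\<lambda>t. norm (P t - z)) integrable_on {0..1}"
    by (intro integrable_continuous_real continuous_intros P_cont)+
  define s where "s = sqrt (\<delta> z / \<kappa>)"
  have s: "s > 0" "s * s = \<delta> z / \<kappa>" using \<delta>0 pos by (simp_all add: s_def)
  \<comment> \<open>The Cauchy-Schwarz inequality in the form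
    \<open>x \<le> s / 2 + x^2 / (2 s)\<close>; with this \<open>s\<close> both terms contribute
    \<open>s / 2\<close>.\<close>
  have m1: "integral {0..1} (\<lambda>t. norm (P t - z)) \<le> s"
  proof -
    have "integral {0..1} (\<lambda>t. norm (P t - z)) \<le> integral {0..1} (\<lambda>t. s / 2 + inverse (2 * s) * (norm (P t - z))\<^sup>2)"
    proof (rule integral_le[OF i1])
      show "(\<lambda>t. s / 2 + inverse (2 * s) * (norm (P t - z))\<^sup>2) integrable_on {0..1}"
        by (intro integrable_continuous_real continuous_intros P_cont)
      fix t
      have "0 \<le> (norm (P t - z) - s)\<^sup>2" by simp
      then have "2 * s * norm (P t - z) \<le> s * s + (norm (P t - z))\<^sup>2" by (simp add: power2_eq_square algebra_simps)
      then have "inverse (2 * s) * (2 * s * norm (P t - z)) \<le> inverse (2 * s) * (s * s + (norm (P t - z))\<^sup>2)"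
        using s by (intro mult_left_mono) auto
      then show "norm (P t - z) \<le> s / 2 + inverse (2 * s) * (norm (P t - z))\<^sup>2"
        using s by (simp add: field_simps)
    qed
    also have "\<dots> = s / 2 + inverse (2 * s) * integral {0..1} (\<lambda>t. (norm (P t - z))\<^sup>2)"
      using has_integral_add[OF has_integral_const_real[of "s / 2" 0 1] has_integral_mult_right[OF integrable_integral[OF i2], of "inverse (2 * s)"]]
      by (simp add: has_integral_iff)
    also have "\<dots> \<le> s / 2 + inverse (2 * s) * (s * s)"
      using m2 s by (intro add_left_mono mult_left_mono) auto
    also have "\<dots> = s" using s(1) by (simp add: field_simps)
    finally show ?thesis .
  qed
  have lin: "(\<lambda>\<zeta>. \<Sum>i\<in>UNIV. a i * (\<phi> \<zeta> $ i - z $ i)) holomorphic_on ball 0 1"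
    "deriv (\<lambda>\<zeta>. \<Sum>i\<in>UNIV. a i * (\<phi> \<zeta> $ i - z $ i)) 0 = (\<Sum>i\<in>UNIV. a i * vderiv \<phi> 0 $ i)" for a :: "'n \<Rightarrow> complex"
  proof -
    have h: "(\<lambda>\<zeta>. \<phi> \<zeta> $ i) holomorphic_on ball 0 1" for i using \<phi>'(1) by (simp add: vholomorphic_def)
    show "(\<lambda>\<zeta>. \<Sum>i\<in>UNIV. a i * (\<phi> \<zeta> $ i - z $ i)) holomorphic_on ball 0 1"
      by (intro holomorphic_intros h)
    have "((\<lambda>\<zeta>. \<phi> \<zeta> $ i) has_field_derivative vderiv \<phi> 0 $ i) (at 0)" for i
      using holomorphic_derivI[OF h open_ball, of 0 i] by (simp add: vderiv_def)
    then have "((\<lambda>\<zeta>. \<Sum>i\<in>UNIV. a i * (\<phi> \<zeta> $ i - z $ i)) has_field_derivative (\<Sum>i\<in>UNIV. a i * vderiv \<phi> 0 $ i)) (at 0)"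
      by (auto intro!: derivative_eq_intros sum.cong)
    then show "deriv (\<lambda>\<zeta>. \<Sum>i\<in>UNIV. a i * (\<phi> \<zeta> $ i - z $ i)) 0 = (\<Sum>i\<in>UNIV. a i * vderiv \<phi> 0 $ i)"
      by (rule DERIV_imp_deriv)
  qed
  define v where "v = vderiv \<phi> 0"
  have nv: "norm v \<le> 2 * s"
  proof -
    \<comment> \<open>Pairing with \<open>v\<close> itself makes the derivative at 0 equal to the
      squared norm of \<open>v\<close>, so one factor \<open>norm v\<close> cancels
      afterwards.\<close>
    define g where "g = (\<lambda>\<zeta>. \<Sum>i\<in>UNIV. cnj (v $ i) * (\<phi> \<zeta> $ i - z $ i))"
    have g: "g holomorphic_on ball 0 1" "deriv g 0 = of_real ((norm v)\<^sup>2)" "g 0 = 0"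
    proof -
      have "(norm v)\<^sup>2 = (\<Sum>i\<in>UNIV. (cmod (v $ i))\<^sup>2)"
        by (simp add: norm_vec_def L2_set_def sum_nonneg)
      then have "(\<Sum>i\<in>UNIV. cnj (v $ i) * v $ i) = of_real ((norm v)\<^sup>2)"
        by (simp only: of_real_sum complex_norm_square mult.commute)
      then show "deriv g 0 = of_real ((norm v)\<^sup>2)" unfolding g_def lin(2) v_def[symmetric] by simp
    qed (auto simp: g_def z lin)
    have gle: "norm (g (of_real (1/2) * cis (2 * pi * t))) \<le> norm v * norm (P t - z)" for t
    proof -
      have "norm (g (of_real (1/2) * cis (2 * pi * t))) \<le> (\<Sum>i\<in>UNIV. norm (v $ i) * norm ((P t - z) $ i))"
        unfolding g_def P_def by (rule order_trans[OF norm_sum]) (simp add: norm_mult)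
      also have "\<dots> \<le> norm v * norm (P t - z)"
        using L2_set_mult_ineq[of "\<lambda>i. norm (v $ i)" "\<lambda>i. norm ((P t - z) $ i)" UNIV] by (simp add: norm_vec_def)
      finally show ?thesis .
    qed
    have "1/2 * norm (deriv g 0) \<le> integral {0..1} (\<lambda>t. norm (g (of_real (1/2) * cis (2 * pi * t))))"
      by (rule norm_deriv_le_circle(1)[OF g(1) _ _ g(3)]) auto
    also have "\<dots> \<le> integral {0..1} (\<lambda>t. norm v * norm (P t - z))"
    proof (rule integral_le)
      show "(\<lambda>t. norm (g (of_real (1/2) * cis (2 * pi * t)))) integrable_on {0..1}"
        using nR by (intro integrable_continuous_real continuous_intros continuous_on_compose2[OF holomorphic_on_imp_continuous_on[OF g(1)]]) auto
      show "(\<lambda>t. norm v * norm (P t - z)) integrable_on {0..1}"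
        by (intro integrable_continuous_real continuous_intros P_cont)
    qed (rule gle)
    also have "\<dots> \<le> norm v * s" using m1 by (simp add: mult_left_mono)
    finally have "norm v * norm v \<le> norm v * (2 * s)" by (simp add: g(2) power2_eq_square norm_mult)
    then show ?thesis using s by (cases "norm v = 0") (auto simp: mult_le_cancel_left)
  qed
  have lv: "cmod (ell z v) \<le> 8 * (1 + L / \<kappa>) * \<delta> z"
  proof -
    define a where "a i = ell z (axis i 1)" for i
    have ell_sum: "ell z (\<Sum>i\<in>A. w i) = (\<Sum>i\<in>A. ell z (w i))" if "finite A" for A :: "'n set" and w
      using that by (induction A) (use ell_scale[OF zU, of 0 0] in \<open>simp_all add: ell_add[OF zU]\<close>)
    have ell_exp: "ell z w = (\<Sum>i\<in>UNIV. a i * w $ i)" for w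
    proof -
      have "w = (\<Sum>i\<in>UNIV. w $ i *s axis i 1)"
        by (simp add: vec_eq_iff axis_def if_distrib cong: if_cong)
      then have "ell z w = ell z (\<Sum>i\<in>UNIV. w $ i *s axis i 1)" by simp
      also have "\<dots> = (\<Sum>i\<in>UNIV. a i * w $ i)"
        by (simp add: ell_sum ell_scale[OF zU] a_def mult.commute)
      finally show ?thesis .
    qed
    define g where "g = (\<lambda>\<zeta>. \<Sum>i\<in>UNIV. a i * (\<phi> \<zeta> $ i - z $ i))"
    have g_eq: "g \<zeta> = ell z (\<phi> \<zeta> - z)" for \<zeta> unfolding g_def ell_exp by simp
    have g: "g holomorphic_on ball 0 1" "deriv g 0 = ell z v" "g 0 = 0"
      unfolding ell_exp v_def using lin[of a] by (simp_all add: g_def z)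
    define G where "G = (\<lambda>t. Re (g (of_real (1/2) * cis (2 * pi * t))))"
    have G_cont: "continuous_on {0..1} G" unfolding G_def
      using nR by (intro continuous_intros continuous_on_compose2[OF holomorphic_on_imp_continuous_on[OF g(1)]]) auto
    have "((\<lambda>t. Re (g (of_real (1/2) * cis (2 * pi * t)))) has_integral Re (g 0)) {0..1}"
      using has_integral_linear[OF circle_mean_value[OF g(1), of "1/2"] bounded_linear_Re] by (simp add: o_def)
    then have G0: "(G has_integral 0) {0..1}" by (simp add: G_def g(3))
    have Gle: "G t \<le> \<delta> z + L * (norm (P t - z))\<^sup>2" for t
      using deriv_le[OF z\<Omega> P\<Omega>[of t]] \<delta>_pos[OF P\<Omega>[of t]]
      unfolding G_def g_eq Re_ell \<delta>_def P_def by linarith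
    \<comment> \<open>For \<open>x \<le> y\<close> and \<open>0 \<le> y\<close> one has
      \<open>\<bar>x\<bar> \<le> 2 y - x\<close>; the term \<open>- G t\<close> integrates to
      zero.\<close>
    have abs: "\<bar>G t\<bar> \<le> 2 * (\<delta> z + L * (norm (P t - z))\<^sup>2) - G t" for t
    proof -
      have "0 \<le> \<delta> z + L * (norm (P t - z))\<^sup>2" using \<delta>0 pos by simp
      moreover have "\<bar>x\<bar> \<le> 2 * y - x" if "0 \<le> y" "x \<le> y" for x y :: real using that by linarith
      ultimately show ?thesis using Gle by blast
    qed
    have int: "((\<lambda>t. 2 * (\<delta> z + L * (norm (P t - z))\<^sup>2) - G t) has_integral
        2 * (\<delta> z + L * integral {0..1} (\<lambda>t. (norm (P t - z))\<^sup>2)) - 0) {0..1}"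
      using has_integral_add[OF has_integral_const_real[of "\<delta> z" 0 1] has_integral_mult_right[OF integrable_integral[OF i2], of L]]
      by (intro has_integral_diff G0 has_integral_mult_right) simp
    have "integral {0..1} (\<lambda>t. \<bar>G t\<bar>) \<le> integral {0..1} (\<lambda>t. 2 * (\<delta> z + L * (norm (P t - z))\<^sup>2) - G t)"
      using abs int by (intro integral_le integrable_continuous_real continuous_intros G_cont P_cont) (auto simp: has_integral_iff)
    also have "\<dots> = 2 * (\<delta> z + L * integral {0..1} (\<lambda>t. (norm (P t - z))\<^sup>2))" using int by (simp add: has_integral_iff)
    also have "\<dots> \<le> 2 * (\<delta> z + L * (\<delta> z / \<kappa>))" using m2 pos by (intro mult_left_mono add_left_mono) auto
    finally have "1/2 * norm (deriv g 0) \<le> 2 * (2 * (\<delta> z + L * (\<delta> z / \<kappa>)))"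
      using norm_deriv_le_circle(2)[OF g(1) _ _ g(3), of "1/2"] unfolding G_def by simp
    then show ?thesis by (simp add: g(2) field_simps)
  qed
  have "cmod (ell z v) / \<delta> z \<le> 8 * (1 + L / \<kappa>)" using lv \<delta>0 by (simp add: pos_divide_le_eq)
  moreover have "norm v / sqrt (\<delta> z) \<le> 2 / sqrt \<kappa>"
  proof -
    have "norm v \<le> 2 * (sqrt (\<delta> z) / sqrt \<kappa>)" using nv by (simp add: s_def real_sqrt_divide)
    then show ?thesis using \<delta>0 by (simp add: pos_divide_le_eq mult.commute)
  qed
  ultimately show ?thesis by (simp add: Mnorm_def v_def)
qed

end

subsection \<open>The norm adapted to the domain\<close>

text \<open>\<open>s\<close> and \<open>s'\<close> are the square roots of the depths at two nearby
  points, \<open>a\<close> and \<open>b\<close> the values of \<open>\<bar>ell\<bar>\<close> there,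
  \<open>n\<close> the norm of the vector. The constants work because 64/49 and 64/343 + 8/7 are
  both below 2.\<close>

lemma weighted_norm_compare:
  fixes s s' a b n :: real
  assumes s: "0 < s" "0 < s'" "7 / 8 * s \<le> s'" and ab: "b \<le> a + s * n / 7" and nn: "0 \<le> a" "0 \<le> b" "0 \<le> n"
  shows "b / (s' * s') + n / s' \<le> 2 * (a / (s * s) + n / s)"
proof -
  define x where "x = inverse s"
  define y where "y = inverse s'"
  have x: "0 < x" "s * x = 1" using s by (auto simp: x_def)
  have "y \<le> inverse (7 / 8 * s)" unfolding y_def using s by (intro le_imp_inverse_le) auto
  also have "inverse (7 / 8 * s) = 8 / 7 * x" using s(1) by (simp add: x_def field_simps)
  finally have y: "0 < y" "y \<le> 8 / 7 * x" using s(2) by (simp_all add: y_def)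
  have "b * (y * y) \<le> b * ((8 / 7 * x) * (8 / 7 * x))"
    using y nn by (intro mult_left_mono mult_mono) auto
  also have "\<dots> \<le> (a + s * n / 7) * ((8 / 7 * x) * (8 / 7 * x))"
    using ab by (intro mult_right_mono) auto
  also have "\<dots> = 64 / 49 * (a * (x * x)) + 64 / 343 * n * (s * x) * x" by (simp add: algebra_simps)
  also have "\<dots> = 64 / 49 * (a * (x * x)) + 64 / 343 * (n * x)" using x by simp
  finally have 1: "b * (y * y) \<le> 64 / 49 * (a * (x * x)) + 64 / 343 * (n * x)" .
  have 2: "n * y \<le> 8 / 7 * (n * x)" using mult_left_mono[OF y(2) nn(3)] by simp
  have 3: "0 \<le> a * (x * x)" "0 \<le> n * x" using x nn by auto
  have "b * (y * y) + n * y \<le> 2 * (a * (x * x)) + 2 * (n * x)" using 1 2 3 by linarith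
  then show ?thesis by (simp only: x_def y_def divide_inverse distrib_left inverse_mult_distrib)
qed

context psc_bounds
begin

text \<open>The first two terms keep the first- and second-order changes of \<open>\<rho>\<close>
  below a fraction of the depth; the third keeps displacements within \<open>\<eta>\<close>, since
  the depth is at most \<open>L\<close>.\<close>

definition cc :: real where "cc = min (1 / 16) (min (1 / (16 * L)) (\<eta> / sqrt L))"

lemma cc: "0 < cc" "cc \<le> 1 / 16" "L * cc \<le> 1 / 16" "cc * sqrt L \<le> \<eta>"
proof -
  have c1: "cc \<le> 1 / (16 * L)" "cc \<le> \<eta> / sqrt L" by (auto simp: cc_def)
  show "0 < cc" using pos by (simp add: cc_def)
  show "cc \<le> 1 / 16" unfolding cc_def by (rule min.cobounded1)
  show "L * cc \<le> 1 / 16" using c1(1) pos by (simp add: field_simps)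
  show "cc * sqrt L \<le> \<eta>" using c1(2) pos by (simp add: field_simps)
qed

lemma Mnorm_ge:
  assumes z: "z \<in> \<Omega>"
  shows "norm v \<le> Mnorm z v * sqrt (\<delta> z)" "cmod (ell z v) \<le> Mnorm z v * \<delta> z"
proof -
  have d: "0 < \<delta> z" by (rule \<delta>_pos[OF z])
  have "norm v / sqrt (\<delta> z) \<le> Mnorm z v" "cmod (ell z v) / \<delta> z \<le> Mnorm z v"
    using d by (auto simp: Mnorm_def)
  then show "norm v \<le> Mnorm z v * sqrt (\<delta> z)" "cmod (ell z v) \<le> Mnorm z v * \<delta> z"
    using d by (simp_all add: pos_divide_le_eq)
qed

text \<open>In Taylor's formula the linear term is at most \<open>\<delta> z / 16\<close>, as
  \<open>Mnorm\<close> divides \<open>ell\<close> by the depth, and the quadratic one at most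
  \<open>\<delta> z / 256\<close>, as it divides the norm by the square root of the depth. Hence the
  depth changes by at most one eighth and \<open>w\<close> stays inside.\<close>

lemma Mnorm_near:
  assumes z: "z \<in> \<Omega>" and w: "Mnorm z (w - z) \<le> cc"
  shows "w \<in> \<Omega>" "7 / 8 * \<delta> z \<le> \<delta> w" "\<delta> w \<le> 9 / 8 * \<delta> z" "norm (w - z) \<le> cc * sqrt (\<delta> z)" "norm (w - z) \<le> \<eta>"
proof -
  have d: "0 < \<delta> z" "\<delta> z \<le> L" using \<delta>_pos[OF z] depth_le[OF z] by (auto simp: \<delta>_def)
  have n: "norm (w - z) \<le> cc * sqrt (\<delta> z)"
    by (rule order_trans[OF Mnorm_ge(1)[OF z] mult_right_mono[OF w]]) (use d in simp)
  show "norm (w - z) \<le> cc * sqrt (\<delta> z)" by (rule n)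
  also have "\<dots> \<le> cc * sqrt L" using d cc(1) by (intro mult_left_mono) auto
  also have "\<dots> \<le> \<eta>" by (rule cc(4))
  finally show n\<eta>: "norm (w - z) \<le> \<eta>" .
  have l: "\<bar>deriv_at \<rho> z (w - z)\<bar> \<le> cc * \<delta> z"
  proof -
    have "\<bar>deriv_at \<rho> z (w - z)\<bar> \<le> cmod (ell z (w - z))" using abs_Re_le_cmod[of "ell z (w - z)"] by (simp add: Re_ell)
    also have "\<dots> \<le> Mnorm z (w - z) * \<delta> z" by (rule Mnorm_ge(2)[OF z])
    also have "\<dots> \<le> cc * \<delta> z" using w d by (intro mult_right_mono) auto
    finally show ?thesis .
  qed
  have "(norm (w - z))\<^sup>2 \<le> (cc * sqrt (\<delta> z))\<^sup>2" using n by (intro power_mono) auto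
  also have "(cc * sqrt (\<delta> z))\<^sup>2 = cc * cc * \<delta> z"
    using d by (simp add: power_mult_distrib power2_eq_square[of cc])
  finally have "(norm (w - z))\<^sup>2 \<le> cc * cc * \<delta> z" .
  then have "L * (norm (w - z))\<^sup>2 \<le> L * (cc * cc * \<delta> z)" using pos by (intro mult_left_mono) auto
  also have "\<dots> = (L * cc) * (cc * \<delta> z)" by simp
  also have "\<dots> \<le> 1 / 16 * (1 / 16 * \<delta> z)" using cc d pos by (intro mult_mono) auto
  finally have q: "L * (norm (w - z))\<^sup>2 \<le> 1 / 256 * \<delta> z" by simp
  have "cc * \<delta> z \<le> 1 / 16 * \<delta> z" using cc d by (intro mult_right_mono) auto
  then have \<rho>w: "\<bar>\<rho> w - \<rho> z\<bar> \<le> 1 / 8 * \<delta> z" using Taylor[OF z n\<eta>] q l d by linarith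
  then show "7 / 8 * \<delta> z \<le> \<delta> w" "\<delta> w \<le> 9 / 8 * \<delta> z" by (auto simp: \<delta>_def)
  moreover have "w \<in> U" by (rule near_U[OF z n\<eta>])
  ultimately show "w \<in> \<Omega>" using U(2) d by (auto simp: \<delta>_def)
qed

lemma ell_diff:
  assumes z: "z \<in> \<Omega>" and w: "Mnorm z (w - z) \<le> cc"
  shows "cmod (ell w v - ell z v) \<le> sqrt (\<delta> z) * norm v / 8"
proof -
  note n = Mnorm_near[OF z w]
  have d: "0 < \<delta> z" by (rule \<delta>_pos[OF z])
  have "cmod (ell w v - ell z v) \<le> \<bar>deriv_at \<rho> w v - deriv_at \<rho> z v\<bar> + \<bar>deriv_at \<rho> w (\<i> *s v) - deriv_at \<rho> z (\<i> *s v)\<bar>"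
  proof -
    have "ell w v - ell z v = of_real (deriv_at \<rho> w v - deriv_at \<rho> z v) - \<i> * of_real (deriv_at \<rho> w (\<i> *s v) - deriv_at \<rho> z (\<i> *s v))"
      by (simp add: ell_def algebra_simps)
    also have "cmod \<dots> \<le> \<bar>deriv_at \<rho> w v - deriv_at \<rho> z v\<bar> + \<bar>deriv_at \<rho> w (\<i> *s v) - deriv_at \<rho> z (\<i> *s v)\<bar>"
      by (rule order_trans[OF norm_triangle_ineq4]) (simp add: norm_mult del: of_real_diff)
    finally show ?thesis .
  qed
  also have "\<dots> \<le> L * norm v * norm (w - z) + L * norm v * norm (w - z)"
    using deriv_Lipschitz[OF z n(5), of v] deriv_Lipschitz[OF z n(5), of "\<i> *s v"] by (simp add: norm_imaginary_mult)
  also have "\<dots> = 2 * (L * norm v * norm (w - z))" by simp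
  also have "\<dots> \<le> 2 * (L * norm v * (cc * sqrt (\<delta> z)))"
    using n(4) pos by (intro mult_left_mono) auto
  also have "\<dots> = 2 * (L * cc) * (norm v * sqrt (\<delta> z))" by simp
  also have "\<dots> \<le> 2 * (1 / 16) * (norm v * sqrt (\<delta> z))" using cc d by (intro mult_right_mono mult_left_mono) auto
  finally show ?thesis by (simp add: mult.commute)
qed

lemma plump_metric_Mnorm: "plump_metric \<Omega> Mnorm cc"
proof
  show "open \<Omega>" by (rule open_domain)
  show "0 < cc" "cc \<le> 1" using cc by auto
  fix z v w :: "complex^'n" and a
  assume z: "z \<in> \<Omega>"
  have d: "0 < \<delta> z" and zU: "z \<in> U" by (auto intro: \<delta>_pos in_U z)
  have "cmod (ell z (v + w)) / \<delta> z \<le> (cmod (ell z v) + cmod (ell z w)) / \<delta> z"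
    using d by (intro divide_right_mono) (simp_all add: ell_add[OF zU] norm_triangle_ineq)
  moreover have "norm (v + w) / sqrt (\<delta> z) \<le> (norm v + norm w) / sqrt (\<delta> z)"
    using d by (intro divide_right_mono norm_triangle_ineq) simp
  ultimately show "Mnorm z (v + w) \<le> Mnorm z v + Mnorm z w"
    unfolding Mnorm_def by (simp add: add_divide_distrib)
  show "Mnorm z (a *s v) = cmod a * Mnorm z v"
    by (simp add: Mnorm_def ell_scale[OF zU] norm_mult norm_vector_scalar_mult algebra_simps)
  show "\<exists>k>0. \<forall>v. k * norm v \<le> Mnorm z v"
    using d by (intro exI[of _ "1 / sqrt (\<delta> z)"]) (auto simp: Mnorm_def)
  assume w: "Mnorm z (w - z) \<le> cc"
  note n = Mnorm_near[OF z w]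
  have dw: "0 < \<delta> w" by (rule \<delta>_pos[OF n(1)])
  define s where "s = sqrt (\<delta> z)"
  define s' where "s' = sqrt (\<delta> w)"
  have ss: "\<delta> z = s * s" "\<delta> w = s' * s'" "0 < s" "0 < s'" using d dw by (simp_all add: s_def s'_def)
  have s1: "7 / 8 * s \<le> s'"
  proof (rule power2_le_imp_le)
    have "(7 / 8 * s)\<^sup>2 = 49 / 64 * \<delta> z" by (simp add: ss power2_eq_square)
    also have "\<dots> \<le> \<delta> w" using n(2) d by linarith
    finally show "(7 / 8 * s)\<^sup>2 \<le> s'\<^sup>2" by (simp add: ss power2_eq_square)
  qed (use ss in simp)
  have s2: "7 / 8 * s' \<le> s"
  proof (rule power2_le_imp_le)
    have "(7 / 8 * s')\<^sup>2 = 49 / 64 * \<delta> w" by (simp add: ss power2_eq_square)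
    also have "\<dots> \<le> \<delta> z" using n(3) d by linarith
    finally show "(7 / 8 * s')\<^sup>2 \<le> s\<^sup>2" by (simp add: ss power2_eq_square)
  qed (use ss in simp)
  have "Mnorm w v \<le> 2 * Mnorm z v \<and> Mnorm z v \<le> 2 * Mnorm w v" for v
  proof
    have e: "cmod (ell w v - ell z v) \<le> s * norm v / 8" unfolding s_def by (rule ell_diff[OF z w])
    have e1: "cmod (ell w v) \<le> cmod (ell z v) + s * norm v / 8" "cmod (ell z v) \<le> cmod (ell w v) + s * norm v / 8"
      using e norm_triangle_ineq2[of "ell w v" "ell z v"] norm_triangle_ineq3[of "ell w v" "ell z v"] by linarith+
    have "0 \<le> s * norm v" using ss by simp
    then have "cmod (ell w v) \<le> cmod (ell z v) + s * norm v / 7" using e1(1) by linarith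
    from weighted_norm_compare[OF ss(3,4) s1 this]
    show "Mnorm w v \<le> 2 * Mnorm z v" by (simp add: Mnorm_def s_def s'_def ss(1,2)[symmetric] flip: s_def s'_def)
    \<comment> \<open>The error of \<open>ell\<close> is measured with the depth at
      \<open>z\<close>; passing to \<open>s'\<close> turns \<open>s / 8\<close> into at most
      \<open>s' / 7\<close>, whence the 7 in \<open>weighted_norm_compare\<close>.\<close>
    have "7 / 8 * s * norm v \<le> s' * norm v" using s1 by (intro mult_right_mono) auto
    then have "cmod (ell z v) \<le> cmod (ell w v) + s' * norm v / 7" using e1(2) by simp
    from weighted_norm_compare[OF ss(4,3) s2 this]
    show "Mnorm z v \<le> 2 * Mnorm w v" by (simp add: Mnorm_def s_def s'_def ss(1,2)[symmetric] flip: s_def s'_def)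
  qed
  then show "w \<in> \<Omega> \<and> (\<forall>v. Mnorm w v \<le> 2 * Mnorm z v \<and> Mnorm z v \<le> 2 * Mnorm w v)" using n(1) by blast
next
  have img: "fst ` (\<Omega> \<times> UNIV) \<subseteq> U" using in_U by auto
  have c1: "continuous_on (\<Omega> \<times> UNIV) (\<lambda>p::(complex^'n) \<times> (complex^'n). deriv_at \<rho> (fst p) (snd p))"
    "continuous_on (\<Omega> \<times> UNIV) (\<lambda>p::(complex^'n) \<times> (complex^'n). deriv_at \<rho> (fst p) (\<i> *s snd p))"
    using img by (intro C2_fun.continuous_on_deriv_at[OF C2_\<rho>] continuous_intros; simp)+
  have c2: "continuous_on (\<Omega> \<times> UNIV) (\<lambda>p::(complex^'n) \<times> (complex^'n). \<delta> (fst p))"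
    unfolding \<delta>_def using img
    by (intro continuous_on_minus continuous_on_compose2[OF C2_fun.continuous_on_fun[OF C2_\<rho>]] continuous_intros)
  show "continuous_on (\<Omega> \<times> UNIV) (\<lambda>p. Mnorm (fst p) (snd p))"
    unfolding Mnorm_def ell_def
    by (intro continuous_intros c1 c2) (auto dest: \<delta>_pos)
qed

sublocale plump_metric \<Omega> Mnorm cc by (rule plump_metric_Mnorm)

text \<open>The unit ball lies in a ball of radius \<open>sqrt (\<delta> z)\<close>, of volume of
  order \<open>\<delta> z ^ n\<close>. Near the boundary the condition
  \<open>\<bar>ell\<bar> < \<delta> z\<close> cuts out a tube, and \<open>emeasure_tube_le\<close>
  gains one more power; deep inside, the missing power costs at most
  \<open>1 / \<kappa>\<close>.\<close>

lemma vol_le_depth: "\<exists>C>0. \<forall>z\<in>\<Omega>. vol z \<le> C * \<delta> z ^ (CARD('n) + 1)"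
proof -
  define n where "n = CARD('n)"
  define \<beta> where "\<beta> = unit_ball_vol (DIM(complex^'n))"
  have \<beta>: "\<beta> > 0" unfolding \<beta>_def by (rule unit_ball_vol_pos) simp
  have D: "DIM(complex^'n) = 2 * n" by (simp add: n_def)
  define C where "C = \<beta> / \<kappa> + \<beta> * 4 ^ n / \<kappa>\<^sup>2"
  have C: "C > 0" "\<beta> / \<kappa> \<le> C" "\<beta> * 4 ^ n / \<kappa>\<^sup>2 \<le> C" using \<beta> pos by (auto simp: C_def add_pos_pos)
  have "vol z \<le> C * \<delta> z ^ (n + 1)" if z: "z \<in> \<Omega>" for z
  proof -
    have d: "0 < \<delta> z" and zU: "z \<in> U" by (auto intro: \<delta>_pos in_U z)
    have sq: "sqrt (\<delta> z) ^ (2 * n) = \<delta> z ^ n" using d by (simp add: power_mult)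
    have sub: "{v. Mnorm z v < 1} \<subseteq> {v. norm v < sqrt (\<delta> z) \<and> cmod (ell z v) < \<delta> z}"
    proof safe
      fix v assume v: "Mnorm z v < 1"
      have "Mnorm z v * sqrt (\<delta> z) < 1 * sqrt (\<delta> z)" "Mnorm z v * \<delta> z < 1 * \<delta> z"
        using v d by (intro mult_strict_right_mono; simp)+
      then show "norm v < sqrt (\<delta> z)" "cmod (ell z v) < \<delta> z" using Mnorm_ge[OF z, of v] by auto
    qed
    have lin: "linear (ell z)"
      by (intro linearI) (simp_all add: ell_add[OF zU] ell_scale[OF zU] scaleR_eq_vector_scalar_mult scaleR_conv_of_real[where 'a=complex])
    then have [measurable]: "ell z \<in> borel_measurable borel"
      by (intro borel_measurable_continuous_onI linear_continuous_on) (simp add: linear_conv_bounded_linear)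
    have m: "{v. norm v < sqrt (\<delta> z) \<and> cmod (ell z v) < \<delta> z} \<in> sets lborel" by measurable
    consider "\<kappa> \<le> \<delta> z" | u where "norm u \<le> 1" "\<kappa> \<le> \<bar>deriv_at \<rho> z u\<bar>"
      using nondegenerate[OF z] by (auto simp: \<delta>_def)
    then show ?thesis
    proof cases
      case 1
      have "ennreal (vol z) \<le> emeasure lborel (ball (0::complex^'n) (sqrt (\<delta> z)))"
        unfolding emeasure_unit(1)[OF z, symmetric] using sub by (intro emeasure_mono) auto
      also have "\<dots> = ennreal (\<beta> * \<delta> z ^ n)" using d by (subst emeasure_ball) (simp_all only: \<beta>_def D sq real_sqrt_ge_zero less_imp_le)
      finally have "vol z \<le> \<beta> * \<delta> z ^ n" using \<beta> d by (subst (asm) ennreal_le_iff) auto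
      also have "\<dots> = \<beta> * \<delta> z ^ n * 1" by simp
      also have "\<dots> \<le> \<beta> * \<delta> z ^ n * (\<delta> z / \<kappa>)"
        using 1 \<beta> d pos by (intro mult_left_mono) auto
      also have "\<dots> = \<beta> / \<kappa> * \<delta> z ^ (n + 1)" by simp
      also have "\<dots> \<le> C * \<delta> z ^ (n + 1)" using C d by (intro mult_right_mono) auto
      finally show ?thesis .
    next
      case 2
      have "\<kappa> \<le> cmod (ell z u)" using 2(2) abs_Re_le_cmod[of "ell z u"] by (simp add: Re_ell)
      have "ennreal (vol z) \<le> emeasure lborel {v. norm v < sqrt (\<delta> z) \<and> cmod (ell z v) < \<delta> z}"
        unfolding emeasure_unit(1)[OF z, symmetric] using sub m by (rule emeasure_mono)
      also have "\<dots> \<le> ennreal (\<beta> * (2 * sqrt (\<delta> z)) ^ (2 * n) * (\<delta> z / \<kappa>)\<^sup>2 / (sqrt (\<delta> z))\<^sup>2)"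
        unfolding \<beta>_def D[symmetric]
        using ell_add[OF zU] ell_scale[OF zU] 2(1) \<open>\<kappa> \<le> cmod (ell z u)\<close> pos d by (intro emeasure_tube_le) auto
      finally have "vol z \<le> \<beta> * (2 * sqrt (\<delta> z)) ^ (2 * n) * (\<delta> z / \<kappa>)\<^sup>2 / (sqrt (\<delta> z))\<^sup>2"
        using \<beta> d by (subst (asm) ennreal_le_iff) auto
      also have "\<dots> = \<beta> * (4 ^ n * \<delta> z ^ n) * (\<delta> z * \<delta> z / \<kappa>\<^sup>2) / \<delta> z"
        using d unfolding power_mult_distrib sq by (simp add: power_mult power_divide power2_eq_square)
      also have "\<dots> = \<beta> * 4 ^ n / \<kappa>\<^sup>2 * \<delta> z ^ (n + 1)" using d by (simp add: field_simps)
      also have "\<dots> \<le> C * \<delta> z ^ (n + 1)" using C d by (intro mult_right_mono) auto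
      finally show ?thesis .
    qed
  qed
  then show ?thesis using C(1) by (auto simp: n_def)
qed

end

subsection \<open>The Kobayashi metric and distance\<close>

context psc_bounds
begin

definition KK :: real where "KK = 8 * (1 + L / \<kappa>) + 2 / sqrt \<kappa>"

lemma KK: "0 < KK" using pos by (simp add: KK_def add_pos_pos)

definition admissible :: "complex^'n \<Rightarrow> complex^'n \<Rightarrow> real set" where
  "admissible z \<xi> = {\<alpha>. \<alpha> > 0 \<and> (\<exists>\<phi>\<in>holomorphic_discs \<Omega>. \<phi> 0 = z \<and> vderiv \<phi> 0 = (1 / \<alpha>) *\<^sub>R \<xi>)}"

lemma kobayashi_metric_eq: "kobayashi_metric \<Omega> z \<xi> = Inf (admissible z \<xi>)"
  unfolding kobayashi_metric_def admissible_def
  by (rule arg_cong[where f=Inf], intro Collect_cong conj_cong bex_cong refl)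
    (simp add: vec_eq_iff vderiv_def scaleR_conv_of_real[where 'a=complex] mult.commute)

lemma affine_disc:
  assumes z: "z \<in> \<Omega>" and \<xi>: "Mnorm z v \<le> cc"
  shows "(\<lambda>\<zeta>. z + \<zeta> *s v) \<in> holomorphic_discs \<Omega>" "vderiv (\<lambda>\<zeta>. z + \<zeta> *s v) 0 = v"
proof -
  show "(\<lambda>\<zeta>. z + \<zeta> *s v) \<in> holomorphic_discs \<Omega>"
    unfolding holomorphic_discs_iff
  proof (intro conjI allI impI)
    show "vholomorphic (\<lambda>\<zeta>. z + \<zeta> *s v)" by (auto simp: vholomorphic_def intro!: holomorphic_intros)
    fix \<zeta> :: complex assume "norm \<zeta> < 1"
    then have "cmod \<zeta> * Mnorm z v \<le> 1 * cc" using \<xi> M_nonneg[OF z] by (intro mult_mono) auto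
    then show "z + \<zeta> *s v \<in> \<Omega>" by (intro plump_mem[OF z]) (simp add: M_scale[OF z])
  qed
  have "((\<lambda>\<zeta>. z $ i + \<zeta> * v $ i) has_field_derivative v $ i) (at 0)" for i
    by (auto intro!: derivative_eq_intros)
  then show "vderiv (\<lambda>\<zeta>. z + \<zeta> *s v) 0 = v"
    by (simp add: vderiv_def vec_eq_iff DERIV_imp_deriv)
qed

lemma admissibleI:
  assumes z: "z \<in> \<Omega>" and \<alpha>: "0 < \<alpha>" "Mnorm z \<xi> / cc \<le> \<alpha>"
  shows "\<alpha> \<in> admissible z \<xi>"
proof -
  have "Mnorm z ((1 / \<alpha>) *\<^sub>R \<xi>) \<le> cc"
    using \<alpha> cc(1) by (simp add: M_scaleR[OF z] field_simps)
  note disc = affine_disc[OF z this]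
  have "z + 0 *s ((1 / \<alpha>) *\<^sub>R \<xi>) = z" by simp
  with disc \<alpha>(1) show ?thesis unfolding admissible_def
    by (intro CollectI conjI bexI[of _ "\<lambda>\<zeta>. z + \<zeta> *s ((1 / \<alpha>) *\<^sub>R \<xi>)"])
qed

lemma admissible_nonempty: "z \<in> \<Omega> \<Longrightarrow> admissible z \<xi> \<noteq> {}"
  using admissibleI[of z "max 1 (Mnorm z \<xi> / cc)" \<xi>] by (metis empty_iff less_max_iff_disj max.cobounded2 zero_less_one)

lemma admissible_bdd: "bdd_below (admissible z \<xi>)"
  by (rule bdd_belowI[of _ 0]) (auto simp: admissible_def)

lemma kobayashi_metric_nonneg: "z \<in> \<Omega> \<Longrightarrow> 0 \<le> kobayashi_metric \<Omega> z \<xi>"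
  unfolding kobayashi_metric_eq by (intro cInf_greatest admissible_nonempty) (auto simp: admissible_def)

lemma kobayashi_metric_le:
  assumes z: "z \<in> \<Omega>" shows "kobayashi_metric \<Omega> z \<xi> \<le> Mnorm z \<xi> / cc"
proof (rule field_le_epsilon)
  fix e :: real assume "0 < e"
  then have "Mnorm z \<xi> / cc + e \<in> admissible z \<xi>"
    using M_nonneg[OF z, of \<xi>] cc(1) by (intro admissibleI[OF z]) (auto intro: add_nonneg_pos)
  then show "kobayashi_metric \<Omega> z \<xi> \<le> Mnorm z \<xi> / cc + e"
    unfolding kobayashi_metric_eq by (rule cInf_lower[OF _ admissible_bdd])
qed

lemma kobayashi_metric_ge:
  assumes z: "z \<in> \<Omega>" shows "Mnorm z \<xi> \<le> KK * kobayashi_metric \<Omega> z \<xi>"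
proof -
  have "Mnorm z \<xi> / KK \<le> Inf (admissible z \<xi>)"
  proof (rule cInf_greatest[OF admissible_nonempty[OF z]])
    fix \<alpha> assume "\<alpha> \<in> admissible z \<xi>"
    then obtain \<phi> where \<phi>: "0 < \<alpha>" "\<phi> \<in> holomorphic_discs \<Omega>" "\<phi> 0 = z" "vderiv \<phi> 0 = (1 / \<alpha>) *\<^sub>R \<xi>"
      by (auto simp: admissible_def)
    have "Mnorm z ((1 / \<alpha>) *\<^sub>R \<xi>) \<le> KK" using Mnorm_vderiv_le[OF \<phi>(2,3)] by (simp add: \<phi>(4) KK_def)
    then show "Mnorm z \<xi> / KK \<le> \<alpha>" using \<phi>(1) KK by (simp add: M_scaleR[OF z] field_simps)
  qed
  then show ?thesis using KK by (simp add: kobayashi_metric_eq field_simps)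
qed

text \<open>Upper semicontinuity of the Kobayashi metric, needed to make the metric measurable along
  curves. A competing disc, restricted to a slightly smaller radius, has compact image in
  \<open>\<Omega>\<close> and so survives a small affine perturbation that adjusts its centre and
  its derivative.\<close>

lemma open_kobayashi_metric_less:
  "open {p. fst p \<in> \<Omega> \<and> kobayashi_metric \<Omega> (fst p) (snd p) < \<beta>}" (is "open ?S")
proof (subst open_subopen, intro ballI)
  fix p assume "p \<in> ?S"
  then obtain z0 \<xi>0 where p: "p = (z0, \<xi>0)" and z0: "z0 \<in> \<Omega>" and lt: "Inf (admissible z0 \<xi>0) < \<beta>"
    by (cases p) (auto simp: kobayashi_metric_eq)
  obtain \<alpha> where "\<alpha> \<in> admissible z0 \<xi>0" and \<alpha>: "\<alpha> < \<beta>"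
    using cInf_lessD[OF admissible_nonempty[OF z0] lt] by blast
  then obtain \<phi> where \<alpha>0: "0 < \<alpha>" and \<phi>: "\<phi> \<in> holomorphic_discs \<Omega>" "\<phi> 0 = z0" "vderiv \<phi> 0 = (1 / \<alpha>) *\<^sub>R \<xi>0"
    by (auto simp: admissible_def)
  have \<phi>': "vholomorphic \<phi>" "\<And>\<zeta>. norm \<zeta> < 1 \<Longrightarrow> \<phi> \<zeta> \<in> \<Omega>" using \<phi> by (auto simp: holomorphic_discs_iff)
  \<comment> \<open>Restricting the disc to radius \<open>r\<close> replaces \<open>\<alpha>\<close>
    by \<open>\<alpha> / r\<close>, which has to stay below \<open>\<beta>\<close>.\<close>
  obtain r where "\<alpha> / \<beta> < r" and r1: "r < 1" using dense[of "\<alpha> / \<beta>" 1] \<alpha> \<alpha>0 by auto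
  have \<beta>: "0 < \<beta>" using \<alpha> \<alpha>0 by simp
  have r0: "0 < r" using \<open>\<alpha> / \<beta> < r\<close> divide_pos_pos[OF \<alpha>0 \<beta>] by linarith
  have r: "0 < r" "\<alpha> / r < \<beta>"
    using r0 \<open>\<alpha> / \<beta> < r\<close> \<beta> by (simp_all add: divide_less_eq mult.commute)
  have "compact (\<phi> ` cball 0 r)"
    using r1 by (intro compact_continuous_image vholomorphic_continuous_on[OF \<phi>'(1)] continuous_intros) auto
  moreover have "\<phi> ` cball 0 r \<subseteq> \<Omega>" using \<phi>'(2) r1 by auto
  ultimately obtain \<epsilon> where \<epsilon>: "\<epsilon> > 0" "(\<Union>x\<in>\<phi> ` cball 0 r. ball x \<epsilon>) \<subseteq> \<Omega>"
    using compact_subset_open_imp_ball_epsilon_subset[OF _ open_domain] by metis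
  define T where "T = ball z0 (\<epsilon> / 2) \<times> ball \<xi>0 (\<epsilon> / 2 * (\<alpha> / r))"
  have "open T" unfolding T_def by (intro open_Times open_ball)
  moreover have "p \<in> T" using \<epsilon> \<alpha>0 r by (simp add: T_def p)
  moreover have "T \<subseteq> ?S"
  proof
    fix x assume "x \<in> T"
    then obtain z \<xi> where x: "x = (z, \<xi>)" and z: "norm (z - z0) < \<epsilon> / 2" and \<xi>: "norm (\<xi> - \<xi>0) < \<epsilon> / 2 * (\<alpha> / r)"
      by (cases x) (auto simp: T_def dist_norm norm_minus_commute)
    define u where "u = (r / \<alpha>) *\<^sub>R (\<xi> - \<xi>0)"
    have u: "norm u < \<epsilon> / 2"
    proof -
      have "norm u = r / \<alpha> * norm (\<xi> - \<xi>0)" using r \<alpha>0 by (simp add: u_def)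
      also have "\<dots> < r / \<alpha> * (\<epsilon> / 2 * (\<alpha> / r))" using \<xi> r \<alpha>0 by (intro mult_strict_left_mono) auto
      also have "\<dots> = \<epsilon> / 2" using r \<alpha>0 by simp
      finally show ?thesis .
    qed
    \<comment> \<open>The correction has norm below \<open>\<epsilon>\<close>; it moves the centre
      to \<open>z\<close>, and by the choice of \<open>u\<close> the derivative at 0 becomes
      \<open>(r / \<alpha>) *\<^sub>R \<xi>\<close> exactly.\<close>
    define \<psi> where "\<psi> = (\<lambda>\<zeta>. \<phi> (of_real r * \<zeta>) + ((z - z0) + \<zeta> *s u))"
    have hol: "(\<lambda>\<zeta>. \<phi> (of_real r * \<zeta>) $ i) holomorphic_on ball 0 1" for i
    proof -
      have "(\<lambda>\<zeta>. \<phi> \<zeta> $ i) holomorphic_on ball 0 1" using \<phi>'(1) by (simp add: vholomorphic_def)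
      moreover have "(\<lambda>\<zeta>. of_real r * \<zeta>) ` ball 0 1 \<subseteq> ball (0::complex) 1"
      proof safe
        fix \<zeta> :: complex assume "\<zeta> \<in> ball 0 1"
        then have "norm \<zeta> < 1" by simp
        moreover have "r * norm \<zeta> \<le> 1 * norm \<zeta>" using r1 by (intro mult_right_mono) auto
        ultimately show "of_real r * \<zeta> \<in> ball 0 1" using r by (simp add: norm_mult)
      qed
      ultimately show ?thesis
        using holomorphic_on_compose_gen[of "\<lambda>\<zeta>. of_real r * \<zeta>" "ball 0 1" "\<lambda>\<zeta>. \<phi> \<zeta> $ i" "ball 0 1"]
        by (simp add: o_def holomorphic_intros)
    qed
    have "\<psi> \<in> holomorphic_discs \<Omega>" unfolding holomorphic_discs_iff
    proof (intro conjI allI impI)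
      show "vholomorphic \<psi>" unfolding vholomorphic_def \<psi>_def
        by (auto intro!: holomorphic_intros hol)
      fix \<zeta> :: complex assume \<zeta>: "norm \<zeta> < 1"
      have "norm ((z - z0) + \<zeta> *s u) < \<epsilon>"
      proof -
        have "norm (\<zeta> *s u) \<le> 1 * norm u" unfolding norm_vector_scalar_mult using \<zeta> by (intro mult_right_mono) auto
        then show ?thesis using z u norm_triangle_ineq[of "z - z0" "\<zeta> *s u"] by linarith
      qed
      moreover have "norm (of_real r * \<zeta>) \<le> r" using \<zeta> r by (simp add: norm_mult mult_left_le)
      moreover have "dist (\<phi> (of_real r * \<zeta>)) (\<psi> \<zeta>) = norm ((z - z0) + \<zeta> *s u)"
        by (subst dist_commute) (simp only: \<psi>_def dist_norm add_diff_cancel_left')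
      ultimately have "\<psi> \<zeta> \<in> (\<Union>x\<in>\<phi> ` cball 0 r. ball x \<epsilon>)"
        by (intro UN_I[of "\<phi> (of_real r * \<zeta>)"] imageI) (simp_all only: mem_ball mem_cball dist_0_norm)
      then show "\<psi> \<zeta> \<in> \<Omega>" using \<epsilon> by blast
    qed
    moreover have \<psi>0: "\<psi> 0 = z" by (simp add: \<psi>_def \<phi>(2))
    moreover have "vderiv \<psi> 0 = (1 / (\<alpha> / r)) *\<^sub>R \<xi>"
    proof -
      have "((\<lambda>\<zeta>. \<psi> \<zeta> $ i) has_field_derivative of_real r * vderiv \<phi> 0 $ i + u $ i) (at 0)" for i
      proof -
        have "(\<lambda>\<zeta>. \<phi> \<zeta> $ i) holomorphic_on ball 0 1" using \<phi>'(1) by (simp add: vholomorphic_def)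
        then have d: "((\<lambda>\<zeta>. \<phi> \<zeta> $ i) has_field_derivative vderiv \<phi> 0 $ i) (at (of_real r * 0))"
          using holomorphic_derivI[of "\<lambda>\<zeta>. \<phi> \<zeta> $ i" "ball 0 1" 0] by (simp add: vderiv_def)
        have "((\<lambda>\<zeta>. of_real r * \<zeta>) has_field_derivative of_real r) (at 0)" by (auto intro!: derivative_eq_intros)
        from DERIV_chain2[OF d this]
        show ?thesis unfolding \<psi>_def by (auto intro!: derivative_eq_intros simp: mult.commute)
      qed
      then have "vderiv \<psi> 0 $ i = of_real r * vderiv \<phi> 0 $ i + u $ i" for i
        by (simp add: vderiv_def DERIV_imp_deriv)
      then have "vderiv \<psi> 0 = r *\<^sub>R vderiv \<phi> 0 + u"
        by (simp add: vec_eq_iff scaleR_conv_of_real[where 'a=complex])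
      also have "\<dots> = (r / \<alpha>) *\<^sub>R (\<xi>0 + (\<xi> - \<xi>0))"
        by (simp only: \<phi>(3) u_def scaleR_add_right scaleR_scaleR times_divide_eq_right mult_1_right)
      also have "\<xi>0 + (\<xi> - \<xi>0) = \<xi>" by simp
      finally show ?thesis by (simp only: divide_divide_eq_right mult_1_left)
    qed
    ultimately have "\<alpha> / r \<in> admissible z \<xi>" using \<alpha>0 r unfolding admissible_def by auto
    then have "kobayashi_metric \<Omega> z \<xi> \<le> \<alpha> / r"
      unfolding kobayashi_metric_eq by (rule cInf_lower[OF _ admissible_bdd])
    moreover have "z \<in> \<Omega>" using \<open>\<psi> \<in> holomorphic_discs \<Omega>\<close> \<psi>0 by (auto simp: holomorphic_discs_iff dest: spec[of _ 0])
    ultimately show "x \<in> ?S" using r by (simp add: x)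
  qed
  ultimately show "\<exists>T. open T \<and> p \<in> T \<and> T \<subseteq> ?S" by blast
qed

definition C1_path :: "(real \<Rightarrow> complex^'n) \<Rightarrow> (real \<Rightarrow> complex^'n) \<Rightarrow> bool" where
  "C1_path \<gamma> \<gamma>' \<longleftrightarrow> (\<forall>t\<in>{0..1}. (\<gamma> has_vector_derivative \<gamma>' t) (at t within {0..1})) \<and>
     continuous_on {0..1} \<gamma>' \<and> \<gamma> ` {0..1} \<subseteq> \<Omega>"

lemma C1_path_continuous: "C1_path \<gamma> \<gamma>' \<Longrightarrow> continuous_on {0..1} \<gamma>"
  unfolding C1_path_def by (auto intro: continuous_on_vector_derivative)

text \<open>Without integrability the integral in \<open>kobayashi_dist\<close> would take the
  default value 0 and carry no information. Measurability is upper semicontinuity; the bound is the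
  continuous function \<open>Mnorm / cc\<close>.\<close>

lemma set_integrable_kobayashi:
  assumes \<gamma>: "C1_path \<gamma> \<gamma>'"
  shows "set_integrable lborel {0..1} (\<lambda>t. kobayashi_metric \<Omega> (\<gamma> t) (\<gamma>' t))"
proof -
  define g where "g = (\<lambda>t. kobayashi_metric \<Omega> (\<gamma> t) (\<gamma>' t))"
  have cont: "continuous_on {0..1} \<gamma>" "continuous_on {0..1} \<gamma>'" and im: "\<And>t. t \<in> {0..1} \<Longrightarrow> \<gamma> t \<in> \<Omega>"
    using C1_path_continuous[OF \<gamma>] \<gamma> by (auto simp: C1_path_def)
  have m: "{t \<in> {0..1}. g t < a} \<in> sets borel" for a
  proof -
    have "openin (top_of_set {0..1}) ({0..1} \<inter> (\<lambda>t. (\<gamma> t, \<gamma>' t)) -` {p. fst p \<in> \<Omega> \<and> kobayashi_metric \<Omega> (fst p) (snd p) < a})"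
      by (intro continuous_openin_preimage_gen open_kobayashi_metric_less continuous_intros cont)
    then obtain T where "open T" "{0..1} \<inter> (\<lambda>t. (\<gamma> t, \<gamma>' t)) -` {p. fst p \<in> \<Omega> \<and> kobayashi_metric \<Omega> (fst p) (snd p) < a} = {0..1} \<inter> T"
      by (auto simp: openin_open)
    moreover have "{0..1} \<inter> (\<lambda>t. (\<gamma> t, \<gamma>' t)) -` {p. fst p \<in> \<Omega> \<and> kobayashi_metric \<Omega> (fst p) (snd p) < a} = {t \<in> {0..1}. g t < a}"
      using im by (auto simp: g_def)
    ultimately have "{t \<in> {0..1}. g t < a} = {0..1} \<inter> T" by (simp only:)
    then show ?thesis using \<open>open T\<close> by (simp only: sets.Int borel_open borel_closed closed_atLeastAtMost)
  qed
  have meas: "(\<lambda>t. indicator {0..1} t *\<^sub>R g t) \<in> borel_measurable borel"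
  proof (rule borel_measurableI_less)
    fix a
    have "{t \<in> space borel. indicator {0..1} t *\<^sub>R g t < a} = {t \<in> {0..1}. g t < a} \<union> (if 0 < a then - {0..1} else {})"
      by (auto simp: indicator_def split: if_splits)
    then show "{t \<in> space borel. indicator {0..1} t *\<^sub>R g t < a} \<in> sets borel" using m[of a] by simp
  qed
  have img: "(\<lambda>t. (\<gamma> t, \<gamma>' t)) ` {0..1} \<subseteq> \<Omega> \<times> UNIV" using im by auto
  have "continuous_on {0..1} (\<lambda>t. Mnorm (\<gamma> t) (\<gamma>' t) / cc)"
    using continuous_on_divide[OF continuous_on_compose2[OF M_cont continuous_on_Pair[OF cont] img] continuous_on_const[of _ cc]] cc(1)
    by simp
  then have "set_integrable lborel {0..1} (\<lambda>t. Mnorm (\<gamma> t) (\<gamma>' t) / cc)"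
    by (rule borel_integrable_atLeastAtMost')
  then have "integrable lborel (\<lambda>t. indicator {0..1} t *\<^sub>R g t)"
    unfolding set_integrable_def
  proof (rule Bochner_Integration.integrable_bound)
    show "(\<lambda>t. indicator {0..1} t *\<^sub>R g t) \<in> borel_measurable lborel" using meas by simp
    have "norm (indicator {0..1} t *\<^sub>R g t) \<le> norm (indicator {0..1} t *\<^sub>R (Mnorm (\<gamma> t) (\<gamma>' t) / cc))" for t
      using kobayashi_metric_le[OF im, of t "\<gamma>' t"] kobayashi_metric_nonneg[OF im, of t "\<gamma>' t"] M_nonneg[OF im, of t "\<gamma>' t"] cc(1)
      by (auto simp: indicator_def g_def)
    then show "AE t in lborel. norm (indicator {0..1} t *\<^sub>R g t) \<le> norm (indicator {0..1} t *\<^sub>R (Mnorm (\<gamma> t) (\<gamma>' t) / cc))"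
      by simp
  qed
  then show ?thesis by (simp add: set_integrable_def g_def)
qed

end

section \<open>Kobayashi length and chains of polyballs\<close>

context psc_bounds
begin

lemma Mnorm_path_le:
  assumes z: "z \<in> \<Omega>" and ab: "a \<le> b"
    and \<gamma>: "\<And>t. t \<in> {a..b} \<Longrightarrow> (\<gamma> has_vector_derivative \<gamma>' t) (at t within {a..b})" and c': "continuous_on {a..b} \<gamma>'"
  shows "Mnorm z (\<gamma> b - \<gamma> a) \<le> integral {a..b} (\<lambda>t. Mnorm z (\<gamma>' t))"
proof -
  have zU: "z \<in> U" and d: "0 < \<delta> z" by (auto intro: in_U \<delta>_pos z)
  have "linear (ell z)"
    by (intro linearI) (simp_all add: ell_add[OF zU] ell_scale[OF zU] scaleR_eq_vector_scalar_mult scaleR_conv_of_real[where 'a=complex])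
  then have bl: "bounded_linear (ell z)" by (simp add: linear_conv_bounded_linear)
  have i1: "(\<gamma>' has_integral (\<gamma> b - \<gamma> a)) {a..b}" by (rule fundamental_theorem_of_calculus[OF ab \<gamma>])
  have i2: "((\<lambda>t. ell z (\<gamma>' t)) has_integral ell z (\<gamma> b - \<gamma> a)) {a..b}"
    using has_integral_linear[OF i1 bl] by (simp only: o_def)
  have ce: "continuous_on {a..b} (\<lambda>t. ell z (\<gamma>' t))"
    by (rule bounded_linear.continuous_on[OF bl c'])
  have n1: "(\<lambda>t. norm (\<gamma>' t)) integrable_on {a..b}" and n2: "(\<lambda>t. cmod (ell z (\<gamma>' t))) integrable_on {a..b}"
    by (intro integrable_continuous_real continuous_intros c' ce)+
  have l1: "norm (\<gamma> b - \<gamma> a) \<le> integral {a..b} (\<lambda>t. norm (\<gamma>' t))"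
    unfolding integral_unique[OF i1, symmetric]
    by (rule integral_norm_bound_integral[OF has_integral_integrable[OF i1] n1]) simp
  have l2: "cmod (ell z (\<gamma> b - \<gamma> a)) \<le> integral {a..b} (\<lambda>t. cmod (ell z (\<gamma>' t)))"
    unfolding integral_unique[OF i2, symmetric]
    by (rule integral_norm_bound_integral[OF has_integral_integrable[OF i2] n2]) simp
  have "((\<lambda>t. cmod (ell z (\<gamma>' t)) / \<delta> z + norm (\<gamma>' t) / sqrt (\<delta> z)) has_integral
      integral {a..b} (\<lambda>t. cmod (ell z (\<gamma>' t))) / \<delta> z + integral {a..b} (\<lambda>t. norm (\<gamma>' t)) / sqrt (\<delta> z)) {a..b}"
    by (intro has_integral_add has_integral_divide integrable_integral n1 n2)
  then have "integral {a..b} (\<lambda>t. Mnorm z (\<gamma>' t)) =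
      integral {a..b} (\<lambda>t. cmod (ell z (\<gamma>' t))) / \<delta> z + integral {a..b} (\<lambda>t. norm (\<gamma>' t)) / sqrt (\<delta> z)"
    unfolding Mnorm_def by (rule integral_unique)
  moreover have "Mnorm z (\<gamma> b - \<gamma> a) \<le> \<dots>"
    unfolding Mnorm_def using l1 l2 d by (intro add_mono divide_right_mono) auto
  ultimately show ?thesis by simp
qed

text \<open>
  As long as the path stays in the polyball of radius \<open>cc\<close> about its starting point, its Kobayashi
  length controls the displacement; so it cannot reach the boundary of a polyball too early.
\<close>
lemma short_path:
  assumes p: "C1_path \<gamma> \<gamma>'" and ab: "0 \<le> a" "a \<le> b" "b \<le> 1"
    and int: "(\<lambda>t. kobayashi_metric \<Omega> (\<gamma> t) (\<gamma>' t)) integrable_on {0..1}"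
    and I: "2 * KK * integral {a..b} (\<lambda>t. kobayashi_metric \<Omega> (\<gamma> t) (\<gamma>' t)) < cc"
  shows "Mnorm (\<gamma> a) (\<gamma> b - \<gamma> a) \<le> 2 * KK * integral {a..b} (\<lambda>t. kobayashi_metric \<Omega> (\<gamma> t) (\<gamma>' t))"
proof (rule ccontr)
  define g where "g = (\<lambda>t. kobayashi_metric \<Omega> (\<gamma> t) (\<gamma>' t))"
  define J where "J = integral {a..b} g"
  define m where "m = (\<lambda>t. Mnorm (\<gamma> a) (\<gamma> t - \<gamma> a))"
  assume "\<not> ?thesis"
  then have big: "2 * KK * J < m b" by (simp add: J_def g_def m_def)
  have Jc: "2 * KK * J < cc" using I by (simp add: J_def g_def)
  have im: "\<gamma> t \<in> \<Omega>" if "t \<in> {0..1}" for t using p that by (auto simp: C1_path_def)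
  have g0: "0 \<le> g t" if "t \<in> {0..1}" for t using kobayashi_metric_nonneg[OF im[OF that]] by (simp add: g_def)
  have ga: "g integrable_on {x..y}" if "0 \<le> x" "y \<le> 1" for x y
    unfolding g_def by (rule integrable_on_subinterval[OF int]) (use that in auto)
  have J0: "0 \<le> J" unfolding J_def using g0 ab by (intro integral_nonneg ga) auto
  have a\<Omega>: "\<gamma> a \<in> \<Omega>" using im ab by auto
  have c\<gamma>: "continuous_on {a..b} \<gamma>"
    by (rule continuous_on_subset[OF C1_path_continuous[OF p]]) (use ab in auto)
  have cm: "continuous_on {a..b} m" unfolding m_def
    by (rule continuous_on_compose2[OF continuous_M[OF a\<Omega>, of UNIV]]) (auto intro!: continuous_intros c\<gamma>)
  \<comment> \<open>A level that exceeds the claimed bound but not \<open>cc\<close>. Up to the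
    first time it is reached, the norm at \<open>\<gamma> a\<close> is at most twice the norm at the
    moving point, so the length bounds the displacement below \<open>\<mu>\<close>, a
    contradiction.\<close>
  define \<mu> where "\<mu> = min (m b) cc"
  have \<mu>: "2 * KK * J < \<mu>" "\<mu> \<le> cc" "\<mu> \<le> m b" "0 < \<mu>"
    using big Jc order.strict_trans1[OF mult_nonneg_nonneg[of "2 * KK" J] big] J0 KK cc(1) by (auto simp: \<mu>_def)
  define T where "T = {t \<in> {a..b}. \<mu> \<le> m t}"
  have "closed T" unfolding T_def
    by (intro continuous_on_closed_Collect_le cm continuous_intros closed_atLeastAtMost)
  moreover have "T \<noteq> {}" "bdd_below T" using \<mu>(3) ab by (auto simp: T_def intro!: bdd_belowI[of _ a])
  ultimately have t0: "Inf T \<in> T" by (rule closed_contains_Inf[rotated 2])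
  define t0 where "t0 = Inf T"
  have t0T: "a \<le> t0" "t0 \<le> b" "\<mu> \<le> m t0" using t0 by (auto simp: T_def t0_def)
  have before: "m t < \<mu>" if "a \<le> t" "t < t0" for t
  proof (rule ccontr)
    assume "\<not> m t < \<mu>"
    then have "t \<in> T" using that t0T by (auto simp: T_def)
    then have "t0 \<le> t" unfolding t0_def using \<open>bdd_below T\<close> by (rule cInf_lower)
    then show False using that by simp
  qed
  have ma: "m a = 0" by (simp add: m_def M_0[OF a\<Omega>])
  have "\<exists>t\<ge>a. t \<le> t0 \<and> m t = \<mu>"
    by (rule IVT') (use ma \<mu> t0T cm in \<open>auto intro: continuous_on_subset\<close>)
  then obtain t1 where t1: "a \<le> t1" "t1 \<le> t0" "m t1 = \<mu>" by blast
  then have "t1 = t0" using before[of t1] by (cases "t1 = t0") auto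
  then have mt0: "m t0 = \<mu>" using t1 by simp
  have le: "m t \<le> cc" if "t \<in> {a..t0}" for t
    using before[of t] mt0 \<mu>(2) that by (cases "t = t0") auto
  have sub: "{a..t0} \<subseteq> {0..1}" using ab t0T by auto
  have "m t0 \<le> integral {a..t0} (\<lambda>t. Mnorm (\<gamma> a) (\<gamma>' t))"
    unfolding m_def
  proof (rule Mnorm_path_le[OF a\<Omega> t0T(1)])
    show "continuous_on {a..t0} \<gamma>'" using p sub by (auto simp: C1_path_def intro: continuous_on_subset)
    show "(\<gamma> has_vector_derivative \<gamma>' t) (at t within {a..t0})" if "t \<in> {a..t0}" for t
    proof (rule has_vector_derivative_within_subset[OF _ sub])
      show "(\<gamma> has_vector_derivative \<gamma>' t) (at t within {0..1})" using p sub that by (auto simp: C1_path_def)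
    qed
  qed
  also have "\<dots> \<le> integral {a..t0} (\<lambda>t. 2 * KK * g t)"
  proof (rule integral_le)
    have "continuous_on {a..t0} \<gamma>'" using p sub by (auto simp: C1_path_def intro: continuous_on_subset)
    then show "(\<lambda>t. Mnorm (\<gamma> a) (\<gamma>' t)) integrable_on {a..t0}"
      by (intro integrable_continuous_real continuous_on_compose2[OF continuous_M[OF a\<Omega>, of UNIV]]) auto
    show "(\<lambda>t. 2 * KK * g t) integrable_on {a..t0}"
      using integrable_cmul[OF ga[of a t0], of "2 * KK"] ab t0T by simp
    fix t assume t: "t \<in> {a..t0}"
    have "Mnorm (\<gamma> a) (\<gamma>' t) \<le> 2 * Mnorm (\<gamma> t) (\<gamma>' t)"
      using plump_ge[OF a\<Omega>, of "\<gamma> t"] le[OF t] by (simp add: m_def)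
    also have "\<dots> \<le> 2 * (KK * g t)"
      using kobayashi_metric_ge[OF im, of t "\<gamma>' t"] t sub by (auto simp: g_def)
    finally show "Mnorm (\<gamma> a) (\<gamma>' t) \<le> 2 * KK * g t" by simp
  qed
  also have "\<dots> = 2 * KK * integral {a..t0} g" by simp
  also have "\<dots> \<le> 2 * KK * J"
    unfolding J_def using KK g0 ab t0T by (intro mult_left_mono integral_subset_le ga) auto
  finally show False using mt0 \<mu>(1) by simp
qed

text \<open>The path is cut into \<open>Suc m\<close> pieces of equal Kobayashi length, the cutting
  times being supplied by the intermediate value theorem for the length; \<open>short_path\<close>
  makes each piece a single step.\<close>

lemma path_chain:
  fixes s :: real
  assumes p: "C1_path \<gamma> \<gamma>'" and s: "0 < s" "s \<le> cc"
    and int: "(\<lambda>t. kobayashi_metric \<Omega> (\<gamma> t) (\<gamma>' t)) integrable_on {0..1}"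
    and ab: "0 \<le> a" "a \<le> b" "b \<le> 1"
    and I: "2 * KK * integral {a..b} (\<lambda>t. kobayashi_metric \<Omega> (\<gamma> t) (\<gamma>' t)) < Suc m * s"
  shows "(\<gamma> a, \<gamma> b) \<in> near s ^^ Suc m"
  using ab I
proof (induction m arbitrary: a)
  case 0
  have "Mnorm (\<gamma> a) (\<gamma> b - \<gamma> a) \<le> 2 * KK * integral {a..b} (\<lambda>t. kobayashi_metric \<Omega> (\<gamma> t) (\<gamma>' t))"
    using 0 s by (intro short_path[OF p _ _ _ int]) auto
  then have "Mnorm (\<gamma> a) (\<gamma> b - \<gamma> a) < s" using 0 by simp
  moreover have "\<gamma> a \<in> \<Omega>" using p 0 by (auto simp: C1_path_def)
  ultimately show ?case by (simp add: near_def)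
next
  case (Suc m)
  define g where "g = (\<lambda>t. kobayashi_metric \<Omega> (\<gamma> t) (\<gamma>' t))"
  have im: "\<gamma> t \<in> \<Omega>" if "t \<in> {0..1}" for t using p that by (auto simp: C1_path_def)
  have g0: "0 \<le> g t" if "t \<in> {0..1}" for t using kobayashi_metric_nonneg[OF im[OF that]] by (simp add: g_def)
  have ga: "g integrable_on {a..b}"
    unfolding g_def by (rule integrable_on_subinterval[OF int]) (use Suc.prems in auto)
  define J where "J = integral {a..b} g"
  have J0: "0 \<le> J" unfolding J_def using g0 Suc.prems by (intro integral_nonneg ga) auto
  have JI: "2 * KK * J < Suc (Suc m) * s" using Suc.prems by (simp add: J_def g_def)
  define \<theta> where "\<theta> = J / Suc (Suc m)"
  have \<theta>: "0 \<le> \<theta>" "\<theta> \<le> J" "2 * KK * \<theta> < s" "J - \<theta> = Suc m * \<theta>"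
  proof -
    show "0 \<le> \<theta>" using J0 by (simp add: \<theta>_def)
    have "Suc (Suc m) * \<theta> = J" by (simp add: \<theta>_def)
    then show e: "J - \<theta> = Suc m * \<theta>" by (simp add: algebra_simps)
    have "0 \<le> Suc m * \<theta>" using \<open>0 \<le> \<theta>\<close> by (intro mult_nonneg_nonneg) auto
    then show "\<theta> \<le> J" using e by linarith
    have "Suc (Suc m) * (2 * KK * \<theta>) < Suc (Suc m) * s"
      using JI \<open>Suc (Suc m) * \<theta> = J\<close> by (simp only: mult.left_commute mult.assoc)
    then show "2 * KK * \<theta> < s" by (simp only: mult_less_cancel_left_pos of_nat_0_less_iff zero_less_Suc)
  qed
  have "\<exists>t\<ge>a. t \<le> b \<and> integral {a..t} g = \<theta>"
  proof (rule IVT')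
    show "continuous_on {a..b} (\<lambda>t. integral {a..t} g)" by (rule indefinite_integral_continuous_1[OF ga])
  qed (use \<theta> Suc.prems in \<open>auto simp: J_def\<close>)
  then obtain t where t: "a \<le> t" "t \<le> b" "integral {a..t} g = \<theta>" by blast
  have "integral {a..t} g + integral {t..b} g = J"
    unfolding J_def by (rule Henstock_Kurzweil_Integration.integral_combine[OF t(1,2) ga])
  then have rest: "integral {t..b} g = Suc m * \<theta>" using t(3) \<theta>(4) by linarith
  have "2 * KK * integral {a..t} g < cc" using \<theta>(3) t(3) s by simp
  then have "Mnorm (\<gamma> a) (\<gamma> t - \<gamma> a) \<le> 2 * KK * integral {a..t} g"
    unfolding g_def using Suc.prems t by (intro short_path[OF p _ _ _ int]) auto
  then have "Mnorm (\<gamma> a) (\<gamma> t - \<gamma> a) < s" using \<theta>(3) t(3) by simp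
  moreover have "\<gamma> a \<in> \<Omega>" using im Suc.prems by auto
  ultimately have "(\<gamma> a, \<gamma> t) \<in> near s" by (simp add: near_def)
  moreover have "(\<gamma> t, \<gamma> b) \<in> near s ^^ Suc m"
  proof (rule Suc.IH)
    have "2 * KK * (Suc m * \<theta>) = Suc m * (2 * KK * \<theta>)" by (simp only: mult.left_commute mult.assoc)
    also have "\<dots> < Suc m * s" using \<theta>(3) by (intro mult_strict_left_mono) auto
    finally show "2 * KK * integral {t..b} (\<lambda>t. kobayashi_metric \<Omega> (\<gamma> t) (\<gamma>' t)) < Suc m * s"
      using rest by (simp add: g_def)
  qed (use Suc.prems t in auto)
  ultimately show ?case by (rule relpow_Suc_I2)
qed

text \<open>An infimum over an empty set would be meaningless: connectedness supplies a polynomial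
  path, so a curve almost attaining the distance exists.\<close>

lemma kobayashi_dist_path:
  assumes zw: "z \<in> \<Omega>" "w \<in> \<Omega>" and d: "kobayashi_dist \<Omega> z w < T"
  obtains \<gamma> \<gamma>' where "C1_path \<gamma> \<gamma>'" "\<gamma> 0 = z" "\<gamma> 1 = w"
    "(\<lambda>t. kobayashi_metric \<Omega> (\<gamma> t) (\<gamma>' t)) integrable_on {0..1}"
    "integral {0..1} (\<lambda>t. kobayashi_metric \<Omega> (\<gamma> t) (\<gamma>' t)) < T"
proof -
  define X where "X = {LBINT t:{0..1}. kobayashi_metric \<Omega> (\<gamma> t) (\<gamma>' t) | \<gamma> \<gamma>'. C1_path \<gamma> \<gamma>' \<and> \<gamma> 0 = z \<and> \<gamma> 1 = w}"
  have X: "kobayashi_dist \<Omega> z w = Inf X"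
    unfolding kobayashi_dist_def X_def C1_path_def by (simp only: conj_assoc)
  obtain g where g: "polynomial_function g" "path_image g \<subseteq> \<Omega>" "pathstart g = z" "pathfinish g = w"
    using connected_open_polynomial_connected[OF open_domain connected_domain zw] by blast
  obtain g' where g': "polynomial_function g'" "\<And>x. (g has_vector_derivative g' x) (at x)"
    using has_vector_derivative_polynomial_function[OF g(1)] by blast
  have "C1_path g g'"
    unfolding C1_path_def using g(2) g'
    by (auto simp: path_image_def intro: has_vector_derivative_at_within continuous_on_polymonial_function)
  then have "X \<noteq> {}" using g(3,4) unfolding X_def pathstart_def pathfinish_def by blast
  from cInf_lessD[OF this d[unfolded X]] obtain \<gamma> \<gamma>' where
    p: "C1_path \<gamma> \<gamma>'" "\<gamma> 0 = z" "\<gamma> 1 = w" "(LBINT t:{0..1}. kobayashi_metric \<Omega> (\<gamma> t) (\<gamma>' t)) < T"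
    unfolding X_def by blast
  note i = set_borel_integral_eq_integral[OF set_integrable_kobayashi[OF p(1)]]
  show thesis by (rule that[OF p(1-3) i(1)]) (use p(4) i(2) in simp)
qed

lemma kobayashi_dist_le_path:
  assumes p: "C1_path \<gamma> \<gamma>'"
  shows "kobayashi_dist \<Omega> (\<gamma> 0) (\<gamma> 1) \<le> integral {0..1} (\<lambda>t. kobayashi_metric \<Omega> (\<gamma> t) (\<gamma>' t))"
proof -
  define X where "X = {LBINT t:{0..1}. kobayashi_metric \<Omega> (h t) (h' t) | h h'. C1_path h h' \<and> h 0 = \<gamma> 0 \<and> h 1 = \<gamma> 1}"
  have X: "kobayashi_dist \<Omega> (\<gamma> 0) (\<gamma> 1) = Inf X"
    unfolding kobayashi_dist_def X_def C1_path_def by (simp only: conj_assoc)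
  have "bdd_below X"
  proof (rule bdd_belowI[of _ 0])
    fix x assume "x \<in> X"
    then obtain h h' where h: "C1_path h h'" "x = (LBINT t:{0..1}. kobayashi_metric \<Omega> (h t) (h' t))"
      unfolding X_def by blast
    note i = set_borel_integral_eq_integral[OF set_integrable_kobayashi[OF h(1)]]
    show "0 \<le> x" unfolding h(2) i(2)
      using h(1) by (intro integral_nonneg i(1) kobayashi_metric_nonneg) (auto simp: C1_path_def)
  qed
  moreover have "integral {0..1} (\<lambda>t. kobayashi_metric \<Omega> (\<gamma> t) (\<gamma>' t)) \<in> X"
    unfolding X_def set_borel_integral_eq_integral(2)[OF set_integrable_kobayashi[OF p], symmetric] using p by blast
  ultimately show ?thesis unfolding X by (rule cInf_lower[rotated])
qed

text \<open>The straight segment is a competing curve: on it the norm is at most twice that at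
  \<open>z\<close>, and the Kobayashi metric at most \<open>Mnorm / cc\<close>.\<close>

lemma polyball_subset_kobayashi_ball:
  assumes z: "z \<in> \<Omega>" and t: "0 < t" "t \<le> cc" "2 * t / cc \<le> artanh r"
  shows "polyball z t \<subseteq> kobayashi_ball \<Omega> z r"
proof
  fix w assume "w \<in> polyball z t"
  then have w: "Mnorm z (w - z) < t" by (simp add: polyball_def)
  then have w\<Omega>: "w \<in> \<Omega>" using t by (intro plump_mem[OF z]) auto
  define \<gamma> where "\<gamma> = (\<lambda>s::real. w + s *\<^sub>R (z - w))"
  have near: "Mnorm z (\<gamma> s - z) \<le> cc" if "s \<in> {0..1}" for s
  proof -
    have "\<gamma> s - z = (1 - s) *\<^sub>R (w - z)" by (simp add: \<gamma>_def algebra_simps)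
    then have "Mnorm z (\<gamma> s - z) = (1 - s) * Mnorm z (w - z)" using that by (simp add: M_scaleR[OF z])
    also have "\<dots> \<le> 1 * Mnorm z (w - z)" using that M_nonneg[OF z] by (intro mult_right_mono) auto
    finally show ?thesis using w t by simp
  qed
  have in\<Omega>: "\<gamma> s \<in> \<Omega>" if "s \<in> {0..1}" for s by (rule plump_mem[OF z near[OF that]])
  have p: "C1_path \<gamma> (\<lambda>_. z - w)"
    unfolding C1_path_def using in\<Omega>
    by (auto simp: \<gamma>_def intro!: derivative_eq_intros continuous_intros)
  have le: "kobayashi_metric \<Omega> (\<gamma> s) (z - w) \<le> 2 * Mnorm z (w - z) / cc" if "s \<in> {0..1}" for s
  proof -
    have "kobayashi_metric \<Omega> (\<gamma> s) (z - w) \<le> Mnorm (\<gamma> s) (z - w) / cc" by (rule kobayashi_metric_le[OF in\<Omega>[OF that]])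
    also have "\<dots> \<le> 2 * Mnorm z (w - z) / cc"
      using plump_le[OF z near[OF that], of "z - w"] cc(1) M_commute[OF z, of z w] by (intro divide_right_mono) auto
    finally show ?thesis .
  qed
  have "kobayashi_dist \<Omega> w z \<le> integral {0..1} (\<lambda>s. kobayashi_metric \<Omega> (\<gamma> s) (z - w))"
    using kobayashi_dist_le_path[OF p] by (simp add: \<gamma>_def)
  also have "\<dots> \<le> integral {0..1} (\<lambda>s::real. 2 * Mnorm z (w - z) / cc)"
    using le set_borel_integral_eq_integral(1)[OF set_integrable_kobayashi[OF p]] by (intro integral_le) auto
  also have "\<dots> = 2 * Mnorm z (w - z) / cc" by simp
  also have "\<dots> < 2 * t / cc" using w cc(1) by (intro divide_strict_right_mono) auto
  finally show "w \<in> kobayashi_ball \<Omega> z r" using w\<Omega> t(3) by (simp add: kobayashi_ball_def)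
qed

text \<open>The curve runs from \<open>w\<close> to the centre, so \<open>short_path\<close>
  measures the displacement in the norm at \<open>w\<close>; changing to the norm at
  \<open>a\<close> doubles \<open>2 * KK * T\<close>.\<close>

lemma kobayashi_ball_subset_polyball:
  assumes a: "a \<in> \<Omega>" and s: "artanh s \<le> T" "2 * KK * T < cc"
  shows "kobayashi_ball \<Omega> a s \<subseteq> polyball a (4 * KK * T)"
proof
  fix w assume "w \<in> kobayashi_ball \<Omega> a s"
  then have w: "w \<in> \<Omega>" "kobayashi_dist \<Omega> w a < T" using s(1) by (auto simp: kobayashi_ball_def)
  obtain \<gamma> \<gamma>' where p: "C1_path \<gamma> \<gamma>'" "\<gamma> 0 = w" "\<gamma> 1 = a"
    "(\<lambda>t. kobayashi_metric \<Omega> (\<gamma> t) (\<gamma>' t)) integrable_on {0..1}"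
    "integral {0..1} (\<lambda>t. kobayashi_metric \<Omega> (\<gamma> t) (\<gamma>' t)) < T"
    using kobayashi_dist_path[OF w(1) a w(2)] by blast
  have lt: "2 * KK * integral {0..1} (\<lambda>t. kobayashi_metric \<Omega> (\<gamma> t) (\<gamma>' t)) < 2 * KK * T"
    using p(5) KK by (intro mult_strict_left_mono) auto
  have "Mnorm (\<gamma> 0) (\<gamma> 1 - \<gamma> 0) \<le> 2 * KK * integral {0..1} (\<lambda>t. kobayashi_metric \<Omega> (\<gamma> t) (\<gamma>' t))"
    using lt s(2) by (intro short_path[OF p(1) _ _ _ p(4)]) auto
  then have wa: "Mnorm w (a - w) < 2 * KK * T" using lt p by simp
  then have "Mnorm w (a - w) \<le> cc" using s(2) by simp
  from plump_le[OF w(1) this, of "a - w"] wa M_commute[OF a, of a w]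
  show "w \<in> polyball a (4 * KK * T)" by (simp add: polyball_def)
qed

lemma near_pow_converse:
  assumes "(x, y) \<in> near s ^^ m" "s \<le> cc"
  shows "(y, x) \<in> near (2 * s) ^^ m"
  using assms(1)
proof (induction m arbitrary: y)
  case (Suc m)
  then obtain v where v: "(x, v) \<in> near s ^^ m" "(v, y) \<in> near s" by auto
  then have v\<Omega>: "v \<in> \<Omega>" and lt: "Mnorm v (y - v) < s" by (auto simp: near_def)
  then have le: "Mnorm v (y - v) \<le> cc" using assms(2) by simp
  have "(y, v) \<in> near (2 * s)"
    using plump_mem[OF v\<Omega> le] plump_le[OF v\<Omega> le, of "y - v"] lt M_commute[OF plump_mem[OF v\<Omega> le], of v y]
    by (simp add: near_def)
  then show ?case using Suc.IH[OF v(1)] by (rule relpow_Suc_I2)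
qed simp

text \<open>Curves end at the centre \<open>z\<close> whereas chains are to start there. Reversing a
  chain doubles its steps, hence \<open>step / 2\<close>.\<close>

lemma kobayashi_ball_subset_chain:
  "\<exists>m. \<forall>z\<in>\<Omega>. kobayashi_ball \<Omega> z r \<subseteq> {x. (z, x) \<in> near step ^^ Suc m}"
proof -
  have st: "0 < step / 2" "step / 2 \<le> cc" using cc(1) by auto
  obtain m :: nat where "2 * KK * artanh r / (step / 2) < m" using reals_Archimedean2 by blast
  then have "2 * KK * artanh r < m * (step / 2)" using st by (simp only: pos_divide_less_eq)
  also have "\<dots> \<le> Suc m * (step / 2)" using st by (intro mult_right_mono) auto
  finally have m: "2 * KK * artanh r < Suc m * (step / 2)" .
  have "(z, w) \<in> near step ^^ Suc m" if z: "z \<in> \<Omega>" and w: "w \<in> kobayashi_ball \<Omega> z r" for z w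
  proof -
    have w': "w \<in> \<Omega>" "kobayashi_dist \<Omega> w z < artanh r" using w by (auto simp: kobayashi_ball_def)
    obtain \<gamma> \<gamma>' where p: "C1_path \<gamma> \<gamma>'" "\<gamma> 0 = w" "\<gamma> 1 = z"
      "(\<lambda>t. kobayashi_metric \<Omega> (\<gamma> t) (\<gamma>' t)) integrable_on {0..1}"
      "integral {0..1} (\<lambda>t. kobayashi_metric \<Omega> (\<gamma> t) (\<gamma>' t)) < artanh r"
      using kobayashi_dist_path[OF w'(1) z w'(2)] by blast
    have "2 * KK * integral {0..1} (\<lambda>t. kobayashi_metric \<Omega> (\<gamma> t) (\<gamma>' t)) < 2 * KK * artanh r"
      using p(5) KK by (intro mult_strict_left_mono) auto
    then have "2 * KK * integral {0..1} (\<lambda>t. kobayashi_metric \<Omega> (\<gamma> t) (\<gamma>' t)) < Suc m * (step / 2)" using m by linarith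
    then have "(\<gamma> 0, \<gamma> 1) \<in> near (step / 2) ^^ Suc m" by (intro path_chain[OF p(1) st p(4)]) auto
    from near_pow_converse[OF this st(2)] show ?thesis using p(2,3) by (simp del: relpow.simps)
  qed
  then show ?thesis by blast
qed

end

section \<open>From Kobayashi balls and boundary distance to polyballs and volumes\<close>

lemma artanh_pos: "0 < artanh r" if "0 < r" "r < 1" for r :: real
  unfolding artanh_def using that by (simp add: ln_gt_zero)

lemma artanh_le_twice: "artanh s \<le> 2 * s" if "0 \<le> s" "s \<le> 1 / 2" for s :: real
proof -
  have "ln ((1 + s) / (1 - s)) \<le> (1 + s) / (1 - s) - 1" using that by (intro ln_le_minus_one) simp
  also have "\<dots> = 2 * s / (1 - s)" using that by (simp add: field_simps)
  also have "\<dots> \<le> 2 * s / (1 / 2)" using that by (intro divide_left_mono) auto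
  finally show ?thesis by (simp add: artanh_def)
qed

lemma powr_comparable:
  fixes x y :: real
  assumes "0 < x" "0 < y" "x \<le> 2 * y" "y \<le> 2 * x"
  shows "x powr \<alpha> \<le> 2 powr \<bar>\<alpha>\<bar> * y powr \<alpha>"
proof (cases "0 \<le> \<alpha>")
  case True
  then have "x powr \<alpha> \<le> (2 * y) powr \<alpha>" using assms by (intro powr_mono2) auto
  then show ?thesis using True assms by (simp add: powr_mult)
next
  case False
  then have "(2 * x) powr \<alpha> \<le> y powr \<alpha>" using assms by (intro powr_mono2') auto
  then have "2 powr \<bar>\<alpha>\<bar> * (2 * x) powr \<alpha> \<le> 2 powr \<bar>\<alpha>\<bar> * y powr \<alpha>" by (rule mult_left_mono) simp
  moreover have "2 powr \<bar>\<alpha>\<bar> * (2 * x) powr \<alpha> = x powr \<alpha>"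
    using False assms by (simp add: powr_mult powr_minus)
  ultimately show ?thesis by simp
qed

context psc_bounds
begin

text \<open>Turns relative density in the Kobayashi ball \<open>Y\<close> into an absolute bound in
  terms of \<open>vol z\<close>: \<open>Y\<close> contains a polyball of fixed radius
  \<open>c0\<close>, so its volume is at least \<open>c0 ^ DIM(complex^'n) * vol z\<close>.\<close>

lemma emeasure_density:
  assumes z: "z \<in> \<Omega>" and c0: "0 < c0" "polyball z c0 \<subseteq> Y" and Y: "Y \<subseteq> {x. (z, x) \<in> near step ^^ Suc m}"
    and A: "A \<subseteq> (\<Union>j::nat. polyball (a j) t)" and a: "\<And>j. a j \<in> \<Omega>"
    and \<gamma>: "0 < \<gamma>" "\<gamma> \<le> measure lebesgue (A \<inter> Y) / measure lebesgue Y"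
  shows "ennreal (\<gamma> * c0 ^ DIM(complex^'n) * vol z) \<le> emeasure lborel ((\<Union>j. polyball (a j) t) \<inter> {x. (z, x) \<in> near step ^^ Suc m})"
proof -
  define N where "N = {x. (z, x) \<in> near step ^^ Suc m}"
  define B where "B = (\<Union>j. polyball (a j) t) \<inter> N"
  have N: "N \<in> sets borel" unfolding N_def by (intro borel_open near_pow_sections)
  have B: "B \<in> sets borel" unfolding B_def by (intro sets.Int N sets.countable_UN image_subsetI polyball_measurable a)
  have "0 < measure lebesgue (A \<inter> Y) / measure lebesgue Y" using \<gamma> by linarith
  then have pos: "0 < measure lebesgue (A \<inter> Y)" "0 < measure lebesgue Y"
    by (auto simp: zero_less_divide_iff not_less measure_nonneg less_le)
  \<comment> \<open>\<open>measure\<close> is 0 on non-measurable sets, so the positive ratio itself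
    forces both sets to be measurable.\<close>
  have Ym: "Y \<in> sets lebesgue" "A \<inter> Y \<in> sets lebesgue" using pos measure_notin_sets by force+
  have le: "emeasure lebesgue X \<le> emeasure lborel Z" if "X \<subseteq> Z" "Z \<in> sets borel" for X Z :: "(complex^'n) set"
  proof -
    have "emeasure lebesgue X \<le> emeasure lebesgue Z" using that by (intro emeasure_mono) auto
    then show ?thesis using that(2) by simp
  qed
  have "emeasure lborel N \<le> ennreal ((2 ^ Suc m * step) ^ DIM(complex^'n) * vol z)"
    unfolding N_def using cc(1) by (intro emeasure_near_pow_right z) auto
  then have Nfin: "emeasure lborel N < \<infinity>" by (rule order.strict_trans1) simp
  have Ye: "emeasure lebesgue Y = ennreal (measure lebesgue Y)"
    using order.strict_trans1[OF le[OF Y[folded N_def] N] Nfin] by (intro emeasure_eq_ennreal_measure) auto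
  have "emeasure lebesgue (A \<inter> Y) \<le> emeasure lborel N" using Y by (intro le N) (auto simp: N_def)
  then have AYe: "emeasure lebesgue (A \<inter> Y) = ennreal (measure lebesgue (A \<inter> Y))"
    using Nfin by (intro emeasure_eq_ennreal_measure) auto
  have "ennreal (c0 ^ DIM(complex^'n) * vol z) = emeasure lebesgue (polyball z c0)"
    using emeasure_polyball[OF z c0(1)] polyball_measurable[OF z] by simp
  also have "\<dots> \<le> ennreal (measure lebesgue Y)" unfolding Ye[symmetric] by (intro emeasure_mono c0 Ym)
  finally have "c0 ^ DIM(complex^'n) * vol z \<le> measure lebesgue Y" by (simp only: ennreal_le_iff measure_nonneg)
  then have "\<gamma> * (c0 ^ DIM(complex^'n) * vol z) \<le> \<gamma> * measure lebesgue Y" using \<gamma>(1) by (intro mult_left_mono) auto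
  also have "\<dots> \<le> measure lebesgue (A \<inter> Y)" using \<gamma>(2) pos(2) by (simp only: pos_le_divide_eq)
  finally have "ennreal (\<gamma> * c0 ^ DIM(complex^'n) * vol z) \<le> emeasure lebesgue (A \<inter> Y)"
    unfolding AYe by (intro ennreal_leI) (simp only: mult.assoc)
  also have "\<dots> \<le> emeasure lborel B" using A Y by (intro le B) (auto simp: B_def N_def)
  finally show ?thesis by (simp only: B_def N_def)
qed

lemma Lp_norm_pow_eq:
  "Lp_norm_pow \<Omega> \<rho> p \<alpha> f = (\<integral>\<^sup>+x. weight f p x * ennreal (\<delta> x powr \<alpha>) \<partial>lborel)"
proof -
  have "ennreal (cmod (f x) powr p * \<bar>\<rho> x\<bar> powr \<alpha>) * indicator \<Omega> x = weight f p x * ennreal (\<delta> x powr \<alpha>)" for x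
    using \<delta>_pos[of x] by (auto simp: weight_def indicator_def \<delta>_def ennreal_mult')
  then show ?thesis unfolding Lp_norm_pow_def by (simp only: nn_integral_completion)
qed

text \<open>The volume contributes \<open>n + 1\<close> powers of the depth and the weight
  \<open>\<alpha>\<close> powers. The total exponent is nonnegative, so the depth may be replaced by
  a multiple of the boundary distance.\<close>

lemma vol_weight_le_dist:
  assumes \<alpha>: "- 1 < \<alpha>"
  obtains K where "0 < K"
    "\<And>z. z \<in> \<Omega> \<Longrightarrow> \<delta> z powr \<alpha> * vol z \<le> K * infdist z (frontier \<Omega>) powr (real CARD('n) + 1 + \<alpha>)"
proof -
  define e where "e = real CARD('n) + 1 + \<alpha>"
  have e: "0 \<le> e" using \<alpha> by (simp add: e_def)
  obtain Cv where Cv: "0 < Cv" "\<And>z. z \<in> \<Omega> \<Longrightarrow> vol z \<le> Cv * \<delta> z ^ (CARD('n) + 1)" using vol_le_depth by blast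
  have "\<delta> z powr \<alpha> * vol z \<le> (Cv * L powr e) * infdist z (frontier \<Omega>) powr e" if z: "z \<in> \<Omega>" for z
  proof -
    have d: "0 < \<delta> z" by (rule \<delta>_pos[OF z])
    have "\<delta> z powr \<alpha> * vol z \<le> \<delta> z powr \<alpha> * (Cv * \<delta> z ^ (CARD('n) + 1))" using Cv(2)[OF z] by (intro mult_left_mono) auto
    also have "\<dots> = Cv * \<delta> z powr e"
      unfolding e_def powr_add using d by (simp add: powr_realpow[symmetric] powr_add mult_ac)
    also have "\<dots> \<le> Cv * (L * infdist z (frontier \<Omega>)) powr e"
      using d e Cv(1) depth_le_dist[OF z] by (intro mult_left_mono powr_mono2) (auto simp: \<delta>_def)
    also have "\<dots> = (Cv * L powr e) * infdist z (frontier \<Omega>) powr e" using pos by (simp add: powr_mult infdist_nonneg)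
    finally show ?thesis .
  qed
  then show thesis using that[of "Cv * L powr e"] Cv(1) pos by (simp add: e_def)
qed

text \<open>The abstract inequality is applied with polyballs of radius
  \<open>t = 4 * KK * (2 * s)\<close>, where \<open>2 * s\<close> bounds \<open>artanh s\<close>,
  and with density \<open>\<gamma> * d\<close> instead of \<open>\<gamma>\<close>, where
  \<open>d\<close> is the loss in \<open>emeasure_density\<close>.\<close>

theorem kobayashi_sampling:
  assumes r: "0 < r" "r < 1" and p: "1 \<le> p" and \<alpha>: "- 1 < \<alpha>"
  shows "\<exists>C q :: real. C > 0 \<and> q > 0 \<and>
    (\<forall>(\<gamma>::real) (s::real) (a :: nat \<Rightarrow> complex^'n).
       0 < \<gamma> \<longrightarrow> \<gamma> \<le> 1 \<longrightarrow> 0 < s \<longrightarrow> s < 1 \<longrightarrow>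
       s < inverse C * \<gamma> powr q \<longrightarrow>
       (\<forall>j. a j \<in> \<Omega>) \<longrightarrow>
       (INF z\<in>\<Omega>. measure lebesgue ((\<Union>j. kobayashi_ball \<Omega> (a j) s) \<inter> kobayashi_ball \<Omega> z r)
                  / measure lebesgue (kobayashi_ball \<Omega> z r)) \<ge> \<gamma> \<longrightarrow>
       (\<forall>f\<in>bergman_space \<Omega> \<rho> p \<alpha>.
          Lp_norm_pow \<Omega> \<rho> p \<alpha> f
          \<le> ennreal C * (\<Sum>j. ennreal (cmod (f (a j)) powr p *
                infdist (a j) (frontier \<Omega>) powr (real CARD('n) + 1 + \<alpha>)))))"
proof -
  define e where "e = real CARD('n) + 1 + \<alpha>"
  define \<omega> where "\<omega> = (\<lambda>z. \<delta> z powr \<alpha>)"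
  obtain m where "\<forall>z\<in>\<Omega>. kobayashi_ball \<Omega> z r \<subseteq> {x. (z, x) \<in> near step ^^ Suc m}"
    using kobayashi_ball_subset_chain[of r] by (rule exE)
  note m = bspec[OF this]
  have "continuous_on \<Omega> \<delta>"
    unfolding \<delta>_def using in_U
    by (intro continuous_on_minus continuous_on_subset[OF C2_fun.continuous_on_fun[OF C2_\<rho>]]) auto
  then have \<omega>_cont: "continuous_on \<Omega> \<omega>"
    unfolding \<omega>_def using \<delta>_pos by (intro continuous_on_powr continuous_on_const) force+
  have \<omega>_pos: "0 < \<omega> z" if "z \<in> \<Omega>" for z using \<delta>_pos[OF that] by (simp add: \<omega>_def)
  have b: "1 \<le> 2 powr \<bar>\<alpha>\<bar>" by (rule ge_one_powr_ge_zero) auto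
  have \<omega>_le: "\<omega> w \<le> 2 powr \<bar>\<alpha>\<bar> * \<omega> z \<and> \<omega> z \<le> 2 powr \<bar>\<alpha>\<bar> * \<omega> w" if z: "z \<in> \<Omega>" and w: "Mnorm z (w - z) \<le> cc" for z w
    using Mnorm_near[OF z w] \<delta>_pos[OF z] \<delta>_pos[of w] unfolding \<omega>_def by (intro conjI powr_comparable) auto
  define S where "S = (\<lambda>C q. \<forall>\<gamma> t a f. 0 < \<gamma> \<longrightarrow> \<gamma> \<le> 1 \<longrightarrow> 0 < t \<longrightarrow> t < inverse C * \<gamma> powr q \<longrightarrow>
     (\<forall>j::nat. a j \<in> \<Omega>) \<longrightarrow>
    (\<forall>z\<in>\<Omega>. ennreal (\<gamma> * vol z) \<le> emeasure lborel ((\<Union>j. polyball (a j) t) \<inter> {x. (z, x) \<in> near step ^^ Suc m})) \<longrightarrow>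
    holomorphic_Cn f \<Omega> \<longrightarrow> (\<integral>\<^sup>+x. weight f p x * ennreal (\<omega> x) \<partial>lborel) < \<infinity> \<longrightarrow>
    (\<integral>\<^sup>+x. weight f p x * ennreal (\<omega> x) \<partial>lborel)
      \<le> ennreal C * (\<Sum>j. ennreal (cmod (f (a j)) powr p * (\<omega> (a j) * vol (a j)))))"
  have "\<exists>C>0. \<exists>q>0. S C q"
    unfolding S_def by (rule sampling_inequality[OF \<omega>_cont \<omega>_pos b \<omega>_le p])
  then obtain C0 q where C0: "0 < C0" and q: "0 < q" and "S C0 q" by blast
  note sampling = \<open>S C0 q\<close>[unfolded S_def, rule_format]
  obtain K where K: "0 < K" "\<And>z. z \<in> \<Omega> \<Longrightarrow> \<omega> z * vol z \<le> K * infdist z (frontier \<Omega>) powr e"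
    using vol_weight_le_dist[OF \<alpha>] unfolding \<omega>_def e_def by blast
  \<comment> \<open>The radius of a polyball contained in every
    \<open>kobayashi_ball \<Omega> z r\<close>.\<close>
  define c0 where "c0 = min cc (cc * artanh r / 2)"
  have c0: "0 < c0" "c0 \<le> cc" "2 * c0 / cc \<le> artanh r"
  proof -
    show "0 < c0" using cc(1) artanh_pos[OF r] by (simp add: c0_def)
    have "c0 \<le> cc * artanh r / 2" by (simp add: c0_def)
    then show "2 * c0 / cc \<le> artanh r" using cc(1) by (simp add: pos_divide_le_eq mult.commute)
  qed (simp add: c0_def)
  define d where "d = c0 ^ DIM(complex^'n)"
  have d: "0 < d" "d \<le> 1" using c0 cc(2) by (auto simp: d_def intro!: power_le_one)
  \<comment> \<open>In this order the summands bound the final factor, bring \<open>t\<close> below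
    the threshold of the abstract inequality, keep \<open>t\<close> below \<open>cc\<close>, and
    give \<open>s \<le> 1/2\<close> for \<open>artanh_le_twice\<close>.\<close>
  define C where "C = C0 * K + 8 * KK * C0 / d powr q + 8 * KK / cc + 2"
  have terms: "0 < C0 * K" "0 < 8 * KK * C0 / d powr q" "0 < 8 * KK / cc"
    using C0 K(1) KK cc(1) d(1) by auto
  then have C: "0 < C" "C0 * K \<le> C" "8 * KK * C0 / d powr q \<le> C" "8 * KK / cc \<le> C" "2 \<le> C" by (auto simp: C_def)
  have main: "Lp_norm_pow \<Omega> \<rho> p \<alpha> f
      \<le> ennreal C * (\<Sum>j. ennreal (cmod (f (a j)) powr p * infdist (a j) (frontier \<Omega>) powr e))"
    if \<gamma>: "0 < \<gamma>" "\<gamma> \<le> 1" and s: "0 < s" "s < inverse C * \<gamma> powr q" and a: "\<forall>j. a j \<in> \<Omega>"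
      and inf: "\<gamma> \<le> (INF z\<in>\<Omega>. measure lebesgue ((\<Union>j. kobayashi_ball \<Omega> (a j) s) \<inter> kobayashi_ball \<Omega> z r)
                  / measure lebesgue (kobayashi_ball \<Omega> z r))"
      and f: "f \<in> bergman_space \<Omega> \<rho> p \<alpha>" for \<gamma> s f and a :: "nat \<Rightarrow> complex^'n"
  proof -
    have Cs: "C * s < \<gamma> powr q" using s(2) C(1) by (simp add: field_simps)
    have small: "x * s < \<gamma> powr q" if "x \<le> C" for x
      using mult_right_mono[OF that, of s] s(1) Cs by linarith
    have "\<gamma> powr q \<le> 1 powr q" using \<gamma> q by (intro powr_mono2) auto
    then have g1: "\<gamma> powr q \<le> 1" by simp
    have s2: "s \<le> 1 / 2" using small[OF C(5)] g1 by linarith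
    have "8 * KK / cc * s < 1" using small[OF C(4)] g1 by linarith
    then have "8 * KK * s < cc" using cc(1) by (simp add: field_simps)
    then have Tcc: "2 * KK * (2 * s) < cc" using mult_pos_pos[OF KK s(1)] by simp
    have "8 * KK * C0 / d powr q * s < \<gamma> powr q" by (rule small[OF C(3)])
    then have tC: "4 * KK * (2 * s) < inverse C0 * (\<gamma> * d) powr q"
      using C0 d(1) \<gamma>(1) by (simp add: powr_mult field_simps)
    have t0: "0 < 4 * KK * (2 * s)" using KK s(1) by simp
    have cover: "(\<Union>j. kobayashi_ball \<Omega> (a j) s) \<subseteq> (\<Union>j. polyball (a j) (4 * KK * (2 * s)))"
      using s(1) s2 Tcc a by (intro UN_mono kobayashi_ball_subset_polyball artanh_le_twice) auto
    have dens: "ennreal (\<gamma> * d * vol z) \<le> emeasure lborel ((\<Union>j. polyball (a j) (4 * KK * (2 * s))) \<inter> {x. (z, x) \<in> near step ^^ Suc m})"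
      if z: "z \<in> \<Omega>" for z
      unfolding d_def
    proof (rule emeasure_density[OF z c0(1) polyball_subset_kobayashi_ball[OF z c0] m[OF z] cover _ \<gamma>(1)])
      show "\<gamma> \<le> measure lebesgue ((\<Union>j. kobayashi_ball \<Omega> (a j) s) \<inter> kobayashi_ball \<Omega> z r) / measure lebesgue (kobayashi_ball \<Omega> z r)"
        by (rule order_trans[OF inf cINF_lower[OF bdd_belowI[of _ 0] z]]) auto
    qed (use a in auto)
    have hol: "holomorphic_Cn f \<Omega>" and fin: "(\<integral>\<^sup>+x. weight f p x * ennreal (\<omega> x) \<partial>lborel) < \<infinity>"
      using f by (auto simp: bergman_space_def Lp_norm_pow_eq \<omega>_def)
    have "Lp_norm_pow \<Omega> \<rho> p \<alpha> f = (\<integral>\<^sup>+x. weight f p x * ennreal (\<omega> x) \<partial>lborel)"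
      by (simp add: Lp_norm_pow_eq \<omega>_def)
    also have "\<dots> \<le> ennreal C0 * (\<Sum>j. ennreal (cmod (f (a j)) powr p * (\<omega> (a j) * vol (a j))))"
    proof (rule sampling[where \<gamma> = "\<gamma> * d" and t = "4 * KK * (2 * s)"])
      show "0 < \<gamma> * d" using \<gamma>(1) d(1) by simp
      show "\<gamma> * d \<le> 1" using \<gamma> d by (simp add: mult_le_one)
      show "a j \<in> \<Omega>" for j using a by simp
    qed (rule t0 tC dens hol fin; assumption?)+
    also have "\<dots> \<le> ennreal C0 * (\<Sum>j. ennreal K * ennreal (cmod (f (a j)) powr p * infdist (a j) (frontier \<Omega>) powr e))"
    proof (intro mult_left_mono suminf_le summableI)
      fix j
      have "cmod (f (a j)) powr p * (\<omega> (a j) * vol (a j)) \<le> cmod (f (a j)) powr p * (K * infdist (a j) (frontier \<Omega>) powr e)"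
        using K(2) a by (intro mult_left_mono) auto
      then show "ennreal (cmod (f (a j)) powr p * (\<omega> (a j) * vol (a j)))
          \<le> ennreal K * ennreal (cmod (f (a j)) powr p * infdist (a j) (frontier \<Omega>) powr e)"
        using K(1) by (simp only: ennreal_mult'[symmetric] less_imp_le) (simp add: mult_ac ennreal_leI)
    qed auto
    also have "\<dots> = ennreal (C0 * K) * (\<Sum>j. ennreal (cmod (f (a j)) powr p * infdist (a j) (frontier \<Omega>) powr e))"
      using C0 K(1) by (simp add: ennreal_mult mult.assoc)
    also have "\<dots> \<le> ennreal C * (\<Sum>j. ennreal (cmod (f (a j)) powr p * infdist (a j) (frontier \<Omega>) powr e))"
      using C(2) by (intro mult_right_mono ennreal_leI) auto
    finally show ?thesis .
  qed
  show ?thesis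
    by (rule exI[of _ C], rule exI[of _ q], intro conjI allI impI ballI C(1) q, rule main[unfolded e_def])
qed

end

theorem theorem3:
  fixes \<Omega> :: "(complex^'n::finite) set" and \<rho> :: "complex^'n \<Rightarrow> real"
    and r p \<alpha> :: real
  assumes "strongly_pseudoconvex \<Omega> \<rho>"
    and "0 < r" "r < 1" and "1 \<le> p" and "-1 < \<alpha>"
  shows "\<exists>C q :: real. C > 0 \<and> q > 0 \<and>
    (\<forall>(\<gamma>::real) (s::real) (a :: nat \<Rightarrow> complex^'n).
       0 < \<gamma> \<longrightarrow> \<gamma> \<le> 1 \<longrightarrow> 0 < s \<longrightarrow> s < 1 \<longrightarrow>
       s < inverse C * \<gamma> powr q \<longrightarrow>
       (\<forall>j. a j \<in> \<Omega>) \<longrightarrow>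
       (INF z\<in>\<Omega>. measure lebesgue ((\<Union>j. kobayashi_ball \<Omega> (a j) s) \<inter> kobayashi_ball \<Omega> z r)
                  / measure lebesgue (kobayashi_ball \<Omega> z r)) \<ge> \<gamma> \<longrightarrow>
       (\<forall>f\<in>bergman_space \<Omega> \<rho> p \<alpha>.
          Lp_norm_pow \<Omega> \<rho> p \<alpha> f
          \<le> ennreal C * (\<Sum>j. ennreal (cmod (f (a j)) powr p *
                infdist (a j) (frontier \<Omega>) powr (real CARD('n) + 1 + \<alpha>)))))"
proof -
  obtain U L \<eta> \<kappa> where "psc_bounds \<Omega> \<rho> U L \<eta> \<kappa>" by (rule strongly_pseudoconvex_bounds[OF assms(1)])
  then interpret psc_bounds \<Omega> \<rho> U L \<eta> \<kappa> .
  show ?thesis by (rule kobayashi_sampling[OF assms(2-5)])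
qed

end
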